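(* Let $(\mathbb{A},u_0)$ be a core pointed graph of groups with finite underlying graph and finitely generated vertex and edge groups. Suppose that, for each vertex $u$, the vertex group $A_u$ has the f.c.i.p. relative to the collection $\{\alpha_e(A_e)\}_{e\in\mathrm{Star}(u)}$ of adjacent edge groups, and that $\pi_1(\mathbb{A},u_0)$ has the f.g.i.p. relative to every edge subgroup of $\mathbb{A}$. Then: (1) $\pi_1(\mathbb{A},u_0)$ has the f.g.i.p. if each vertex group of $\mathbb{A}$ has the f.g.i.p. (2) $\pi_1(\mathbb{A},u_0)$ has the s.f.g.i.p. if each vertex group of $\mathbb{A}$ has the s.f.g.i.p. and $\mathbb{A}$ is acylindrical.
   Context: Conventions: $H^g=g^{-1}Hg$; $B\backslash G/C$ is the set of double cosets $BhC$. Graphs of groups. A graph has an edge inversion $e\mapsto e^{-1}$ (fixpoint-free), origin and target maps $o,t$ with $t(e^{-1})=o(e)$; $\mathrm{Star}(u)=\{e:o(e)=u\}$. A graph of groups $\mathbb A$ has vertex groups $A_u$, edge groups $A_e=A_{e^{-1}}$ and monomorphisms $\alpha_e\colon A_e\to A_{o(e)}$, $\omega_e\colon A_e\to A_{t(e)}$ with $\alpha_{e^{-1}}=\omega_e$. An $\mathbb A$-path from $u$ to $u'$ is a sequence $p=(a_0,e_1,a_1,\dots,e_k,a_k)$ where $(e_1,\dots,e_k)$ is a path from $u$ to $u'$, $a_{i-1}\in A_{o(e_i)}$ and $a_k\in A_{t(e_k)}$ (length $k$). It is reduced if for all $1\le i<k$, either $e_{i+1}\ne e_i^{-1}$ or $a_i\notin\omega_{e_i}(A_{e_i})$.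 $\mathbb A$-paths are considered up to the congruence generated by $(1,e,\omega_e(x),e^{-1},1)=(\alpha_e(x))$; the classes of closed $\mathbb A$-paths at $u_0$ form $\pi_1(\mathbb A,u_0)$. $(\mathbb A,u_0)$ is core if every vertex and edge lies on a reduced closed $\mathbb A$-path at $u_0$. The edge subgroups of $\mathbb A$ are the subgroups $p\,\alpha_e(A_e)\,p^{-1}\le\pi_1(\mathbb A,u_0)$ with $e$ an edge and $p$ an $\mathbb A$-path from $u_0$ to $o(e)$. $\mathbb A$ is $k$-acylindrical ($k\ge1$) if for every reduced $\mathbb A$-path $p$ of length $k$ and every non-trivial $a\in A_{t(p)}$ ($t(p)$ the terminal and $o(p)$ the initial vertex of $p$), the $\mathbb A$-path $pap^{-1}$ does not reduce to an element of $A_{o(p)}$; it is acylindrical if it is $k$-acylindrical for some $k$. Intersection properties. $G$ has the f.g.i.p. if the intersection of any two finitely generated subgroups is finitely generated; $G$ has the f.g.i.p. relative to a subgroup $H$ if $K\cap H$ is finitely generated for every finitely generated $K\le G$; $G$ has the s.f.g.i.p. if it has the f.g.i.p. and for all finitely generated $H,K\le G$ there are finitely many double cosets $HgK$ with $H^g\cap K\ne1$. f.c.i.p. For finitely generated subgroups $A,B,C\le G$ and $f,g\in G$, let $q^A_{f,g}\colon (A\cap B^f)\backslash A/(A\cap C^g)\to B\backslash G/C$ be the (well-defined) map $(A\cap B^f)a(A\cap C^g)\mapsto B\,fag^{-1}\,C$. $G$ has the f.c.i.p. relative to a collection (indexed family) $\mathcal A$ of finitely generated subgroups if for every pair $B,C$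 of finitely generated subgroups of $G$ and every choice, for each $A\in\mathcal A$, of finite sets $\mathcal F_A,\mathcal G_A\subset G$ whose elements lie in pairwise distinct $(B,A)$-, respectively $(C,A)$-double cosets, $$\sum_{BhC\in B\backslash G/C}\max\Big\{0,\Big(\sum_{A\in\mathcal A}\ \sum_{f\in\mathcal F_A,\,g\in\mathcal G_A}\big|(q^A_{f,g})^{-1}(BhC)\big|\Big)-1\Big\}<\infty .$$ *)

theory Defs
  imports
    "HOL-Algebra.Generated_Groups"
    "HOL-Analysis.Analysis"
    "Graph_Theory.Bidirected_Digraph"
    "Graph_Theory.Arc_Walk"
begin

section \<open>Finitely generated subgroups and double cosets\<close>

definition fg_subgroup :: "('a, 'm) monoid_scheme \<Rightarrow> 'a set \<Rightarrow> bool" where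
  "fg_subgroup G H \<longleftrightarrow> (\<exists>S. finite S \<and> S \<subseteq> carrier G \<and> H = generate G S)"

definition fg_group :: "('a, 'm) monoid_scheme \<Rightarrow> bool" where
  "fg_group G \<longleftrightarrow> group G \<and> fg_subgroup G (carrier G)"

definition conj_set :: "('a, 'm) monoid_scheme \<Rightarrow> 'a set \<Rightarrow> 'a \<Rightarrow> 'a set" where
  "conj_set G H g = (inv\<^bsub>G\<^esub> g <#\<^bsub>G\<^esub> H) #>\<^bsub>G\<^esub> g"

definition dcoset :: "('a, 'm) monoid_scheme \<Rightarrow> 'a set \<Rightarrow> 'a \<Rightarrow> 'a set \<Rightarrow> 'a set" where
  "dcoset G B h C = (B #>\<^bsub>G\<^esub> h) <#>\<^bsub>G\<^esub> C"

definition dcosets :: "('a, 'm) monoid_scheme \<Rightarrow> 'a set \<Rightarrow> 'a set \<Rightarrow> 'a set \<Rightarrow> 'a set set" where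
  "dcosets G B A C = (\<lambda>a. dcoset G B a C) ` A"


section \<open>Intersection properties\<close>

definition fgip :: "('a, 'm) monoid_scheme \<Rightarrow> bool" where
  "fgip G \<longleftrightarrow> (\<forall>H K. fg_subgroup G H \<and> fg_subgroup G K \<longrightarrow> fg_subgroup G (H \<inter> K))"

definition fgip_rel :: "('a, 'm) monoid_scheme \<Rightarrow> 'a set \<Rightarrow> bool" where
  "fgip_rel G H \<longleftrightarrow> (\<forall>K. fg_subgroup G K \<longrightarrow> fg_subgroup G (K \<inter> H))"

definition sfgip :: "('a, 'm) monoid_scheme \<Rightarrow> bool" where
  "sfgip G \<longleftrightarrow> fgip G \<and>
     (\<forall>H K. fg_subgroup G H \<and> fg_subgroup G K \<longrightarrow>
        finite {dcoset G H g K | g. g \<in> carrier G \<and> conj_set G H g \<inter> K \<noteq> {\<one>\<^bsub>G\<^esub>}})"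

text \<open>
  \<open>q_map G B C f g\<close>, restricted to \<open>q_dom G A B C f g\<close>, is the map
  \<open>(A \<inter> B\<^sup>f) a (A \<inter> C\<^sup>g) \<mapsto> B (f a g\<^sup>-\<^sup>1) C\<close>; by \<open>q_map_dcoset\<close> it does not depend on the choice
  of the representative \<open>a\<close>.
\<close>

definition q_dom :: "('a, 'm) monoid_scheme \<Rightarrow> 'a set \<Rightarrow> 'a set \<Rightarrow> 'a set \<Rightarrow> 'a \<Rightarrow> 'a \<Rightarrow> 'a set set" where
  "q_dom G A B C f g = dcosets G (A \<inter> conj_set G B f) A (A \<inter> conj_set G C g)"

definition q_map :: "('a, 'm) monoid_scheme \<Rightarrow> 'a set \<Rightarrow> 'a set \<Rightarrow> 'a \<Rightarrow> 'a \<Rightarrow> 'a set \<Rightarrow> 'a set" where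
  "q_map G B C f g D = the_elem ((\<lambda>a. dcoset G B (f \<otimes>\<^bsub>G\<^esub> a \<otimes>\<^bsub>G\<^esub> inv\<^bsub>G\<^esub> g) C) ` D)"

lemma q_map_dcoset:
  assumes G: "group G" and A: "subgroup A G" and B: "subgroup B G" and C: "subgroup C G"
    and f: "f \<in> carrier G" and g: "g \<in> carrier G" and a: "a \<in> A"
  shows "q_map G B C f g (dcoset G (A \<inter> conj_set G B f) a (A \<inter> conj_set G C g)) =
    dcoset G B (f \<otimes>\<^bsub>G\<^esub> a \<otimes>\<^bsub>G\<^esub> inv\<^bsub>G\<^esub> g) C"
proof -
  interpret group G by fact
  interpret A: subgroup A G by fact
  interpret B: subgroup B G by fact
  interpret C: subgroup C G by fact
  let ?D = "dcoset G (A \<inter> conj_set G B f) a (A \<inter> conj_set G C g)"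
  note [simp] = f g
  have ac[simp]: "a \<in> carrier G" using a by (rule A.mem_carrier)
  have one: "\<one>\<^bsub>G\<^esub> \<in> conj_set G H h" if "subgroup H G" "h \<in> carrier G" for H h
    using that subgroup.one_closed[OF that(1)]
    by (force simp: conj_set_def l_coset_def r_coset_def)
  have "\<one>\<^bsub>G\<^esub> \<in> A \<inter> conj_set G B f" "\<one>\<^bsub>G\<^esub> \<in> A \<inter> conj_set G C g"
    using one[OF B f] one[OF C g] A.one_closed by blast+
  moreover have "a = \<one>\<^bsub>G\<^esub> \<otimes>\<^bsub>G\<^esub> a \<otimes>\<^bsub>G\<^esub> \<one>\<^bsub>G\<^esub>" by simp
  ultimately have aD: "a \<in> ?D"
    unfolding dcoset_def r_coset_def set_mult_def by blast
  have "dcoset G B (f \<otimes>\<^bsub>G\<^esub> a' \<otimes>\<^bsub>G\<^esub> inv\<^bsub>G\<^esub> g) C = dcoset G B (f \<otimes>\<^bsub>G\<^esub> a \<otimes>\<^bsub>G\<^esub> inv\<^bsub>G\<^esub> g) C"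
    if "a' \<in> ?D" for a'
  proof -
    from that obtain b c where bc: "b \<in> B" "c \<in> C"
      and a': "a' = (inv\<^bsub>G\<^esub> f \<otimes>\<^bsub>G\<^esub> b \<otimes>\<^bsub>G\<^esub> f) \<otimes>\<^bsub>G\<^esub> a \<otimes>\<^bsub>G\<^esub> (inv\<^bsub>G\<^esub> g \<otimes>\<^bsub>G\<^esub> c \<otimes>\<^bsub>G\<^esub> g)"
      unfolding dcoset_def r_coset_def set_mult_def conj_set_def l_coset_def by auto
    have [simp]: "b \<in> carrier G" "c \<in> carrier G" using bc by auto
    have eq: "f \<otimes>\<^bsub>G\<^esub> a' \<otimes>\<^bsub>G\<^esub> inv\<^bsub>G\<^esub> g = b \<otimes>\<^bsub>G\<^esub> (f \<otimes>\<^bsub>G\<^esub> a \<otimes>\<^bsub>G\<^esub> inv\<^bsub>G\<^esub> g) \<otimes>\<^bsub>G\<^esub> c"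
    proof -
      have 1: "f \<otimes>\<^bsub>G\<^esub> (inv\<^bsub>G\<^esub> f \<otimes>\<^bsub>G\<^esub> y) = y" if "y \<in> carrier G" for y
        using that by (simp add: m_assoc[symmetric])
      show ?thesis unfolding a' by (simp add: m_assoc 1)
    qed
    have "B #>\<^bsub>G\<^esub> (b \<otimes>\<^bsub>G\<^esub> h) = B #>\<^bsub>G\<^esub> h" if "h \<in> carrier G" for h
      using coset_mult_assoc[of B b h] coset_join2[OF _ B bc(1)] that B.subset by simp
    moreover have "c <#\<^bsub>G\<^esub> C = C"
      using coset_join3[OF _ C bc(2)] by simp
    moreover have "B #>\<^bsub>G\<^esub> (y \<otimes>\<^bsub>G\<^esub> c) <#>\<^bsub>G\<^esub> C = B #>\<^bsub>G\<^esub> y <#>\<^bsub>G\<^esub> (c <#\<^bsub>G\<^esub> C)"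
      if "y \<in> carrier G" for y
      using that coset_mult_assoc[of B y c] rcos_assoc_lcos[of "B #>\<^bsub>G\<^esub> y" C c] B.subset C.subset
      by (simp add: r_coset_subset_G)
    ultimately show ?thesis unfolding eq dcoset_def by simp
  qed
  with aD have "(\<lambda>x. dcoset G B (f \<otimes>\<^bsub>G\<^esub> x \<otimes>\<^bsub>G\<^esub> inv\<^bsub>G\<^esub> g) C) ` ?D =
    {dcoset G B (f \<otimes>\<^bsub>G\<^esub> a \<otimes>\<^bsub>G\<^esub> inv\<^bsub>G\<^esub> g) C}" by blast
  then show ?thesis unfolding q_map_def by simp
qed

definition q_fibre ::
  "('a, 'm) monoid_scheme \<Rightarrow> 'a set \<Rightarrow> 'a set \<Rightarrow> 'a set \<Rightarrow> 'a \<Rightarrow> 'a \<Rightarrow> 'a set \<Rightarrow> 'a set set" where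
  "q_fibre G A B C f g E = {D \<in> q_dom G A B C f g. q_map G B C f g D = E}"

text \<open>
  Fibres may be infinite, so cardinalities are taken in \<^typ>\<open>ennreal\<close> (\<open>card\<close> would return \<open>0\<close>).
  All sums are sums of nonnegative extended reals and hence unconditionally defined.
\<close>

definition fcip_rel :: "('a, 'm) monoid_scheme \<Rightarrow> 'i set \<Rightarrow> ('i \<Rightarrow> 'a set) \<Rightarrow> bool" where
  "fcip_rel G I \<A> \<longleftrightarrow>
     (\<forall>B C \<F> \<G>.
        fg_subgroup G B \<and> fg_subgroup G C \<and>
        (\<forall>i\<in>I. finite (\<F> i) \<and> \<F> i \<subseteq> carrier G \<and> inj_on (\<lambda>f. dcoset G B f (\<A> i)) (\<F> i)) \<and>
        (\<forall>i\<in>I. finite (\<G> i) \<and> \<G> i \<subseteq> carrier G \<and> inj_on (\<lambda>g. dcoset G C g (\<A> i)) (\<G> i)) \<longrightarrow>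
        (\<Sum>\<^sub>\<infinity>E\<in>dcosets G B (carrier G) C.
           max 0 ((\<Sum>\<^sub>\<infinity>i\<in>I. \<Sum>f\<in>\<F> i. \<Sum>g\<in>\<G> i.
              emeasure (count_space UNIV) (q_fibre G (\<A> i) B C f g E)) - 1)) < (\<infinity> :: ennreal))"


section \<open>Graphs of groups\<close>

text \<open>
  The underlying graph is a directed multigraph with a fixpoint-free edge inversion, i.e. a
  \<^locale>\<open>bidirected_digraph\<close>; \<open>tail\<close> and \<open>head\<close> are the origin and target maps.
  All vertex groups have their carriers in one type, and so have all edge groups. The carriers
  need not be disjoint, so this is no restriction on the groups involved.
\<close>

record ('v, 'e, 'a, 'b) graph_of_groups =
  ugraph :: "('v, 'e) pre_digraph"
  einv :: "'e \<Rightarrow> 'e"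
  vgroup :: "'v \<Rightarrow> 'a monoid"
  egroup :: "'e \<Rightarrow> 'b monoid"
  alpha :: "'e \<Rightarrow> 'b \<Rightarrow> 'a"

abbreviation "gverts A \<equiv> verts (ugraph A)"
abbreviation "gedges A \<equiv> arcs (ugraph A)"
abbreviation "org A \<equiv> tail (ugraph A)"
abbreviation "trg A \<equiv> head (ugraph A)"

definition omega :: "('v, 'e, 'a, 'b) graph_of_groups \<Rightarrow> 'e \<Rightarrow> 'b \<Rightarrow> 'a" where
  "omega A e = alpha A (einv A e)"

locale graph_of_groups =
  bidirected_digraph "ugraph A" "einv A" for A :: "('v, 'e, 'a, 'b) graph_of_groups" +
  assumes vgroup: "u \<in> gverts A \<Longrightarrow> group (vgroup A u)"
    and egroup: "e \<in> gedges A \<Longrightarrow> group (egroup A e)"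
    and egroup_inv: "e \<in> gedges A \<Longrightarrow> egroup A (einv A e) = egroup A e"
    and alpha_mon: "e \<in> gedges A \<Longrightarrow> alpha A e \<in> mon (egroup A e) (vgroup A (org A e))"

definition star :: "('v, 'e, 'a, 'b) graph_of_groups \<Rightarrow> 'v \<Rightarrow> 'e set" where
  "star A u = {e \<in> gedges A. org A e = u}"

definition edge_image :: "('v, 'e, 'a, 'b) graph_of_groups \<Rightarrow> 'e \<Rightarrow> 'a set" where
  "edge_image A e = alpha A e ` carrier (egroup A e)"


subsection \<open>Paths\<close>

text \<open>The path \<open>(a\<^sub>0, e\<^sub>1, a\<^sub>1, \<dots>, e\<^sub>k, a\<^sub>k)\<close> is encoded as \<open>(a\<^sub>0, [(e\<^sub>1, a\<^sub>1), \<dots>, (e\<^sub>k, a\<^sub>k)])\<close>.\<close>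

type_synonym ('e, 'a) apath = "'a \<times> ('e \<times> 'a) list"

definition path_edges :: "('e, 'a) apath \<Rightarrow> 'e list" where
  "path_edges p = map fst (snd p)"

definition is_apath ::
  "('v, 'e, 'a, 'b) graph_of_groups \<Rightarrow> 'v \<Rightarrow> ('e, 'a) apath \<Rightarrow> 'v \<Rightarrow> bool" where
  "is_apath A u p v \<longleftrightarrow>
     pre_digraph.awalk (ugraph A) u (path_edges p) v \<and>
     fst p \<in> carrier (vgroup A u) \<and>
     (\<forall>(e, a)\<in>set (snd p). a \<in> carrier (vgroup A (trg A e)))"

definition reduced :: "('v, 'e, 'a, 'b) graph_of_groups \<Rightarrow> ('e, 'a) apath \<Rightarrow> bool" where
  "reduced A p \<longleftrightarrow>
     (\<forall>i. Suc i < length (snd p) \<longrightarrow>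
        fst (snd p ! Suc i) \<noteq> einv A (fst (snd p ! i)) \<or>
        snd (snd p ! i) \<notin>
          omega A (fst (snd p ! i)) ` carrier (egroup A (fst (snd p ! i))))"

text \<open>
  The vertex argument of \<open>path_mult\<close> is the common endpoint at which the two paths are
  composed, that of \<open>path_inv\<close> is the initial vertex; they select the vertex group in which to
  multiply or invert.
\<close>

fun path_mult ::
  "('v, 'e, 'a, 'b) graph_of_groups \<Rightarrow> 'v \<Rightarrow> ('e, 'a) apath \<Rightarrow> ('e, 'a) apath \<Rightarrow> ('e, 'a) apath" where
  "path_mult A v (a, []) (b, ys) = (a \<otimes>\<^bsub>vgroup A v\<^esub> b, ys)"
| "path_mult A v (a, (e, a') # xs) q = (let (c, zs) = path_mult A v (a', xs) q in (a, (e, c) # zs))"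

fun path_inv ::
  "('v, 'e, 'a, 'b) graph_of_groups \<Rightarrow> 'v \<Rightarrow> ('e, 'a) apath \<Rightarrow> ('e, 'a) apath" where
  "path_inv A u (a, []) = (inv\<^bsub>vgroup A u\<^esub> a, [])"
| "path_inv A u (a, (e, a') # xs) =
     (let (c, zs) = path_inv A (trg A e) (a', xs) in (c, zs @ [(einv A e, inv\<^bsub>vgroup A u\<^esub> a)]))"

definition path_conj ::
  "('v, 'e, 'a, 'b) graph_of_groups \<Rightarrow> 'v \<Rightarrow> ('e, 'a) apath \<Rightarrow> 'v \<Rightarrow> 'a \<Rightarrow> ('e, 'a) apath" where
  "path_conj A u p v a = path_mult A v (path_mult A v p (a, [])) (path_inv A u p)"

text \<open>\<open>path_cong A u v\<close> is the generated congruence on the paths from \<open>u\<close> to \<open>v\<close>.\<close>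

inductive path_cong ::
  "('v, 'e, 'a, 'b) graph_of_groups \<Rightarrow> 'v \<Rightarrow> 'v \<Rightarrow> ('e, 'a) apath \<Rightarrow> ('e, 'a) apath \<Rightarrow> bool"
  for A where
  base: "\<lbrakk>e \<in> gedges A; x \<in> carrier (egroup A e)\<rbrakk> \<Longrightarrow>
     path_cong A (org A e) (org A e)
       (\<one>\<^bsub>vgroup A (org A e)\<^esub>, [(e, omega A e x), (einv A e, \<one>\<^bsub>vgroup A (org A e)\<^esub>)])
       (alpha A e x, [])"
| refl: "is_apath A u p v \<Longrightarrow> path_cong A u v p p"
| sym: "path_cong A u v p q \<Longrightarrow> path_cong A u v q p"
| trans: "\<lbrakk>path_cong A u v p q; path_cong A u v q r\<rbrakk> \<Longrightarrow> path_cong A u v p r"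
| mult: "\<lbrakk>path_cong A u v p p'; path_cong A v w q q'\<rbrakk> \<Longrightarrow>
     path_cong A u w (path_mult A v p q) (path_mult A v p' q')"


subsection \<open>The fundamental group\<close>

definition path_class ::
  "('v, 'e, 'a, 'b) graph_of_groups \<Rightarrow> 'v \<Rightarrow> ('e, 'a) apath \<Rightarrow> ('e, 'a) apath set" where
  "path_class A u p = {q. path_cong A u u p q}"

definition pi1 :: "('v, 'e, 'a, 'b) graph_of_groups \<Rightarrow> 'v \<Rightarrow> ('e, 'a) apath set monoid" where
  "pi1 A u =
     \<lparr>carrier = path_class A u ` {p. is_apath A u p u},
      monoid.mult = (\<lambda>X Y. \<Union>p\<in>X. \<Union>q\<in>Y. path_class A u (path_mult A u p q)),
      one = path_class A u (\<one>\<^bsub>vgroup A u\<^esub>, [])\<rparr>"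

lemma is_apath_Nil:
  "is_apath A u (a, []) v \<longleftrightarrow> u \<in> gverts A \<and> u = v \<and> a \<in> carrier (vgroup A u)"
  by (auto simp: is_apath_def path_edges_def pre_digraph.awalk_def pre_digraph.cas.simps)

context graph_of_groups begin

lemma alpha_closed: "e \<in> gedges A \<Longrightarrow> x \<in> carrier (egroup A e) \<Longrightarrow> alpha A e x \<in> carrier (vgroup A (org A e))"
  using alpha_mon[of e] by (auto simp: mon_def hom_def)

lemma omega_closed: "e \<in> gedges A \<Longrightarrow> x \<in> carrier (egroup A e) \<Longrightarrow> omega A e x \<in> carrier (vgroup A (trg A e))"
  using alpha_closed[of "einv A e" x] by (simp add: omega_def egroup_inv)

lemma alpha_one: "e \<in> gedges A \<Longrightarrow> alpha A e \<one>\<^bsub>egroup A e\<^esub> = \<one>\<^bsub>vgroup A (org A e)\<^esub>"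
  using hom_one[of "alpha A e" "egroup A e" "vgroup A (org A e)"] alpha_mon[of e] egroup[of e] vgroup[of "org A e"]
  by (auto simp: mon_def)

lemma vgroup_closed [simp]:
  assumes "u \<in> gverts A"
  shows "\<one>\<^bsub>vgroup A u\<^esub> \<in> carrier (vgroup A u)"
    and "a \<in> carrier (vgroup A u) \<Longrightarrow> inv\<^bsub>vgroup A u\<^esub> a \<in> carrier (vgroup A u)"
    and "a \<in> carrier (vgroup A u) \<Longrightarrow> b \<in> carrier (vgroup A u) \<Longrightarrow>
      a \<otimes>\<^bsub>vgroup A u\<^esub> b \<in> carrier (vgroup A u)"
proof -
  interpret group "vgroup A u" using assms by (rule vgroup)
  show "\<one>\<^bsub>vgroup A u\<^esub> \<in> carrier (vgroup A u)"
    and "a \<in> carrier (vgroup A u) \<Longrightarrow> inv\<^bsub>vgroup A u\<^esub> a \<in> carrier (vgroup A u)"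
    and "a \<in> carrier (vgroup A u) \<Longrightarrow> b \<in> carrier (vgroup A u) \<Longrightarrow>
      a \<otimes>\<^bsub>vgroup A u\<^esub> b \<in> carrier (vgroup A u)" by simp_all
qed

lemma is_apath_Cons:
  "is_apath A u (a, (e, b) # xs) v \<longleftrightarrow>
     a \<in> carrier (vgroup A u) \<and> e \<in> gedges A \<and> u = org A e \<and> is_apath A (trg A e) (b, xs) v"
  by (auto simp: is_apath_def path_edges_def awalk_Cons_iff)

lemma is_apath_verts: "is_apath A u p v \<Longrightarrow> u \<in> gverts A \<and> v \<in> gverts A"
  by (auto simp: is_apath_def)

lemma is_apath_mult: "is_apath A u p v \<Longrightarrow> is_apath A v q w \<Longrightarrow> is_apath A u (path_mult A v p q) w"
proof -
  obtain a xs where p: "p = (a, xs)" by force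
  assume "is_apath A u p v" and q: "is_apath A v q w"
  then show ?thesis unfolding p
  proof (induction xs arbitrary: a u)
    case Nil
    obtain b ys where [simp]: "q = (b, ys)" by force
    have u: "u = v" "u \<in> gverts A" "a \<in> carrier (vgroup A u)" using Nil by (auto simp: is_apath_Nil)
    show ?case using Nil u by (auto simp: is_apath_def path_edges_def)
  next
    case (Cons x xs)
    obtain e b where [simp]: "x = (e, b)" by force
    obtain c zs where cz: "path_mult A v (b, xs) q = (c, zs)" by force
    show ?case using Cons.IH[of "trg A e" b] Cons.prems
      by (auto simp: is_apath_Cons cz)
  qed
qed

lemma path_mult_assoc:
  assumes "is_apath A u p v" "is_apath A v q w" "is_apath A w r x"
  shows "path_mult A w (path_mult A v p q) r = path_mult A v p (path_mult A w q r)"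
proof -
  obtain a xs where p: "p = (a, xs)" by force
  from assms(1) show ?thesis unfolding p
  proof (induction xs arbitrary: a u)
    case Nil
    obtain b ys where q[simp]: "q = (b, ys)" by force
    have v: "v \<in> gverts A" "a \<in> carrier (vgroup A v)" using Nil by (auto simp: is_apath_Nil)
    interpret group "vgroup A v" using v vgroup by blast
    have b: "b \<in> carrier (vgroup A v)" using assms(2) by (auto simp: is_apath_def)
    show ?case
    proof (cases ys)
      case [simp]: Nil
      obtain c zs where [simp]: "r = (c, zs)" by force
      have [simp]: "w = v" using assms(2) by (simp add: is_apath_Nil)
      have "c \<in> carrier (vgroup A v)" using assms(3) by (auto simp: is_apath_def)
      then show ?thesis using v b by (simp add: m_assoc)
    next
      case (Cons y ys')
      then show ?thesis by (cases y) (simp split: prod.splits)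
    qed
  next
    case (Cons x xs)
    obtain e b where [simp]: "x = (e, b)" by force
    obtain c ys where c: "path_mult A v (b, xs) q = (c, ys)" by force
    show ?case using Cons.IH[of "trg A e" b] Cons.prems
      by (cases "path_mult A w (c, ys) r") (simp add: is_apath_Cons c)
  qed
qed

lemma is_apath_one: "u \<in> gverts A \<Longrightarrow> is_apath A u (\<one>\<^bsub>vgroup A u\<^esub>, []) u"
  using vgroup[of u] by (simp add: is_apath_Nil group.is_monoid)

lemma path_mult_one: "is_apath A u p v \<Longrightarrow> path_mult A u (\<one>\<^bsub>vgroup A u\<^esub>, []) p = p"
  using vgroup[of u] is_apath_verts[of u p v]
  by (cases p) (auto simp: is_apath_def group.is_monoid)

lemma path_cong_is_apath:
  "path_cong A u v p q \<Longrightarrow> is_apath A u p v \<and> is_apath A u q v"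
proof (induction rule: path_cong.induct)
  case (base e x)
  then show ?case using vgroup[of "org A e"] vgroup[of "trg A e"]
    by (auto simp: is_apath_Cons is_apath_Nil alpha_closed omega_closed group.is_monoid)
qed (auto intro: is_apath_mult)

lemma path_mult_snoc:
  assumes "is_apath A u p v" "a \<in> carrier (vgroup A w)" "w \<in> gverts A" "v = trg A e'" "e' \<in> gedges A" "w = org A e'"
  shows "path_mult A v p (\<one>\<^bsub>vgroup A v\<^esub>, [(einv A e', a)]) = (fst p, snd p @ [(einv A e', a)])"
proof -
  obtain b xs where p: "p = (b, xs)" by force
  from assms(1) show ?thesis unfolding p
  proof (induction xs arbitrary: b u)
    case Nil
    then show ?case using vgroup[of v] by (auto simp: is_apath_Nil group.is_monoid)
  next
    case (Cons x xs)
    then show ?case by (cases x) (auto simp: is_apath_Cons split: prod.splits)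
  qed
qed

lemma is_apath_inv: "is_apath A u p v \<Longrightarrow> is_apath A v (path_inv A u p) u"
  and path_inv_cong: "is_apath A u p v \<Longrightarrow>
    path_cong A v v (path_mult A u (path_inv A u p) p) (\<one>\<^bsub>vgroup A v\<^esub>, [])"
proof -
  obtain a xs where p: "p = (a, xs)" by force
  assume "is_apath A u p v"
  then have "is_apath A v (path_inv A u p) u \<and> path_cong A v v (path_mult A u (path_inv A u p) p) (\<one>\<^bsub>vgroup A v\<^esub>, [])"
    unfolding p
  proof (induction xs arbitrary: a u)
    case Nil
    then have uv: "u = v" "u \<in> gverts A" "a \<in> carrier (vgroup A u)" by (auto simp: is_apath_Nil)
    then interpret group "vgroup A v" using vgroup by blast
    show ?case using uv by (auto simp: is_apath_Nil intro!: path_cong.refl)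
  next
    case (Cons x xs)
    obtain e b where [simp]: "x = (e, b)" by force
    from Cons.prems have a: "a \<in> carrier (vgroup A u)" and e: "e \<in> gedges A" and u: "u = org A e"
      and q: "is_apath A (trg A e) (b, xs) v" by (auto simp: is_apath_Cons)
    let ?t = "trg A e" and ?q = "(b, xs)"
    have uG: "u \<in> gverts A" and tG: "?t \<in> gverts A" using e u by auto
    interpret U: group "vgroup A u" using uG by (rule vgroup)
    interpret T: group "vgroup A ?t" using tG by (rule vgroup)
    define qi where "qi = path_inv A ?t ?q"
    from Cons.IH[OF q] have qi: "is_apath A v qi ?t"
      and qq: "path_cong A v v (path_mult A ?t qi ?q) (\<one>\<^bsub>vgroup A v\<^esub>, [])" by (auto simp: qi_def)
    let ?r = "(\<one>\<^bsub>vgroup A ?t\<^esub>, [(einv A e, inv\<^bsub>vgroup A u\<^esub> a)])"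
    let ?s = "(a, [(e, \<one>\<^bsub>vgroup A ?t\<^esub>)])"
    have r: "is_apath A ?t ?r u" using e u uG a by (simp add: is_apath_Cons is_apath_Nil)
    have s: "is_apath A u ?s ?t" using e u uG a by (simp add: is_apath_Cons is_apath_Nil)
    have inv: "path_inv A u (a, x # xs) = path_mult A ?t qi ?r"
      using path_mult_snoc[OF qi _ uG HOL.refl e u, of "inv\<^bsub>vgroup A u\<^esub> a"] a
      by (simp add: qi_def split: prod.splits)
    have p: "(a, x # xs) = path_mult A ?t ?s ?q"
      using q by (auto simp: is_apath_def)
    have rs: "path_mult A u ?r ?s = (\<one>\<^bsub>vgroup A ?t\<^esub>, [(einv A e, \<one>\<^bsub>vgroup A u\<^esub>), (e, \<one>\<^bsub>vgroup A ?t\<^esub>)])"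
      using a by simp
    have "path_cong A ?t ?t (path_mult A u ?r ?s) (\<one>\<^bsub>vgroup A ?t\<^esub>, [])"
      unfolding rs using path_cong.base[of "einv A e" A "\<one>\<^bsub>egroup A e\<^esub>"] e u
        alpha_one[of e] alpha_one[of "einv A e"] egroup[of e]
      by (simp add: omega_def egroup_inv group.is_monoid monoid.one_closed)
    from path_cong.mult[OF this path_cong.refl[OF q]]
    have "path_cong A ?t v (path_mult A ?t (path_mult A u ?r ?s) ?q) ?q"
      using path_mult_one[OF q] by simp
    from path_cong.mult[OF path_cong.refl[OF qi] this]
    have "path_cong A v v (path_mult A ?t qi (path_mult A ?t (path_mult A u ?r ?s) ?q))
       (path_mult A ?t qi ?q)" .
    then have "path_cong A v v (path_mult A u (path_mult A ?t qi ?r) (path_mult A ?t ?s ?q))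
       (path_mult A ?t qi ?q)"
      using path_mult_assoc[OF r s q] path_mult_assoc[OF qi r is_apath_mult[OF s q]] by simp
    then have "path_cong A v v (path_mult A u (path_inv A u (a, x # xs)) (a, x # xs))
       (\<one>\<^bsub>vgroup A v\<^esub>, [])" using path_cong.trans[OF _ qq] unfolding inv unfolding p by blast
    moreover have "is_apath A v (path_inv A u (a, x # xs)) u" unfolding inv
      using is_apath_mult[OF qi r] .
    ultimately show ?case by blast
  qed
  then show "is_apath A v (path_inv A u p) u"
    "path_cong A v v (path_mult A u (path_inv A u p) p) (\<one>\<^bsub>vgroup A v\<^esub>, [])" by blast+
qed

lemma path_class_eq_iff:
  assumes "is_apath A u p u"
  shows "path_class A u p = path_class A u q \<longleftrightarrow> path_cong A u u p q"
proof
  assume "path_class A u p = path_class A u q"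
  moreover have "p \<in> path_class A u p" using assms by (simp add: path_class_def path_cong.refl)
  ultimately show "path_cong A u u p q" by (simp add: path_class_def path_cong.sym)
next
  assume "path_cong A u u p q"
  then show "path_class A u p = path_class A u q"
    unfolding path_class_def by (blast intro: path_cong.sym path_cong.trans)
qed

lemma pi1_mult_class:
  assumes p: "is_apath A u p u" and q: "is_apath A u q u"
  shows "path_class A u p \<otimes>\<^bsub>pi1 A u\<^esub> path_class A u q = path_class A u (path_mult A u p q)"
proof -
  have "path_class A u (path_mult A u p' q') = path_class A u (path_mult A u p q)"
    if "p' \<in> path_class A u p" "q' \<in> path_class A u q" for p' q'
    using that path_cong.mult[of A u u p p' u q q'] is_apath_mult[OF p q]
    by (metis mem_Collect_eq path_class_def path_class_eq_iff)
  moreover have "p \<in> path_class A u p" "q \<in> path_class A u q"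
    using p q by (auto simp: path_class_def intro: path_cong.refl)
  ultimately show ?thesis unfolding pi1_def by fastforce
qed

lemma group_pi1:
  assumes u: "u \<in> gverts A"
  shows "group (pi1 A u)"
proof (rule groupI)
  have car: "carrier (pi1 A u) = path_class A u ` {p. is_apath A u p u}"
    and one: "\<one>\<^bsub>pi1 A u\<^esub> = path_class A u (\<one>\<^bsub>vgroup A u\<^esub>, [])" by (simp_all add: pi1_def)
  show "\<one>\<^bsub>pi1 A u\<^esub> \<in> carrier (pi1 A u)" using is_apath_one[OF u] by (auto simp: car one)
  fix x y z
  assume "x \<in> carrier (pi1 A u)"
  then obtain p where p: "is_apath A u p u" and x: "x = path_class A u p" by (auto simp: car)
  show "\<one>\<^bsub>pi1 A u\<^esub> \<otimes>\<^bsub>pi1 A u\<^esub> x = x"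
    using p by (simp add: x one pi1_mult_class is_apath_one u path_mult_one)
  show "\<exists>y\<in>carrier (pi1 A u). y \<otimes>\<^bsub>pi1 A u\<^esub> x = \<one>\<^bsub>pi1 A u\<^esub>"
  proof
    show "path_class A u (path_inv A u p) \<in> carrier (pi1 A u)" using is_apath_inv[OF p] by (auto simp: car)
    show "path_class A u (path_inv A u p) \<otimes>\<^bsub>pi1 A u\<^esub> x = \<one>\<^bsub>pi1 A u\<^esub>"
      using p is_apath_inv[OF p] path_inv_cong[OF p]
      by (simp add: x one pi1_mult_class path_class_eq_iff is_apath_mult)
  qed
  assume "y \<in> carrier (pi1 A u)"
  then obtain q where q: "is_apath A u q u" and y: "y = path_class A u q" by (auto simp: car)
  show "x \<otimes>\<^bsub>pi1 A u\<^esub> y \<in> carrier (pi1 A u)"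
    using p q is_apath_mult[OF p q] by (auto simp: x y pi1_mult_class car)
  assume "z \<in> carrier (pi1 A u)"
  then obtain r where r: "is_apath A u r u" and z: "z = path_class A u r" by (auto simp: car)
  show "x \<otimes>\<^bsub>pi1 A u\<^esub> y \<otimes>\<^bsub>pi1 A u\<^esub> z = x \<otimes>\<^bsub>pi1 A u\<^esub> (y \<otimes>\<^bsub>pi1 A u\<^esub> z)"
    using p q r path_mult_assoc[OF p q r] by (simp add: x y z pi1_mult_class is_apath_mult)
qed

end

definition edge_subgroups ::
  "('v, 'e, 'a, 'b) graph_of_groups \<Rightarrow> 'v \<Rightarrow> ('e, 'a) apath set set set" where
  "edge_subgroups A u =
     {(\<lambda>a. path_class A u (path_conj A u p (org A e) a)) ` edge_image A e | p e.
        e \<in> gedges A \<and> is_apath A u p (org A e)}"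

definition core :: "('v, 'e, 'a, 'b) graph_of_groups \<Rightarrow> 'v \<Rightarrow> bool" where
  "core A u \<longleftrightarrow>
     (\<forall>v\<in>gverts A. \<exists>p. is_apath A u p u \<and> reduced A p \<and>
        v \<in> set (pre_digraph.awalk_verts (ugraph A) u (path_edges p))) \<and>
     (\<forall>e\<in>gedges A. \<exists>p. is_apath A u p u \<and> reduced A p \<and> e \<in> set (path_edges p))"

text \<open>
  A path from \<open>u\<close> to \<open>u\<close> reduces to an element \<open>b\<close> of the vertex group at \<open>u\<close> if it is congruent
  to the path \<open>(b)\<close> of length \<open>0\<close>.
\<close>

definition k_acylindrical :: "nat \<Rightarrow> ('v, 'e, 'a, 'b) graph_of_groups \<Rightarrow> bool" where
  "k_acylindrical k A \<longleftrightarrow>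
     (\<forall>u v p a. is_apath A u p v \<and> reduced A p \<and> length (path_edges p) = k \<and>
        a \<in> carrier (vgroup A v) \<and> a \<noteq> \<one>\<^bsub>vgroup A v\<^esub> \<longrightarrow>
        \<not> (\<exists>b\<in>carrier (vgroup A u). path_cong A u u (path_conj A u p v a) (b, [])))"

definition acylindrical :: "('v, 'e, 'a, 'b) graph_of_groups \<Rightarrow> bool" where
  "acylindrical A \<longleftrightarrow> (\<exists>k\<ge>1. k_acylindrical k A)"

end

theory Submission
  imports Defs
begin

text \<open>
  The argument is Bass-Serre theory. The group \<open>G = \<pi>\<^sub>1(\<A>, u\<^sub>0)\<close> acts without inversions on the
  Bass-Serre tree; the stabilisers of vertices are copies of the vertex groups \<open>A\<^sub>u\<close>, and the edges
  of type \<open>e\<close> at such a vertex correspond to the cosets of \<open>\<alpha>\<^sub>e(A\<^sub>e)\<close> in \<open>A\<^sub>u\<close>. A finitely generated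
  subgroup \<open>H\<close> preserves a subtree \<open>X\<close> with finitely many \<open>H\<close>-orbits of vertices and edges
  (\<open>exists_cofinite_subtree\<close>). As \<open>H\<close> meets every edge stabiliser in a finitely generated group,
  the vertex stabilisers of \<open>H\<close> in \<open>X\<close> are finitely generated as well (\<open>fg_stab_of_fg\<close>), so that the
  f.c.i.p. of the vertex groups may be applied to them.

  Let \<open>K\<close> be a second finitely generated subgroup with subtree \<open>Y\<close>, and consider the disjoint union
  \<open>\<Gamma>\<close>, over all double cosets \<open>HgK\<close>, of the quotients of \<open>g\<^sup>-\<^sup>1X \<inter> Y\<close> by \<open>g\<^sup>-\<^sup>1Hg \<inter> K\<close>. The vertices of
  \<open>\<Gamma>\<close> over given orbits in \<open>X\<close> and \<open>Y\<close> are double cosets \<open>BaC\<close> in \<open>A\<^sub>u\<close>, where \<open>B\<close> and \<open>C\<close> are the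
  stabilisers in \<open>H\<close> and \<open>K\<close>, and the number of edges of \<open>\<Gamma>\<close> at \<open>BaC\<close> is exactly the sum of fibre
  sizes in the definition of the f.c.i.p. Hence all but finitely many vertices of \<open>\<Gamma>\<close> have degree
  at most 1, and all degrees are finite (\<open>finite_branching\<close>). A connected graph with this property is
  finite (\<open>cofinite_subtree_if_cofinite_branching\<close>).

  For (1) take \<open>g = 1\<close>: the group \<open>H \<inter> K\<close> acts on the tree \<open>X \<inter> Y\<close> with finite quotient, and its
  vertex stabilisers are finitely generated by the f.g.i.p. of the vertex groups; so \<open>H \<inter> K\<close> is
  finitely generated (\<open>fg_of_fg_stabs\<close>).

  For (2) let \<open>g\<^sup>-\<^sup>1Hg \<inter> K\<close> be non-trivial. If one of its non-trivial elements fixes a vertex of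
  \<open>g\<^sup>-\<^sup>1X \<inter> Y\<close>, the s.f.g.i.p. of the vertex groups leaves finitely many possibilities for \<open>HgK\<close>. If it
  acts freely on the vertices of the non-empty tree \<open>g\<^sup>-\<^sup>1X \<inter> Y\<close>, then this tree is neither a vertex
  nor an edge, so the component of \<open>\<Gamma>\<close> has a vertex of degree at least 2, and there are finitely many
  of those. If \<open>g\<^sup>-\<^sup>1X\<close> and \<open>Y\<close> are disjoint, the group fixes the bridge between them pointwise, and
  acylindricity bounds the length of the bridge by some \<open>k\<close>. This last case is excluded beforehand by
  adding to \<open>X\<close>, \<open>k\<close> times, all adjacent edges with non-trivial stabiliser in \<open>H\<close>; by the s.f.g.i.p.
  there are finitely many orbits of them (\<open>cofinite_collar\<close>).

  The tree itself is made of normal forms of \<open>\<A>\<close>-paths. That congruence classes have unique normal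
  forms (\<open>path_cong_iff_nf\<close>) follows by letting paths act on normal forms from the right, and the
  tree structure is then the one given by prefixes of words.
\<close>

section \<open>Finitely generated subgroups\<close>

context group begin

lemma inv_cancel_left [simp]:
  "x \<in> carrier G \<Longrightarrow> y \<in> carrier G \<Longrightarrow> inv x \<otimes> (x \<otimes> y) = y"
  "x \<in> carrier G \<Longrightarrow> y \<in> carrier G \<Longrightarrow> x \<otimes> (inv x \<otimes> y) = y"
  by (simp_all add: m_assoc[symmetric])

lemma fg_subgroup_imp_subgroup: "fg_subgroup G H \<Longrightarrow> subgroup H G"
  by (auto simp: fg_subgroup_def intro: generate_is_subgroup)

lemma fg_subgroup_generate: "finite S \<Longrightarrow> S \<subseteq> carrier G \<Longrightarrow> fg_subgroup G (generate G S)"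
  by (auto simp: fg_subgroup_def)

text \<open>
  The parts are typically vertex stabilisers, of which only finite generation is known; quantifying
  over the subgroups \<open>M\<close> that contain them avoids any choice of generators in applications.
\<close>

lemma fg_subgroupI_parts:
  assumes L: "subgroup L G" and fin: "finite \<S>"
    and parts: "\<And>S. S \<in> \<S> \<Longrightarrow> fg_subgroup G S" "\<And>S. S \<in> \<S> \<Longrightarrow> S \<subseteq> L"
    and gen: "\<And>M. subgroup M G \<Longrightarrow> (\<And>S. S \<in> \<S> \<Longrightarrow> S \<subseteq> M) \<Longrightarrow> L \<subseteq> M"
  shows "fg_subgroup G L"
proof -
  have "\<forall>S\<in>\<S>. \<exists>T. finite T \<and> T \<subseteq> carrier G \<and> S = generate G T"
    using parts(1) by (auto simp: fg_subgroup_def)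
  then obtain T where T: "\<And>S. S \<in> \<S> \<Longrightarrow> finite (T S) \<and> T S \<subseteq> carrier G \<and> S = generate G (T S)"
    by metis
  let ?U = "\<Union>S\<in>\<S>. T S"
  have U: "finite ?U" "?U \<subseteq> carrier G" using fin T by blast+
  have TS: "T S \<subseteq> S" if "S \<in> \<S>" for S
    using T[OF that] generate.incl[of _ "T S" G] by blast
  have "L \<subseteq> generate G ?U"
  proof (rule gen)
    show "subgroup (generate G ?U) G" using U by (intro generate_is_subgroup)
    fix S assume S: "S \<in> \<S>"
    then have "generate G (T S) \<subseteq> generate G ?U" by (intro mono_generate) blast
    with T[OF S] show "S \<subseteq> generate G ?U" by simp
  qed
  moreover have "generate G ?U \<subseteq> L"
    by (rule generate_subgroup_incl[OF _ L]) (use TS parts(2) in blast)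
  ultimately show ?thesis using U unfolding fg_subgroup_def by blast
qed

lemma fg_subgroup_cyclic: "x \<in> carrier G \<Longrightarrow> fg_subgroup G (generate G {x})"
  by (rule fg_subgroup_generate) auto

end

lemma (in group_hom) fg_subgroup_image: "fg_subgroup G K \<Longrightarrow> fg_subgroup H (h ` K)"
  unfolding fg_subgroup_def using generate_img by (metis finite_imageI hom_closed image_subset_iff subset_iff)

text \<open>
  This moves finite generation of stabilisers in the fundamental group back into the vertex groups.
\<close>

lemma (in group_hom) fg_subgroup_vimage:
  assumes "inj_on h (carrier G)" "fg_subgroup H K" "K \<subseteq> h ` carrier G"
  shows "fg_subgroup G {a \<in> carrier G. h a \<in> K}"
proof -
  obtain S where S: "finite S" "S \<subseteq> carrier H" "K = generate H S" using assms(2) by (auto simp: fg_subgroup_def)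
  have SK: "S \<subseteq> K" using S(3) generate.incl[of _ S H] by blast
  then obtain S' where S': "S' \<subseteq> carrier G" "finite S'" "S = h ` S'"
    using finite_subset_image[OF S(1), of h "carrier G"] assms(3) by blast
  have K: "K = h ` generate G S'" using generate_img[OF S'(1)] S S' by simp
  have "generate G S' \<subseteq> carrier G" using S'(1) by (rule G.generate_incl)
  with K assms(1) have "{a \<in> carrier G. h a \<in> K} = generate G S'" by (auto simp: inj_on_def)
  then show ?thesis using S' by (simp add: G.fg_subgroup_generate)
qed

section \<open>Reduced walks and trees\<close>

fun no_backtrack :: "'v list \<Rightarrow> bool" where
  "no_backtrack (x # y # z # zs) \<longleftrightarrow> x \<noteq> z \<and> no_backtrack (y # z # zs)"
| "no_backtrack _ \<longleftrightarrow> True"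

definition walk :: "('v \<times> 'v) set \<Rightarrow> 'v list \<Rightarrow> bool" where
  "walk R xs \<longleftrightarrow> xs \<noteq> [] \<and> successively (\<lambda>x y. (x, y) \<in> R) xs"

lemma walk_simps [simp]:
  "\<not> walk R []" "walk R [x]" "walk R (x # y # zs) \<longleftrightarrow> (x, y) \<in> R \<and> walk R (y # zs)"
  by (auto simp: walk_def)

lemma walk_Cons: "walk R (x # xs) \<longleftrightarrow> xs = [] \<or> (x, hd xs) \<in> R \<and> walk R xs"
  by (cases xs) auto

lemma no_backtrack_Cons:
  "no_backtrack (x # xs) \<longleftrightarrow> no_backtrack xs \<and> (length xs \<ge> 2 \<longrightarrow> x \<noteq> xs ! 1)"
  by (cases xs; cases "tl xs") (auto simp: neq_Nil_conv)

lemma no_backtrack_join: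
  "no_backtrack (xs @ [x]) \<Longrightarrow> no_backtrack (x # ys) \<Longrightarrow>
    (xs \<noteq> [] \<Longrightarrow> ys \<noteq> [] \<Longrightarrow> last xs \<noteq> hd ys) \<Longrightarrow> no_backtrack (xs @ x # ys)"
proof (induction xs rule: no_backtrack.induct)
  case ("2_2" a)
  then show ?case by (cases ys) auto
next
  case ("2_3" a b)
  then show ?case by (cases ys) auto
qed auto

lemma no_backtrack_append:
  "no_backtrack (xs @ ys) \<Longrightarrow> no_backtrack xs \<and> no_backtrack ys"
  by (induction xs) (auto simp: no_backtrack_Cons nth_append split: if_splits)

lemma no_backtrack_rev [simp]: "no_backtrack (rev xs) \<longleftrightarrow> no_backtrack xs"
proof -
  have "no_backtrack (rev xs)" if "no_backtrack xs" for xs :: "'b list" using that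
  proof (induction xs rule: no_backtrack.induct)
    case (1 x y z zs)
    then have "no_backtrack (rev zs @ [z, y])" "x \<noteq> z" by auto
    then have "no_backtrack ((rev zs @ [z]) @ y # [x])" by (auto intro: no_backtrack_join[of "rev zs @ [z]" y "[x]", simplified])
    then show ?case by simp
  qed auto
  from this[of xs] this[of "rev xs"] show ?thesis by auto
qed

lemma walk_append:
  assumes "xs \<noteq> []" "ys \<noteq> []"
  shows "walk R (xs @ ys) \<longleftrightarrow> walk R xs \<and> walk R ys \<and> (last xs, hd ys) \<in> R"
  using assms by (auto simp: walk_def successively_append_iff)

lemma walk_rev: "sym R \<Longrightarrow> walk R (rev xs) \<longleftrightarrow> walk R xs"
  by (auto simp: walk_def successively_rev sym_def elim: successively_mono)

lemma walk_mono: "walk R xs \<Longrightarrow> R \<subseteq> S \<Longrightarrow> walk S xs"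
  by (auto simp: walk_def elim: successively_mono)

lemma walk_imp_rtrancl: "walk R xs \<Longrightarrow> (hd xs, last xs) \<in> R\<^sup>*"
  by (induction xs) (auto simp: walk_Cons intro: converse_rtrancl_into_rtrancl)

text \<open>
  Walks are reduced by cancelling \<open>x, z, x\<close> to \<open>x\<close>, which only deletes steps. Therefore the relation
  can be arbitrary, and for a subgraph of a tree the geodesic lies in the subgraph.
\<close>

lemma reduced_walk_exists:
  assumes "(x, y) \<in> R\<^sup>*"
  shows "\<exists>xs. walk R xs \<and> no_backtrack xs \<and> hd xs = x \<and> last xs = y"
  using assms
proof (induction rule: converse_rtrancl_induct)
  case base
  show ?case by (rule exI[of _ "[y]"]) simp
next
  case (step x z)
  then obtain xs where xs: "walk R xs" "no_backtrack xs" "hd xs = z" "last xs = y" by blast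
  show ?case
  proof (cases "length xs \<ge> 2 \<and> x = xs ! 1")
    case True
    then obtain zs where "xs = z # x # zs" using xs(3)
      by (cases xs; cases "tl xs") auto
    with xs show ?thesis by (intro exI[of _ "x # zs"]) (auto simp: no_backtrack_Cons)
  next
    case False
    with xs step(1) show ?thesis
      by (intro exI[of _ "x # xs"]) (auto simp: walk_Cons no_backtrack_Cons)
  qed
qed

lemma rtrancl_map:
  "(x, y) \<in> R\<^sup>* \<Longrightarrow> (\<And>x y. (x, y) \<in> R \<Longrightarrow> (f x, f y) \<in> S) \<Longrightarrow> (f x, f y) \<in> S\<^sup>*"
  by (induction rule: rtrancl_induct) (auto intro: rtrancl_into_rtrancl)

text \<open>
  A closed reduced walk being trivial says that there are no cycles; it also excludes loops, as
  \<open>[x, x]\<close> would be such a walk.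
\<close>

locale tree =
  fixes V :: "'v set" and adj :: "('v \<times> 'v) set"
  assumes adj_in_V: "adj \<subseteq> V \<times> V"
    and sym_adj: "sym adj"
    and connected: "x \<in> V \<Longrightarrow> y \<in> V \<Longrightarrow> (x, y) \<in> adj\<^sup>*"
    and closed_walk_backtracks:
      "walk adj xs \<Longrightarrow> no_backtrack xs \<Longrightarrow> hd xs = last xs \<Longrightarrow> length xs = 1"
begin

lemma adj_sym: "(x, y) \<in> adj \<Longrightarrow> (y, x) \<in> adj"
  using sym_adj by (auto simp: sym_def)

text \<open>
  If two reduced walks from \<open>x\<close> part at their first step, going back along one and forth along the
  other never backtracks, but is closed.
\<close>

lemma reduced_walk_unique:
  assumes "walk adj xs" "no_backtrack xs" "walk adj ys" "no_backtrack ys"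
    and "hd xs = hd ys" "last xs = last ys"
  shows "xs = ys"
  using assms
proof (induction xs arbitrary: ys)
  case (Cons x xs)
  then obtain ys' where ys: "ys = x # ys'" by (cases ys) auto
  show ?case
  proof (cases "xs = [] \<or> ys' = []")
    case True
    then show ?thesis
    proof
      assume "xs = []"
      with Cons.prems(5,6) have "hd ys = last ys" by simp
      from closed_walk_backtracks[OF Cons.prems(3,4) this] \<open>xs = []\<close> show ?thesis by (simp add: ys)
    next
      assume "ys' = []"
      with Cons.prems(5,6) ys have "hd (x # xs) = last (x # xs)" by (simp only: list.sel last.simps simp_thms if_True)
      from closed_walk_backtracks[OF Cons.prems(1,2) this] \<open>ys' = []\<close> show ?thesis by (simp add: ys)
    qed
  next
    case False
    show ?thesis
    proof (cases "hd xs = hd ys'")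
      case True
      with False show ?thesis using Cons.prems Cons.IH[of ys']
        by (auto simp: ys walk_Cons no_backtrack_Cons)
    next
      case ne: False
      let ?zs = "rev xs @ x # ys'"
      have "walk adj (rev (x # xs))" using Cons.prems(1) walk_rev[OF sym_adj] by blast
      then have "walk adj ?zs" using Cons.prems(3) False
        by (auto simp: walk_append walk_Cons ys)
      moreover have "no_backtrack (rev (x # xs))" using Cons.prems(2) by (simp only: no_backtrack_rev)
      then have "no_backtrack ?zs" using Cons.prems(4) ne ys False
        by (auto intro!: no_backtrack_join simp: last_rev)
      moreover have "hd ?zs = last ?zs" using Cons.prems(6) ys False by (auto simp: hd_append hd_rev)
      ultimately have "length ?zs = 1" by (rule closed_walk_backtracks)
      with False show ?thesis by auto
    qed
  qed
qed auto

text \<open>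
  The unique reduced walk between the two points is a walk in both relations. This is why
  intersections of subtrees are connected.
\<close>

lemma rtrancl_Int:
  assumes "R \<subseteq> adj" "S \<subseteq> adj" "(x, y) \<in> R\<^sup>*" "(x, y) \<in> S\<^sup>*"
  shows "(x, y) \<in> (R \<inter> S)\<^sup>*"
proof -
  obtain xs where xs: "walk R xs" "no_backtrack xs" "hd xs = x" "last xs = y"
    using reduced_walk_exists[OF assms(3)] by blast
  obtain ys where ys: "walk S ys" "no_backtrack ys" "hd ys = x" "last ys = y"
    using reduced_walk_exists[OF assms(4)] by blast
  have "xs = ys" using xs ys assms(1,2) by (intro reduced_walk_unique) (auto intro: walk_mono)
  with xs ys have "walk (R \<inter> S) xs" by (auto simp: walk_def successively_conv_nth)
  then show ?thesis using walk_imp_rtrancl xs by fastforce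
qed

text \<open>
  An edge is the reduced walk between its ends. So a set of edges that connects its vertices
  contains all edges between them, and finiteness of the set of edge orbits of a subtree has to be
  known only for some connecting set of edges.
\<close>

lemma edge_in_connecting_relation:
  assumes "R \<subseteq> adj" "(x, y) \<in> R\<^sup>*" "(x, y) \<in> adj"
  shows "(x, y) \<in> R"
proof -
  obtain xs where xs: "walk R xs" "no_backtrack xs" "hd xs = x" "last xs = y"
    using reduced_walk_exists[OF assms(2)] by blast
  have "xs = [x, y]" using xs assms by (intro reduced_walk_unique) (auto intro: walk_mono)
  with xs show ?thesis by simp
qed

definition edges_in :: "'v set \<Rightarrow> ('v \<times> 'v) set" where
  "edges_in X = adj \<inter> X \<times> X"

definition subtree :: "'v set \<Rightarrow> bool" where
  "subtree X \<longleftrightarrow> X \<subseteq> V \<and> (\<forall>x\<in>X. \<forall>y\<in>X. (x, y) \<in> (edges_in X)\<^sup>*)"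

lemma subtree_Int: "subtree X \<Longrightarrow> subtree Y \<Longrightarrow> subtree (X \<inter> Y)"
proof -
  have "edges_in (X \<inter> Y) = edges_in X \<inter> edges_in Y" by (auto simp: edges_in_def)
  then show "subtree X \<Longrightarrow> subtree Y \<Longrightarrow> subtree (X \<inter> Y)"
    using rtrancl_Int[of "edges_in X" "edges_in Y"] by (auto simp: subtree_def edges_in_def)
qed

lemma walk_edges_in_subset: "walk (edges_in X) xs \<Longrightarrow> length xs \<ge> 2 \<Longrightarrow> set xs \<subseteq> X"
  by (induction xs rule: no_backtrack.induct) (auto simp: edges_in_def)

lemma reduced_walk_in_subtree:
  assumes "subtree X" "x \<in> X" "y \<in> X"
  obtains xs where "walk adj xs" "no_backtrack xs" "hd xs = x" "last xs = y" "set xs \<subseteq> X"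
proof -
  obtain xs where xs: "walk (edges_in X) xs" "no_backtrack xs" "hd xs = x" "last xs = y"
    using reduced_walk_exists assms unfolding subtree_def by metis
  have "set xs \<subseteq> X"
  proof (cases "length xs \<ge> 2")
    case False
    with xs assms(2) show ?thesis by (cases xs; cases "tl xs") auto
  qed (use walk_edges_in_subset xs in blast)
  with xs show ?thesis by (intro that[of xs]) (auto simp: edges_in_def intro: walk_mono)
qed

end

section \<open>Groups acting on trees\<close>

locale tree_action = group G + tree V adj
  for G (structure) and V :: "'v set" and adj +
  fixes act :: "'a \<Rightarrow> 'v \<Rightarrow> 'v"
  assumes act_closed [simp]: "g \<in> carrier G \<Longrightarrow> x \<in> V \<Longrightarrow> act g x \<in> V"
    and act_one: "x \<in> V \<Longrightarrow> act \<one> x = x"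
    and act_mult: "g \<in> carrier G \<Longrightarrow> h \<in> carrier G \<Longrightarrow> x \<in> V \<Longrightarrow> act (g \<otimes> h) x = act g (act h x)"
    and act_adj: "g \<in> carrier G \<Longrightarrow> (x, y) \<in> adj \<Longrightarrow> (act g x, act g y) \<in> adj"
begin

lemma act_inv_act [simp]: "g \<in> carrier G \<Longrightarrow> x \<in> V \<Longrightarrow> act (inv g) (act g x) = x"
  using act_mult[of "inv g" g x] act_one by simp

lemma act_act_inv [simp]: "g \<in> carrier G \<Longrightarrow> x \<in> V \<Longrightarrow> act g (act (inv g) x) = x"
  using act_mult[of g "inv g" x] act_one by simp

lemma act_eq_iff: "g \<in> carrier G \<Longrightarrow> x \<in> V \<Longrightarrow> y \<in> V \<Longrightarrow> act g x = y \<longleftrightarrow> x = act (inv g) y"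
  by auto

lemma act_inj: "g \<in> carrier G \<Longrightarrow> x \<in> V \<Longrightarrow> y \<in> V \<Longrightarrow> act g x = act g y \<longleftrightarrow> x = y"
  by (metis act_inv_act)

lemma adj_V: "(x, y) \<in> adj \<Longrightarrow> x \<in> V \<and> y \<in> V"
  using adj_in_V by auto

lemma act_walk: "g \<in> carrier G \<Longrightarrow> walk adj xs \<Longrightarrow> walk adj (map (act g) xs)"
  by (induction xs rule: no_backtrack.induct) (auto intro: act_adj)

lemma act_no_backtrack:
  "g \<in> carrier G \<Longrightarrow> set xs \<subseteq> V \<Longrightarrow> no_backtrack xs \<Longrightarrow> no_backtrack (map (act g) xs)"
  by (induction xs rule: no_backtrack.induct) (auto simp: act_inj)

definition stab :: "'a set \<Rightarrow> 'v \<Rightarrow> 'a set" where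
  "stab H x = {h \<in> H. act h x = x}"

lemma stab_subgroup: "subgroup H G \<Longrightarrow> x \<in> V \<Longrightarrow> subgroup (stab H x) G"
proof (rule subgroupI)
  assume H: "subgroup H G" and x: "x \<in> V"
  interpret H: subgroup H G by fact
  show "stab H x \<subseteq> carrier G" using H.subset by (auto simp: stab_def)
  show "stab H x \<noteq> {}" using act_one[OF x] H.one_closed by (force simp: stab_def)
  show "a \<in> stab H x \<Longrightarrow> inv a \<in> stab H x" for a
    using x act_inv_act[of a x] by (auto simp: stab_def)
  show "a \<in> stab H x \<Longrightarrow> b \<in> stab H x \<Longrightarrow> a \<otimes> b \<in> stab H x" for a b
    using x by (auto simp: stab_def act_mult)
qed

text \<open>
  The condition on edges does not follow from the one on vertices, as the stabiliser of a vertex can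
  have infinitely many orbits of adjacent edges.
\<close>

definition cofinite_subtree :: "'a set \<Rightarrow> 'v set \<Rightarrow> bool" where
  "cofinite_subtree H X \<longleftrightarrow> subtree X \<and> (\<forall>h\<in>H. \<forall>x\<in>X. act h x \<in> X) \<and>
     (\<exists>D. finite D \<and> D \<subseteq> X \<and> (\<forall>x\<in>X. \<exists>h\<in>H. \<exists>d\<in>D. x = act h d)) \<and>
     (\<exists>E. finite E \<and> E \<subseteq> edges_in X \<and> (\<forall>(x, y)\<in>edges_in X. \<exists>h\<in>H. \<exists>(p, q)\<in>E. x = act h p \<and> y = act h q))"

lemma cofinite_subtree_imp_subtree: "cofinite_subtree H X \<Longrightarrow> subtree X"
  by (simp add: cofinite_subtree_def)

lemma cofinite_subtree_in_V: "cofinite_subtree H X \<Longrightarrow> X \<subseteq> V"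
  by (simp add: cofinite_subtree_def subtree_def)

lemma cofinite_subtree_invariant: "cofinite_subtree H X \<Longrightarrow> h \<in> H \<Longrightarrow> x \<in> X \<Longrightarrow> act h x \<in> X"
  by (simp add: cofinite_subtree_def)

lemma cofinite_subtree_vertices:
  assumes "cofinite_subtree H X"
  obtains D where "finite D" "D \<subseteq> X" "\<And>x. x \<in> X \<Longrightarrow> \<exists>h\<in>H. \<exists>d\<in>D. x = act h d"
proof -
  have "\<exists>D. finite D \<and> D \<subseteq> X \<and> (\<forall>x\<in>X. \<exists>h\<in>H. \<exists>d\<in>D. x = act h d)"
    using assms by (simp add: cofinite_subtree_def)
  with that show ?thesis by blast
qed

lemma cofinite_subtree_edges:
  assumes "cofinite_subtree H X"
  obtains E where "finite E" "E \<subseteq> edges_in X"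
    "\<And>x y. (x, y) \<in> edges_in X \<Longrightarrow> \<exists>h\<in>H. \<exists>p q. (p, q) \<in> E \<and> x = act h p \<and> y = act h q"
proof -
  have "\<exists>E. finite E \<and> E \<subseteq> edges_in X \<and>
      (\<forall>(x, y)\<in>edges_in X. \<exists>h\<in>H. \<exists>(p, q)\<in>E. x = act h p \<and> y = act h q)"
    using assms by (simp add: cofinite_subtree_def)
  then obtain E where "finite E" "E \<subseteq> edges_in X"
    "\<And>x y. (x, y) \<in> edges_in X \<Longrightarrow> \<exists>h\<in>H. \<exists>p q. (p, q) \<in> E \<and> x = act h p \<and> y = act h q" by fast
  with that show ?thesis by blast
qed

lemma cofinite_subtreeI:
  assumes H: "subgroup H G" and X: "X \<subseteq> V" and inv: "\<And>h x. h \<in> H \<Longrightarrow> x \<in> X \<Longrightarrow> act h x \<in> X"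
    and D: "finite D" "D \<subseteq> X" "\<And>x. x \<in> X \<Longrightarrow> \<exists>h\<in>H. \<exists>d\<in>D. x = act h d"
    and E: "finite E" "E \<subseteq> edges_in X"
    and R: "R = {(act h p, act h q) | h p q. h \<in> H \<and> (p, q) \<in> E}"
    and conn: "\<And>x y. x \<in> X \<Longrightarrow> y \<in> X \<Longrightarrow> (x, y) \<in> R\<^sup>*"
  shows "cofinite_subtree H X"
proof -
  have Hc: "H \<subseteq> carrier G" using H by (rule subgroup.subset)
  have RX: "R \<subseteq> edges_in X"
  proof (rule subrelI)
    fix x y assume "(x, y) \<in> R"
    then obtain h p q where hpq: "h \<in> H" "(p, q) \<in> E" "x = act h p" "y = act h q" unfolding R by blast
    then have "(p, q) \<in> adj" "p \<in> X" "q \<in> X" using E(2) by (auto simp: edges_in_def)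
    with hpq Hc show "(x, y) \<in> edges_in X" by (auto simp: edges_in_def act_adj inv)
  qed
  then have "subtree X" using X conn rtrancl_mono[OF RX] by (auto simp: subtree_def)
  moreover have "(x, y) \<in> R" if "(x, y) \<in> edges_in X" for x y
    by (rule edge_in_connecting_relation) (use that conn RX in \<open>auto simp: edges_in_def\<close>)
  then have "\<forall>(x, y)\<in>edges_in X. \<exists>h\<in>H. \<exists>(p, q)\<in>E. x = act h p \<and> y = act h q"
    unfolding R by blast
  moreover have "\<exists>D. finite D \<and> D \<subseteq> X \<and> (\<forall>x\<in>X. \<exists>h\<in>H. \<exists>d\<in>D. x = act h d)" using D by blast
  ultimately show ?thesis using inv E unfolding cofinite_subtree_def by auto
qed

lemma finite_connecting_edges:
  assumes "(x, y) \<in> adj\<^sup>*"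
  shows "\<exists>E. finite E \<and> E \<subseteq> adj \<and> (x, y) \<in> E\<^sup>* \<and> (\<forall>(p, q)\<in>E. (x, p) \<in> E\<^sup>*)"
  using assms
proof (induction)
  case base
  show ?case by (rule exI[of _ "{}"]) auto
next
  case (step y z)
  then obtain E where E: "finite E" "E \<subseteq> adj" "(x, y) \<in> E\<^sup>*" "\<forall>(p, q)\<in>E. (x, p) \<in> E\<^sup>*" by blast
  have mono: "E\<^sup>* \<subseteq> (insert (y, z) E)\<^sup>*" by (rule rtrancl_mono) auto
  have "(x, z) \<in> (insert (y, z) E)\<^sup>*"
    using E(3) mono by (meson insertI1 rtrancl.rtrancl_into_rtrancl subsetD)
  with E step(2) mono show ?case by (intro exI[of _ "insert (y, z) E"]) auto
qed

text \<open>
  The translates of finitely many paths from \<open>v\<close> to \<open>sv\<close>, for generators \<open>s\<close>, form the subtree: they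
  connect \<open>v\<close> to \<open>sv\<close>, hence by translation and induction to \<open>hv\<close> for all \<open>h\<close>.
\<close>

lemma exists_cofinite_subtree:
  assumes H: "fg_subgroup G H" and v: "v \<in> V"
  shows "\<exists>X. v \<in> X \<and> cofinite_subtree H X"
proof -
  have sub: "subgroup H G" using H by (rule fg_subgroup_imp_subgroup)
  interpret H: subgroup H G by fact
  obtain S where S: "finite S" "S \<subseteq> carrier G" "H = generate G S" using H by (auto simp: fg_subgroup_def)
  have SH: "S \<subseteq> H" unfolding S(3) by (auto intro: generate.incl)
  have "\<forall>s\<in>S. \<exists>E. finite E \<and> E \<subseteq> adj \<and> (v, act s v) \<in> E\<^sup>* \<and> (\<forall>(p, q)\<in>E. (v, p) \<in> E\<^sup>*)"
    using S(2) v by (intro ballI finite_connecting_edges connected act_closed) auto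
  then obtain Es where Es: "\<And>s. s \<in> S \<Longrightarrow> finite (Es s) \<and> Es s \<subseteq> adj \<and> (v, act s v) \<in> (Es s)\<^sup>* \<and>
      (\<forall>(p, q)\<in>Es s. (v, p) \<in> (Es s)\<^sup>*)" by metis
  define E0 where "E0 = (\<Union>s\<in>S. Es s)"
  define E where "E = E0 \<union> E0\<inverse>"
  define D where "D = insert v (fst ` E)"
  define X where "X = {act h d | h d. h \<in> H \<and> d \<in> D}"
  define R where "R = {(act h p, act h q) | h p q. h \<in> H \<and> (p, q) \<in> E}"
  have finE: "finite E" using S(1) Es by (auto simp: E_def E0_def)
  have E0adj: "E0 \<subseteq> adj" using Es by (auto simp: E0_def)
  then have Eadj: "E \<subseteq> adj" by (auto simp: E_def adj_sym)
  have DV: "D \<subseteq> V" using Eadj adj_in_V v by (auto simp: D_def)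
  have DX: "D \<subseteq> X"
  proof
    fix d assume "d \<in> D"
    then have "d = act \<one> d" using DV act_one by auto
    with \<open>d \<in> D\<close> show "d \<in> X" unfolding X_def using H.one_closed by blast
  qed
  have ER: "E \<subseteq> R"
  proof (rule subrelI)
    fix p q assume pq: "(p, q) \<in> E"
    then have "p = act \<one> p" "q = act \<one> q" using Eadj adj_in_V act_one by auto
    with pq show "(p, q) \<in> R" unfolding R_def using H.one_closed by blast
  qed
  have symR: "sym R" unfolding R_def E_def sym_def by blast
  then have symRs: "(x, y) \<in> R\<^sup>* \<Longrightarrow> (y, x) \<in> R\<^sup>*" for x y by (meson sym_rtrancl symD)
  have actR: "(act h x, act h y) \<in> R" if h: "h \<in> H" and xy: "(x, y) \<in> R" for h x y
  proof -
    obtain k p q where k: "k \<in> H" "(p, q) \<in> E" "x = act k p" "y = act k q" using xy by (auto simp: R_def)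
    have "p \<in> V" "q \<in> V" using k(2) Eadj adj_in_V by auto
    with k h have "act h x = act (h \<otimes> k) p" "act h y = act (h \<otimes> k) q" by (auto simp: act_mult)
    with k h show ?thesis unfolding R_def using H.m_closed by blast
  qed
  have actRs: "(act h x, act h y) \<in> R\<^sup>*" if "h \<in> H" "(x, y) \<in> R\<^sup>*" for h x y
    using that(2) actR[OF that(1)] by (rule rtrancl_map)
  have vS: "(v, act s v) \<in> R\<^sup>*" if "s \<in> S" for s
  proof -
    have "Es s \<subseteq> R" using ER that by (auto simp: E_def E0_def)
    from rtrancl_mono[OF this] show ?thesis using Es[OF that] by auto
  qed
  have vh: "(v, act h v) \<in> R\<^sup>*" if "h \<in> generate G S" for h
    using that
  proof (induction)
    case one
    then show ?case using v by (simp add: act_one)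
  next
    case (incl h)
    then show ?case by (rule vS)
  next
    case (inv h)
    have "(act (inv h) v, act (inv h) (act h v)) \<in> R\<^sup>*"
      using inv vS SH by (intro actRs) auto
    moreover have "act (inv h) (act h v) = v" using inv S(2) v by (intro act_inv_act) auto
    ultimately show ?case by (simp add: symRs)
  next
    case (eng g h)
    have gh: "g \<in> H" "h \<in> H" using eng S(3) by auto
    have "(act g v, act g (act h v)) \<in> R\<^sup>*" using eng gh by (intro actRs) auto
    with eng gh v show ?case by (simp add: act_mult)
  qed
  have vD: "(v, d) \<in> R\<^sup>*" if "d \<in> D" for d
  proof (cases "d = v")
    case False
    then obtain d' where "(d, d') \<in> E" using \<open>d \<in> D\<close> by (auto simp: D_def)
    then obtain p q s where s: "s \<in> S" "(p, q) \<in> Es s" "d = p \<or> d = q" by (auto simp: E_def E0_def)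
    then have vp: "(v, p) \<in> (Es s)\<^sup>*" using Es[OF s(1)] by auto
    then have "(v, q) \<in> (Es s)\<^sup>*" using s(2) by (rule rtrancl.rtrancl_into_rtrancl)
    moreover have "Es s \<subseteq> R" using ER s by (auto simp: E_def E0_def)
    then have "(Es s)\<^sup>* \<subseteq> R\<^sup>*" by (rule rtrancl_mono)
    ultimately show ?thesis using s(3) vp by auto
  qed auto
  have vX: "(v, x) \<in> R\<^sup>*" if "x \<in> X" for x
  proof -
    obtain h d where hd: "h \<in> H" "d \<in> D" "x = act h d" using \<open>x \<in> X\<close> by (auto simp: X_def)
    then have "(act h v, x) \<in> R\<^sup>*" using vD by (auto intro: actRs)
    moreover have "(v, act h v) \<in> R\<^sup>*" using hd S(3) vh by auto
    ultimately show ?thesis by (rule rtrancl_trans[rotated])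
  qed
  have "cofinite_subtree H X"
  proof (rule cofinite_subtreeI[OF sub _ _ _ DX _ finE _ R_def])
    show "X \<subseteq> V" using DV by (auto simp: X_def intro!: act_closed)
    show "act h x \<in> X" if hx: "h \<in> H" "x \<in> X" for h x
    proof -
      obtain k d where kd: "k \<in> H" "d \<in> D" "x = act k d" using hx(2) unfolding X_def by blast
      have "act h x = act (h \<otimes> k) d" using kd DV hx by (auto simp: act_mult)
      then show ?thesis using kd hx unfolding X_def by blast
    qed
    show "finite D" using finE by (simp add: D_def)
    show "\<exists>h\<in>H. \<exists>d\<in>D. x = act h d" if "x \<in> X" for x using that by (auto simp: X_def)
    have "sym E" by (auto simp: E_def sym_def)
    then have "p \<in> D \<and> q \<in> D" if "(p, q) \<in> E" for p q
      using that by (force simp: D_def sym_def image_iff)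
    then show "E \<subseteq> edges_in X" using Eadj DX by (auto simp: edges_in_def)
    show "(x, y) \<in> R\<^sup>*" if "x \<in> X" "y \<in> X" for x y
      using symRs[OF vX[OF that(1)]] vX[OF that(2)] by (rule rtrancl_trans)
  qed
  with DX show ?thesis by (auto simp: D_def)
qed

end

section \<open>Stabilisers in a finitely generated group\<close>

text \<open>
  A presentation of the quotient graph of groups: \<open>D\<close> contains exactly one vertex of each orbit, and
  \<open>(d, l, d') \<in> T\<close> stands for the edge from \<open>d\<close> to \<open>l d'\<close>. Each orbit of edges is represented by some
  element of \<open>T\<close>, possibly by several.
\<close>

locale subtree_transversal = tree_action G V adj act
  for G (structure) and V :: "'v set" and adj act +
  fixes H :: "'a set" and X D :: "'v set" and T :: "('v \<times> 'a \<times> 'v) set"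
  assumes H: "subgroup H G" and X: "subtree X"
    and X_inv: "h \<in> H \<Longrightarrow> x \<in> X \<Longrightarrow> act h x \<in> X"
    and D: "finite D" "D \<subseteq> X"
    and D_cover: "x \<in> X \<Longrightarrow> \<exists>h\<in>H. \<exists>d\<in>D. x = act h d"
    and D_unique: "d \<in> D \<Longrightarrow> d' \<in> D \<Longrightarrow> h \<in> H \<Longrightarrow> act h d = d' \<Longrightarrow> d = d'"
    and T: "finite T"
    and T_D: "(d, l, d') \<in> T \<Longrightarrow> d \<in> D \<and> d' \<in> D \<and> l \<in> H \<and> (d, act l d') \<in> edges_in X"
    and T_cover: "d \<in> D \<Longrightarrow> (d, y) \<in> edges_in X \<Longrightarrow>
      \<exists>a\<in>stab H d. \<exists>l d'. (d, l, d') \<in> T \<and> y = act (a \<otimes> l) d'"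

context tree_action begin

lemma exists_transversal:
  assumes H: "subgroup H G" and X: "cofinite_subtree H X" and v: "v \<in> X"
  shows "\<exists>D T. v \<in> D \<and> subtree_transversal G V adj act H X D T"
proof -
  interpret H: subgroup H G by fact
  have tree: "subtree X" and inv: "\<And>h x. h \<in> H \<Longrightarrow> x \<in> X \<Longrightarrow> act h x \<in> X"
    using X by (auto simp: cofinite_subtree_def)
  have XV: "X \<subseteq> V" using tree by (auto simp: subtree_def)
  obtain D' where D': "finite D'" "D' \<subseteq> X" "\<And>x. x \<in> X \<Longrightarrow> \<exists>h\<in>H. \<exists>d\<in>D'. x = act h d"
    using cofinite_subtree_vertices[OF X] by blast
  obtain E where E: "finite E" "E \<subseteq> edges_in X"
    "\<And>x y. (x, y) \<in> edges_in X \<Longrightarrow> \<exists>h\<in>H. \<exists>p q. (p, q) \<in> E \<and> x = act h p \<and> y = act h q"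
    by (rule cofinite_subtree_edges[OF X]) (rule that)
  define orb where "orb x = (\<lambda>h. act h x) ` H" for x
  have self: "x \<in> orb x" if "x \<in> X" for x
    unfolding orb_def using act_one[of x] that XV by (intro image_eqI[OF _ H.one_closed]) auto
  have orb_sub: "orb (act h x) \<subseteq> orb x" if "h \<in> H" "x \<in> X" for h x
  proof
    fix y assume "y \<in> orb (act h x)"
    then obtain g where g: "g \<in> H" "y = act g (act h x)" by (auto simp: orb_def)
    then have "y = act (g \<otimes> h) x" using that XV by (auto simp: act_mult)
    moreover have "g \<otimes> h \<in> H" using g that by simp
    ultimately show "y \<in> orb x" unfolding orb_def by (rule image_eqI)
  qed
  have orb_act: "orb (act h x) = orb x" if hx: "h \<in> H" "x \<in> X" for h x
  proof
    have "act (inv h) (act h x) = x" using hx XV by auto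
    then show "orb x \<subseteq> orb (act h x)"
      using orb_sub[of "inv h" "act h x"] hx inv by auto
  qed (rule orb_sub[OF hx])
  obtain D1 where D1: "D1 \<subseteq> D'" "inj_on orb D1" "orb ` D1 = orb ` D'"
    using subset_image_inj[of "orb ` D'" orb D'] by fastforce
  \<comment> \<open>The point \<open>v\<close> replaces the representative of its orbit.\<close>
  define D where "D = insert v {d \<in> D1. orb d \<noteq> orb v}"
  have DX: "D \<subseteq> X" and finD: "finite D"
    using D1(1) D'(1,2) v finite_subset[OF D1(1)] by (auto simp: D_def)
  have inj: "inj_on orb D" using D1(2) by (auto simp: D_def inj_on_def)
  have cover: "\<exists>h\<in>H. \<exists>d\<in>D. x = act h d" if x: "x \<in> X" for x
  proof -
    obtain h d where "h \<in> H" "d \<in> D'" "x = act h d" using D'(3)[OF x] by blast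
    then have "orb x = orb d" using orb_act D'(2) by auto
    moreover have "orb d \<in> orb ` D1" using D1(3) \<open>d \<in> D'\<close> by blast
    then obtain d1 where "d1 \<in> D1" "orb d = orb d1" by blast
    ultimately have "\<exists>d\<in>D. orb x = orb d" by (cases "orb d1 = orb v") (auto simp: D_def)
    then obtain d where d: "d \<in> D" "x \<in> orb d" using self[OF x] by auto
    then obtain h where "h \<in> H" "x = act h d" unfolding orb_def by (elim imageE)
    with d show ?thesis by blast
  qed
  have unique: "d = d'" if "d \<in> D" "d' \<in> D" "h \<in> H" "act h d = d'" for d d' h
    using that orb_act[of h d] DX inj by (auto simp: inj_on_def)
  have "\<forall>x\<in>X. \<exists>g d. g \<in> H \<and> d \<in> D \<and> x = act g d" using cover by blast
  then obtain g rep where rep: "\<And>x. x \<in> X \<Longrightarrow> g x \<in> H \<and> rep x \<in> D \<and> x = act (g x) (rep x)"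
    by metis
  define T where "T = (\<lambda>(p, q). (rep p, inv (g p) \<otimes> g q, rep q)) ` E"
  have EX: "p \<in> X" "q \<in> X" "(p, q) \<in> adj" if "(p, q) \<in> E" for p q
    using that E(2) by (auto simp: edges_in_def)
  have "subtree_transversal G V adj act H X D T"
  proof (unfold_locales; (fact H tree finD DX)?)
    show "h \<in> H \<Longrightarrow> x \<in> X \<Longrightarrow> act h x \<in> X" for h x by (rule inv)
    show "x \<in> X \<Longrightarrow> \<exists>h\<in>H. \<exists>d\<in>D. x = act h d" for x by (rule cover)
    show "d \<in> D \<Longrightarrow> d' \<in> D \<Longrightarrow> h \<in> H \<Longrightarrow> act h d = d' \<Longrightarrow> d = d'" for d d' h by (rule unique)
    show "finite T" using E(1) by (auto simp: T_def)
    show "d \<in> D \<and> d' \<in> D \<and> l \<in> H \<and> (d, act l d') \<in> edges_in X" if dld: "(d, l, d') \<in> T" for d l d'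
    proof -
      obtain p q where pq: "(p, q) \<in> E" "d = rep p" "d' = rep q" "l = inv (g p) \<otimes> g q"
        using dld by (auto simp: T_def)
      note r = rep[OF EX(1)[OF pq(1)]] rep[OF EX(2)[OF pq(1)]]
      have V: "rep p \<in> V" "rep q \<in> V" using r DX XV by auto
      have "d = act (inv (g p)) p" using r V by (metis H.mem_carrier act_inv_act pq(2))
      moreover have "act l d' = act (inv (g p)) q" using r V pq by (simp add: act_mult)
      moreover have "(act (inv (g p)) p, act (inv (g p)) q) \<in> edges_in X"
        using EX[OF pq(1)] r by (auto simp: edges_in_def intro: act_adj inv)
      ultimately show ?thesis using r pq by simp
    qed
    show "\<exists>a\<in>stab H d. \<exists>l d'. (d, l, d') \<in> T \<and> y = act (a \<otimes> l) d'"
      if d: "d \<in> D" and dy: "(d, y) \<in> edges_in X" for d y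
    proof -
      obtain h p q where h: "h \<in> H" "(p, q) \<in> E" "d = act h p" "y = act h q" using E(3)[OF dy] by blast
      have pq: "(p, q) \<in> E" by (rule h(2))
      note r = rep[OF EX(1)[OF pq]] rep[OF EX(2)[OF pq]]
      have V: "rep p \<in> V" "rep q \<in> V" using r DX XV by auto
      have hg: "act (h \<otimes> g p) (rep p) = d" using r V h by (simp add: act_mult)
      then have rp: "rep p = d" using r h d by (intro unique[of "rep p" d "h \<otimes> g p"]) auto
      have "h \<otimes> g p \<in> stab H d" using hg rp r h by (auto simp: stab_def)
      moreover have "(d, inv (g p) \<otimes> g q, rep q) \<in> T" using pq rp by (force simp: T_def)
      moreover have "(h \<otimes> g p) \<otimes> (inv (g p) \<otimes> g q) = h \<otimes> g q"
        using r h by (simp add: m_assoc)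
      then have "y = act ((h \<otimes> g p) \<otimes> (inv (g p) \<otimes> g q)) (rep q)"
        using r V h by (simp add: act_mult)
      ultimately show ?thesis by blast
    qed
  qed
  then show ?thesis by (auto simp: D_def)
qed

end

context subtree_transversal begin

sublocale H: subgroup H G by (rule H)

lemma X_V: "X \<subseteq> V" using X by (auto simp: subtree_def)

lemma D_V: "d \<in> D \<Longrightarrow> d \<in> V" using D(2) X_V by auto

lemma T_adj: "(d, l, d') \<in> T \<Longrightarrow> (d, act l d') \<in> adj"
  using T_D by (auto simp: edges_in_def)

text \<open>
  Words \<open>a\<^sub>0 l\<^sub>1 a\<^sub>1 \<dots> l\<^sub>n a\<^sub>n\<close> read along a path of the quotient graph, with the letters \<open>a\<^sub>i\<close> taken from
  the set that \<open>S\<close> provides at the current vertex. A word from \<open>d\<close> to \<open>d'\<close> with value \<open>h\<close> describes a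
  walk in the tree from \<open>d\<close> to \<open>h d'\<close>.
\<close>

inductive word :: "('v \<Rightarrow> 'a set) \<Rightarrow> 'v \<Rightarrow> 'a \<Rightarrow> 'v \<Rightarrow> bool" for S where
  word_Nil: "d \<in> D \<Longrightarrow> a \<in> S d \<Longrightarrow> word S d a d"
| word_Cons: "a \<in> S d \<Longrightarrow> (d, l, d1) \<in> T \<Longrightarrow> word S d1 h d' \<Longrightarrow> word S d (a \<otimes> l \<otimes> h) d'"

text \<open>
  A path from \<open>d\<close> to \<open>h d'\<close> in the subtree is read off step by step as a word.
\<close>

lemma word_exists:
  assumes h: "h \<in> H" and d: "d \<in> D" "d' \<in> D"
  shows "word (stab H) d h d'"
proof -
  have "word (stab H) d (inv g \<otimes> g') d'"
    if "(x, y) \<in> (edges_in X)\<^sup>*" "g \<in> H" "d \<in> D" "x = act g d" "g' \<in> H" "y = act g' d'" for x y g g' d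
    using that
  proof (induction arbitrary: g d rule: converse_rtrancl_induct)
    case base
    then have "d = act (inv g) (act g' d')" using D_V by (simp add: act_eq_iff[symmetric])
    then have a: "act (inv g \<otimes> g') d' = d" using base D_V d by (simp add: act_mult)
    then have "d' = d" using base d by (intro D_unique[of d' d "inv g \<otimes> g'"]) auto
    then show ?case using a base d by (auto simp: stab_def intro!: word_Nil)
  next
    case (step x z)
    have gz: "(d, act (inv g) z) \<in> edges_in X"
    proof -
      have "d = act (inv g) x" using step D_V by simp
      moreover have "(act (inv g) x, act (inv g) z) \<in> edges_in X"
        using step by (auto simp: edges_in_def intro: act_adj X_inv)
      ultimately show ?thesis by simp
    qed
    then obtain a l d1 where a: "a \<in> stab H d" "(d, l, d1) \<in> T" "act (inv g) z = act (a \<otimes> l) d1"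
      using T_cover step.prems by blast
    then have car: "a \<in> H" "l \<in> H" "d1 \<in> D" "z \<in> V" using T_D step X_V by (auto simp: stab_def edges_in_def)
    have "z = act g (act (inv g) z)" using car step by simp
    also have "\<dots> = act (g \<otimes> (a \<otimes> l)) d1" unfolding a(3) using car step D_V by (simp add: act_mult)
    finally have "word (stab H) d1 (inv (g \<otimes> (a \<otimes> l)) \<otimes> g') d'"
      using step car by (intro step.IH) auto
    then have "word (stab H) d (a \<otimes> l \<otimes> (inv (g \<otimes> (a \<otimes> l)) \<otimes> g')) d'"
      using a by (intro word_Cons)
    moreover have "a \<otimes> l \<otimes> (inv (g \<otimes> (a \<otimes> l)) \<otimes> g') = inv g \<otimes> g'"
    proof -
      have "a \<otimes> l \<in> carrier G" "g \<in> carrier G" using car step by auto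
      then have "a \<otimes> l \<otimes> inv (g \<otimes> (a \<otimes> l)) = inv g"
        by (simp add: inv_mult_group m_assoc[symmetric] del: r_inv_ex) 
      then show ?thesis using car step by (simp add: m_assoc[symmetric])
    qed
    ultimately show ?case by simp
  qed
  moreover have hd: "act h d' \<in> X" "d \<in> X" "d = act \<one> d" using h d D X_inv D_V act_one by auto
  have "(d, act h d') \<in> (edges_in X)\<^sup>*" using hd(1,2) X by (simp add: subtree_def)
  ultimately have "word (stab H) d (inv \<one> \<otimes> h) d'"
    using h d hd(3) H.one_closed by blast
  then show ?thesis using h by simp
qed

text \<open>
  The set \<open>F e\<close> contains the letters that the word uses at \<open>e\<close>.
\<close>

lemma word_finite_letters:
  assumes "word S d h d'"
  shows "\<exists>F. (\<forall>e. finite (F e) \<and> F e \<subseteq> S e) \<and> (\<forall>S'. (\<forall>e. F e \<subseteq> S' e) \<longrightarrow> word S' d h d')"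
  using assms
proof induction
  case (word_Nil d a)
  then show ?case by (intro exI[of _ "(\<lambda>_. {})(d := {a})"]) (auto intro!: word.word_Nil)
next
  case (word_Cons a d l d1 h d')
  then obtain F where F: "\<And>e. finite (F e)" "\<And>e. F e \<subseteq> S e" "\<And>S'. (\<And>e. F e \<subseteq> S' e) \<Longrightarrow> word S' d1 h d'"
    by blast
  show ?case
  proof (intro exI[of _ "F(d := insert a (F d))"] conjI allI impI)
    fix S' assume S': "\<forall>e. (F(d := insert a (F d))) e \<subseteq> S' e"
    have "F e \<subseteq> S' e" for e using spec[OF S', of e] by (auto split: if_splits)
    moreover have "a \<in> S' d" using spec[OF S', of d] by auto
    ultimately show "word S' d (a \<otimes> l \<otimes> h) d'" using F(3) word_Cons by (intro word.word_Cons) auto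
  qed (use F(1,2) word_Cons(1) in \<open>auto split: if_splits\<close>)
qed

lemma fg_if_vertex_stabs_fg:
  assumes fg: "\<And>d. d \<in> D \<Longrightarrow> fg_subgroup G (stab H d)" and v: "v \<in> D"
  shows "fg_subgroup G H"
proof (rule fg_subgroupI_parts[OF H])
  let ?\<S> = "stab H ` D \<union> (\<lambda>(d, l, d'). generate G {l}) ` T"
  show "finite ?\<S>" using D T by auto
  show "fg_subgroup G S" if "S \<in> ?\<S>" for S using that fg T_D by (auto intro!: fg_subgroup_cyclic)
  show "S \<subseteq> H" if "S \<in> ?\<S>" for S
    using that T_D H by (auto simp: stab_def dest!: subsetD[OF generate_subgroup_incl[OF _ H], rotated])
  fix M assume M: "subgroup M G" "\<And>S. S \<in> ?\<S> \<Longrightarrow> S \<subseteq> M"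
  interpret M: subgroup M G by fact
  have "h \<in> M" if "word (stab H) d h d'" for d h d'
    using that
  proof induction
    case (word_Cons a d l d1 h d')
    have "l \<in> generate G {l}" by (auto intro: generate.incl)
    with word_Cons(2) have "l \<in> M" using M(2)[of "generate G {l}"] by force
    moreover have "a \<in> M" using M(2)[of "stab H d"] word_Cons T_D by auto
    ultimately show ?case using word_Cons by auto
  qed (use M(2) in auto)
  then show "H \<subseteq> M" using word_exists[OF _ v v] by blast
qed

text \<open>
  Words whose walk, recorded in the list, does not backtrack. Prefixing \<open>a l\<close> translates the old walk
  and puts \<open>d\<close> in front; the new walk backtracks there iff the second vertex of the old one is
  \<open>l\<^sup>-\<^sup>1 d\<close>.
\<close>

inductive rword :: "('v \<Rightarrow> 'a set) \<Rightarrow> 'v \<Rightarrow> 'v list \<Rightarrow> 'a \<Rightarrow> 'v \<Rightarrow> bool" for S where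
  rword_Nil: "d \<in> D \<Longrightarrow> a \<in> S d \<Longrightarrow> rword S d [d] a d"
| rword_Cons: "a \<in> S d \<Longrightarrow> (d, l, d1) \<in> T \<Longrightarrow> rword S d1 xs h d' \<Longrightarrow>
     (2 \<le> length xs \<Longrightarrow> xs ! 1 \<noteq> act (inv l) d) \<Longrightarrow>
     rword S d (d # map (act (a \<otimes> l)) xs) (a \<otimes> l \<otimes> h) d'"

lemma rword_walk:
  assumes "rword S d xs h d'" and S: "\<And>d. d \<in> D \<Longrightarrow> S d \<subseteq> stab H d"
  shows "d \<in> D \<and> d' \<in> D \<and> h \<in> H \<and> walk adj xs \<and> no_backtrack xs \<and> hd xs = d \<and>
    last xs = act h d' \<and> set xs \<subseteq> V"
  using assms(1)
proof induction
  case (rword_Nil d a)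
  then show ?case using S[of d] D_V[of d] by (auto simp: stab_def)
next
  case (rword_Cons a d l d1 xs h d')
  have a: "a \<in> H" "act a d = d" using rword_Cons S[of d] T_D by (auto simp: stab_def)
  have l: "l \<in> H" "d \<in> D" "d1 \<in> D" "d \<in> V" "d1 \<in> V" using T_D[OF rword_Cons(2)] D_V by auto
  have xs: "walk adj xs" "no_backtrack xs" "hd xs = d1" "last xs = act h d'" "set xs \<subseteq> V" "h \<in> H" "d' \<in> D"
    using rword_Cons by auto
  have ne: "xs \<noteq> []" using xs(1) by auto
  have "(act a d, act a (act l d1)) \<in> adj" using a l T_adj[OF rword_Cons(2)] by (intro act_adj) auto
  then have "(d, act (a \<otimes> l) d1) \<in> adj" using a l by (simp add: act_mult)
  then have walk: "walk adj (d # map (act (a \<otimes> l)) xs)"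
    using act_walk[OF _ xs(1), of "a \<otimes> l"] a l ne xs(3) by (auto simp: walk_Cons hd_map)
  have "d \<noteq> act (a \<otimes> l) (xs ! 1)" if "2 \<le> length xs"
  proof
    assume d: "d = act (a \<otimes> l) (xs ! 1)"
    have V: "xs ! 1 \<in> V" using that xs(5) by (auto simp: subset_iff)
    have "act (inv a) d = act l (xs ! 1)" unfolding d using a l V by (simp add: act_mult act_closed)
    moreover have "act (inv a) d = d" using a l by (metis H.mem_carrier act_inv_act)
    ultimately have "xs ! 1 = act (inv l) d" using l V by (metis H.mem_carrier act_inv_act)
    with rword_Cons(4)[OF that] show False by simp
  qed
  then have nb: "no_backtrack (d # map (act (a \<otimes> l)) xs)"
    using act_no_backtrack[OF _ xs(5,2), of "a \<otimes> l"] a l by (auto simp: no_backtrack_Cons)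
  have "last (d # map (act (a \<otimes> l)) xs) = act (a \<otimes> l \<otimes> h) d'"
    using ne xs a l D_V[of d'] by (simp add: last_map act_mult)
  moreover have "set (d # map (act (a \<otimes> l)) xs) \<subseteq> V" using xs(5) a l by (auto intro!: act_closed)
  ultimately show ?case using walk nb a l xs by auto
qed

lemma rword_translate:
  assumes "b \<in> S d" "rword S d xs h d'" and S: "\<And>d. d \<in> D \<Longrightarrow> subgroup (S d) G \<and> S d \<subseteq> stab H d"
  shows "rword S d (map (act b) xs) (b \<otimes> h) d'"
  using assms(2)
proof cases
  case rword_Nil
  then have "act b d = d" using S[of d] assms(1) by (auto simp: stab_def)
  moreover have "b \<otimes> h \<in> S d" using S[of d] rword_Nil assms(1) by (auto intro: subgroup.m_closed)
  ultimately show ?thesis using rword_Nil by (auto intro: rword.rword_Nil)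
next
  case (rword_Cons a l d1 ys k)
  have l: "l \<in> H" "d \<in> D" "d1 \<in> D" "d \<in> V" "d1 \<in> V" using T_D[OF rword_Cons(4)] D_V by auto
  have ab: "a \<in> H" "b \<in> H" "act b d = d" "b \<otimes> a \<in> S d"
    using l S[of d] assms(1) rword_Cons by (auto simp: stab_def intro: subgroup.m_closed)
  have ys: "set ys \<subseteq> V" "k \<in> H" using rword_walk[OF rword_Cons(5)] S by auto
  have "rword S d (d # map (act ((b \<otimes> a) \<otimes> l)) ys) ((b \<otimes> a) \<otimes> l \<otimes> k) d'"
    using ab rword_Cons by (intro rword.rword_Cons) auto
  moreover have "map (act b) (map (act (a \<otimes> l)) ys) = map (act ((b \<otimes> a) \<otimes> l)) ys"
    using ys ab l by (auto simp: act_mult[symmetric] m_assoc subset_iff)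
  moreover have "(b \<otimes> a) \<otimes> l \<otimes> k = b \<otimes> h" using rword_Cons ab l ys by (simp add: m_assoc)
  ultimately show ?thesis using rword_Cons ab by (simp del: map_map)
qed

text \<open>
  If a walk backtracks from \<open>d\<close> to \<open>l d\<^sub>1\<close> and back, then \<open>l a l'\<close> fixes \<open>d\<close>. Under this condition it is
  an admissible letter at \<open>d\<close>, so that the backtracking can be cancelled within the given letters.
\<close>

definition backtrack_closed :: "('v \<Rightarrow> 'a set) \<Rightarrow> bool" where
  "backtrack_closed S \<longleftrightarrow> (\<forall>d l d1 l' a. (d, l, d1) \<in> T \<and> (d1, l', d) \<in> T \<and> a \<in> stab H d1 \<and>
     act (l \<otimes> a \<otimes> l') d = d \<longrightarrow> l \<otimes> a \<otimes> l' \<in> S d)"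

lemma rword_prefix:
  assumes S: "\<And>d. d \<in> D \<Longrightarrow> subgroup (S d) G \<and> S d \<subseteq> stab H d" and bt: "backtrack_closed S"
    and a: "a \<in> S d" and l: "(d, l, d1) \<in> T" and w: "rword S d1 xs h d'"
  shows "\<exists>xs'. rword S d xs' (a \<otimes> l \<otimes> h) d'"
proof (cases "2 \<le> length xs \<and> xs ! 1 = act (inv l) d")
  case False
  with a l w show ?thesis by (blast intro: rword_Cons)
next
  case True
  from w show ?thesis
  proof cases
    case rword_Nil
    with True show ?thesis by simp
  next
    case (rword_Cons a' l' d2 ys k)
    have lD: "l \<in> H" "d \<in> D" "d \<in> V" "d1 \<in> D" "d1 \<in> V" "l' \<in> H" "d2 \<in> D" "d2 \<in> V"
      using T_D[OF l] T_D[OF rword_Cons(4)] D_V by auto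
    have a': "a' \<in> stab H d1" "a' \<in> H" "a \<in> H" using S lD rword_Cons(3) a by (auto simp: stab_def)
    have ys: "ys \<noteq> []" "hd ys = d2" "k \<in> H" using rword_walk[OF rword_Cons(5)] S by auto
    have "act (a' \<otimes> l') d2 = act (inv l) d"
      using True ys rword_Cons(1) by (cases ys) auto
    then have "act l (act (a' \<otimes> l') d2) = d" using lD by simp
    then have fix_d: "act (l \<otimes> a' \<otimes> l') d2 = d" using lD a' by (simp add: act_mult)
    then have d2: "d2 = d" using lD a' by (intro D_unique[of d2 d "l \<otimes> a' \<otimes> l'"]) auto
    have c: "l \<otimes> a' \<otimes> l' \<in> S d"
      using bt l rword_Cons(4) a'(1) fix_d unfolding d2 backtrack_closed_def by blast
    then have "a \<otimes> (l \<otimes> a' \<otimes> l') \<in> S d" using a S[OF lD(2)] by (auto intro: subgroup.m_closed)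
    from rword_translate[OF this rword_Cons(5)[unfolded d2] S]
    have "\<exists>xs'. rword S d xs' (a \<otimes> (l \<otimes> a' \<otimes> l') \<otimes> k) d'" by blast
    moreover have "a \<otimes> (l \<otimes> a' \<otimes> l') \<otimes> k = a \<otimes> l \<otimes> h"
      using rword_Cons(2) lD a' ys by (simp add: m_assoc)
    ultimately show ?thesis by simp
  qed
qed

lemma rword_word_mult:
  assumes S: "\<And>d. d \<in> D \<Longrightarrow> subgroup (S d) G \<and> S d \<subseteq> stab H d" and bt: "backtrack_closed S"
    and w: "word S d g d1" and rw: "rword S d1 xs h d'"
  shows "\<exists>xs'. rword S d xs' (g \<otimes> h) d'"
  using w rw
proof (induction arbitrary: xs)
  case (word_Nil d a)
  then show ?case using rword_translate[OF _ _ S] by blast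
next
  case (word_Cons a d l d1 g d2)
  then obtain xs' where xs': "rword S d1 xs' (g \<otimes> h) d'" by blast
  have "\<exists>xs'. rword S d xs' (a \<otimes> l \<otimes> (g \<otimes> h)) d'"
    using rword_prefix[OF S bt word_Cons(1,2) xs'] .
  moreover have "a \<in> H" "l \<in> H" "h \<in> H"
    using word_Cons(1) T_D[OF word_Cons(2)] S[of d] rword_walk[OF word_Cons(5)] S by (auto simp: stab_def)
  moreover have "g \<in> H" using word_Cons(3)
  proof induction
    case (word_Cons a d l d1 h d')
    then show ?case using T_D[of d l d1] S[of d] by (auto simp: stab_def)
  qed (use S in \<open>auto simp: stab_def\<close>)
  ultimately show ?case by (simp add: m_assoc)
qed

lemma rword_imp_word: "rword S d xs h d' \<Longrightarrow> word S d h d'"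
  by (induction rule: rword.induct) (auto intro: word.intros)

text \<open>
  All elements of \<open>H\<close> are values of reduced words with letters in \<open>S\<close>. If the value fixes \<open>v\<close>, the
  walk of the word is closed, hence has no steps, and the word is a single letter from \<open>S v\<close>.
\<close>

lemma stab_eq_if_generating_words:
  assumes S: "\<And>d. d \<in> D \<Longrightarrow> subgroup (S d) G \<and> S d \<subseteq> stab H d" and bt: "backtrack_closed S"
    and v: "v \<in> D" and gen: "H = generate G Y"
    and words: "\<And>y. y \<in> Y \<Longrightarrow> word S v y v \<and> word S v (inv y) v"
  shows "stab H v = S v"
proof -
  have one: "rword S v [v] \<one> v" using v S[OF v] by (intro rword_Nil) (auto intro: subgroup.one_closed)
  have YH: "Y \<subseteq> H" unfolding gen by (auto intro: generate.incl)
  have ex: "\<exists>xs. rword S v xs h v" if "h \<in> generate G Y" for h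
    using that
  proof induction
    case one
    then show ?case using \<open>rword S v [v] \<one> v\<close> by blast
  next
    case (incl h)
    then show ?case using rword_word_mult[OF S bt _ one, of v h] words YH by force
  next
    case (inv h)
    then show ?case using rword_word_mult[OF S bt _ one, of v "inv h"] words YH by force
  next
    case (eng g h)
    then show ?case using rword_word_mult[OF S bt] rword_imp_word by blast
  qed
  have "h \<in> S v" if h: "h \<in> stab H v" for h
  proof -
    obtain xs where xs: "rword S v xs h v" using ex h gen by (auto simp: stab_def)
    then have "walk adj xs" "no_backtrack xs" "hd xs = last xs"
      using rword_walk[OF xs] S h by (auto simp: stab_def)
    then have "length xs = 1" by (rule closed_walk_backtracks)
    with xs show ?thesis
    proof cases
      case (rword_Cons a l d1 ys k)
      then show ?thesis using rword_walk[OF rword_Cons(5)] S \<open>length xs = 1\<close> by auto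
    qed auto
  qed
  then show ?thesis using S[OF v] by blast
qed

text \<open>
  By the previous lemma it suffices to find letter groups \<open>S d\<close> that are finitely generated, suffice
  to write the generators of \<open>H\<close>, and are closed under cancellation of backtracking. For given \<open>l\<close>
  and \<open>l'\<close>, the elements \<open>l a l'\<close> that fix \<open>d\<close> form a coset of a subgroup of an edge stabiliser, so one of
  them together with generators of the edge stabiliser is enough, and \<open>T\<close> is finite.
\<close>

lemma fg_vertex_stab:
  assumes fgH: "fg_subgroup G H"
    and fg_edge: "\<And>x y. (x, y) \<in> edges_in X \<Longrightarrow> fg_subgroup G (stab H x \<inter> stab H y)"
    and v: "v \<in> D"
  shows "fg_subgroup G (stab H v)"
proof -
  obtain Y where Y: "finite Y" "Y \<subseteq> carrier G" "H = generate G Y" using fgH by (auto simp: fg_subgroup_def)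
  have YH: "Y \<subseteq> H" unfolding Y(3) by (auto intro: generate.incl)
  define Z where "Z = Y \<union> m_inv G ` Y"
  have Z: "finite Z" "Z \<subseteq> H" using Y(1) YH by (auto simp: Z_def)
  have "\<exists>F. (\<forall>e. finite (F e) \<and> F e \<subseteq> stab H e) \<and> (\<forall>S. (\<forall>e. F e \<subseteq> S e) \<longrightarrow> word S v z v)"
    if "z \<in> Z" for z
    using that Z v by (intro word_finite_letters word_exists) auto
  then obtain F where F: "\<And>z e. z \<in> Z \<Longrightarrow> finite (F z e)" "\<And>z e. z \<in> Z \<Longrightarrow> F z e \<subseteq> stab H e"
    "\<And>z S. z \<in> Z \<Longrightarrow> (\<And>e. F z e \<subseteq> S e) \<Longrightarrow> word S v z v"
    by metis
  define P where "P d = {(l, d1, l'). (d, l, d1) \<in> T \<and> (d1, l', d) \<in> T}" for d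
  have "P d \<subseteq> (\<lambda>((_, l, d1), (_, l', _)). (l, d1, l')) ` (T \<times> T)" for d
    by (force simp: P_def)
  then have finP: "finite (P d)" for d using T finite_subset by blast
  define c where "c d = (\<lambda>(l, d1, l'). SOME c. c \<in> stab H d \<and> (\<exists>a\<in>stab H d1. c = l \<otimes> a \<otimes> l'))" for d
  define Q where "Q d = {(l, d1, l') \<in> P d. \<exists>c. c \<in> stab H d \<and> (\<exists>a\<in>stab H d1. c = l \<otimes> a \<otimes> l')}" for d
  have Q: "c d (l, d1, l') \<in> stab H d" "\<exists>a\<in>stab H d1. c d (l, d1, l') = l \<otimes> a \<otimes> l'"
    if "(l, d1, l') \<in> Q d" for d l d1 l'
  proof -
    have "\<exists>c. c \<in> stab H d \<and> (\<exists>a\<in>stab H d1. c = l \<otimes> a \<otimes> l')" using that by (auto simp: Q_def)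
    from someI_ex[OF this] show "c d (l, d1, l') \<in> stab H d" "\<exists>a\<in>stab H d1. c d (l, d1, l') = l \<otimes> a \<otimes> l'"
      by (auto simp: c_def)
  qed
  define \<S> where "\<S> d = (\<lambda>z. generate G {z}) ` (\<Union>z\<in>Z. F z d) \<union> (\<lambda>q. generate G {c d q}) ` Q d \<union>
      (\<lambda>(l, d1, l'). stab H d \<inter> stab H (act (inv l') d1)) ` Q d" for d
  define S where "S d = generate G (\<Union>(\<S> d))" for d
  have fin: "finite (\<S> d)" for d
    using finP[of d] Z(1) F(1) by (auto simp: \<S>_def Q_def intro: finite_subset[of _ "P d"])
  have sub: "subgroup (stab H d) G" if "d \<in> D" for d using that H D_V by (intro stab_subgroup)
  have \<S>: "fg_subgroup G s \<and> s \<subseteq> stab H d" if d: "d \<in> D" and s: "s \<in> \<S> d" for s d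
  proof -
    interpret st: subgroup "stab H d" G using sub[OF d] .
    have cyc: "fg_subgroup G (generate G {x}) \<and> generate G {x} \<subseteq> stab H d" if "x \<in> stab H d" for x
      using that sub[OF d] st.subset by (auto intro!: fg_subgroup_cyclic dest: subsetD[OF generate_subgroup_incl, rotated 2])
    have edge: "fg_subgroup G (stab H d \<inter> stab H (act (inv l') d1))" if "(l, d1, l') \<in> Q d" for l d1 l'
    proof (rule fg_edge)
      have t: "(d1, l', d) \<in> T" using that by (auto simp: Q_def P_def)
      then have V: "l' \<in> H" "d1 \<in> X" "d \<in> X" "d \<in> V" "(d1, act l' d) \<in> adj" using T_D[OF t] D(2) X_V T_adj[OF t] by auto
      have "(act (inv l') d1, act (inv l') (act l' d)) \<in> adj" using V by (intro act_adj) auto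
      then show "(d, act (inv l') d1) \<in> edges_in X" using V X_inv by (auto simp: edges_in_def adj_sym)
    qed
    consider z x where "z \<in> Z" "x \<in> F z d" "s = generate G {x}"
      | q where "q \<in> Q d" "s = generate G {c d q}"
      | l d1 l' where "(l, d1, l') \<in> Q d" "s = stab H d \<inter> stab H (act (inv l') d1)"
      using s by (auto simp: \<S>_def)
    then show ?thesis
    proof cases
      case 1
      then have "x \<in> stab H d" using F(2) by blast
      with 1 cyc show ?thesis by simp
    next
      case 2
      then have "c d q \<in> stab H d" using Q(1) by (cases q) auto
      with 2 cyc show ?thesis by simp
    qed (use edge in auto)
  qed
  have \<S>c: "\<Union>(\<S> d) \<subseteq> carrier G" if "d \<in> D" for d
    using \<S>[OF that] sub[OF that] subgroup.subset by blast
  have Sincl: "s \<subseteq> S d" if "s \<in> \<S> d" for s d using that by (auto simp: S_def intro: generate.incl)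
  have Ssub: "subgroup (S d) G \<and> S d \<subseteq> stab H d" if d: "d \<in> D" for d
    unfolding S_def using \<S>[OF d] \<S>c[OF d] sub[OF d]
    by (intro conjI generate_is_subgroup generate_subgroup_incl) auto
  have "fg_subgroup G (S d)" if d: "d \<in> D" for d
  proof (rule fg_subgroupI_parts[OF _ fin[of d]])
    show "subgroup (S d) G" using Ssub[OF d] by simp
    fix M assume M: "subgroup M G" "\<And>s. s \<in> \<S> d \<Longrightarrow> s \<subseteq> M"
    show "S d \<subseteq> M" unfolding S_def using M by (intro generate_subgroup_incl) auto
  qed (use \<S>[OF d] Sincl in auto)
  moreover have "stab H v = S v"
  proof (rule stab_eq_if_generating_words[OF Ssub _ v Y(3)])
    have letter: "F z e \<subseteq> S e" if "z \<in> Z" for z e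
    proof
      fix x assume "x \<in> F z e"
      then have "generate G {x} \<in> \<S> e" using that by (auto simp: \<S>_def)
      then show "x \<in> S e" using Sincl generate.incl[of x "{x}" G] by blast
    qed
    show "word S v y v \<and> word S v (inv y) v" if "y \<in> Y" for y
      using that F(3) letter by (auto simp: Z_def)
    show "backtrack_closed S"
      unfolding backtrack_closed_def
    proof (intro allI impI, elim conjE)
      fix d l d1 l' a
      assume l: "(d, l, d1) \<in> T" and l': "(d1, l', d) \<in> T" and a: "a \<in> stab H d1" and fixd: "act (l \<otimes> a \<otimes> l') d = d"
      have V: "l \<in> H" "l' \<in> H" "d \<in> D" "d \<in> V" "d1 \<in> V" "a \<in> H" "act a d1 = d1"
        using T_D[OF l] T_D[OF l'] D_V a by (auto simp: stab_def)
      have "l \<otimes> a \<otimes> l' \<in> stab H d" using V fixd by (auto simp: stab_def)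
      then have q: "(l, d1, l') \<in> Q d" using l l' a by (auto simp: Q_def P_def)
      obtain b where b: "b \<in> stab H d1" "c d (l, d1, l') = l \<otimes> b \<otimes> l'" using Q(2)[OF q] by blast
      have bH: "b \<in> H" "act b d1 = d1" using b by (auto simp: stab_def)
      \<comment> \<open>The quotient of the given element by the chosen one fixes both ends of an edge at \<open>d\<close>.\<close>
      define e where "e = inv l' \<otimes> (inv b \<otimes> a) \<otimes> l'"
      have eH: "e \<in> H" using V bH by (auto simp: e_def)
      have prod: "l \<otimes> a \<otimes> l' = (l \<otimes> b \<otimes> l') \<otimes> e"
      proof -
        have "b \<in> carrier G" "a \<in> carrier G" "l \<in> carrier G" "l' \<in> carrier G" using V bH by auto
        then show ?thesis by (simp add: e_def m_assoc)
      qed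
      have cst: "l \<otimes> b \<otimes> l' \<in> stab H d" using Q(1)[OF q] b by simp
      then have "e = inv (l \<otimes> b \<otimes> l') \<otimes> (l \<otimes> a \<otimes> l')"
        unfolding prod using V bH eH inv_cancel_left(1)[of "l \<otimes> b \<otimes> l'" e] by simp
      then have "e \<in> stab H d" using cst \<open>l \<otimes> a \<otimes> l' \<in> stab H d\<close> sub[OF V(3)]
        by (simp add: subgroup.m_closed subgroup.m_inv_closed)
      moreover have "act e (act (inv l') d1) = act (inv l') d1"
      proof -
        have "act (inv b) d1 = d1" using bH V by (metis H.mem_carrier act_inv_act)
        then show ?thesis using V bH by (simp add: e_def act_mult act_closed)
      qed
      ultimately have "e \<in> stab H d \<inter> stab H (act (inv l') d1)" using eH by (auto simp: stab_def)
      moreover have "stab H d \<inter> stab H (act (inv l') d1) \<in> \<S> d" using q by (force simp: \<S>_def)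
      ultimately have "e \<in> S d" using Sincl by blast
      moreover have "generate G {c d (l, d1, l')} \<in> \<S> d" using q by (force simp: \<S>_def)
      then have "c d (l, d1, l') \<in> S d" using Sincl generate.incl[of "c d (l, d1, l')" "{c d (l, d1, l')}" G] by blast
      ultimately show "l \<otimes> a \<otimes> l' \<in> S d"
        using Ssub[OF V(3)] unfolding prod b(2) by (auto intro: subgroup.m_closed)
    qed
  qed
  ultimately show ?thesis using v by simp
qed

end

context tree_action begin

lemma fg_stab_of_fg:
  assumes fg: "fg_subgroup G H" and X: "cofinite_subtree H X" and v: "v \<in> X"
    and edges: "\<And>x y. (x, y) \<in> edges_in X \<Longrightarrow> fg_subgroup G (stab H x \<inter> stab H y)"
  shows "fg_subgroup G (stab H v)"
proof -
  obtain D T where v: "v \<in> D" and "subtree_transversal G V adj act H X D T"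
    using exists_transversal[OF fg_subgroup_imp_subgroup[OF fg] X v] by blast
  then interpret subtree_transversal G V adj act H X D T by simp
  show ?thesis using fg edges v by (rule fg_vertex_stab)
qed

lemma fg_of_fg_stabs:
  assumes H: "subgroup H G" and X: "cofinite_subtree H X" "X \<noteq> {}"
    and fg: "\<And>x. x \<in> X \<Longrightarrow> fg_subgroup G (stab H x)"
  shows "fg_subgroup G H"
proof -
  obtain v where "v \<in> X" using X(2) by blast
  then obtain D T where v: "v \<in> D" and "subtree_transversal G V adj act H X D T"
    using exists_transversal[OF H X(1)] by blast
  then interpret subtree_transversal G V adj act H X D T by simp
  show ?thesis using fg D(2) v by (intro fg_if_vertex_stabs_fg) auto
qed

subsection \<open>Quotients with finite branching\<close>

lemma act_edges_in:
  "h \<in> carrier G \<Longrightarrow> (\<And>x. x \<in> X \<Longrightarrow> act h x \<in> X) \<Longrightarrow> (x, y) \<in> edges_in X \<Longrightarrow>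
    (act h x, act h y) \<in> edges_in X"
  by (auto simp: edges_in_def act_adj)

lemma edges_in_sym: "(x, y) \<in> edges_in X \<longleftrightarrow> (y, x) \<in> edges_in X"
  by (auto simp: edges_in_def adj_sym)

lemma cofinite_subtree_if_cofinite_edges:
  assumes L: "subgroup L G" and Z: "subtree Z" "Z \<noteq> {}"
    and inv: "\<And>l x. l \<in> L \<Longrightarrow> x \<in> Z \<Longrightarrow> act l x \<in> Z"
    and E: "finite E" "E \<subseteq> edges_in Z"
    and cover: "\<And>x y. (x, y) \<in> edges_in Z \<Longrightarrow> \<exists>l\<in>L. \<exists>(p, q)\<in>E. x = act l p \<and> y = act l q"
  shows "cofinite_subtree L Z"
proof -
  interpret L: subgroup L G by fact
  obtain z where z: "z \<in> Z" using Z by blast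
  have ZV: "Z \<subseteq> V" using Z by (simp add: subtree_def)
  let ?D = "insert z (fst ` E)"
  have "\<exists>l\<in>L. \<exists>d\<in>?D. x = act l d" if x: "x \<in> Z" for x
  proof -
    have "(x, z) \<in> (edges_in Z)\<^sup>*" using x z Z by (simp add: subtree_def)
    then show ?thesis
    proof (cases rule: converse_rtranclE)
      case base
      then have "x = act \<one> z" using z ZV act_one by auto
      then show ?thesis using L.one_closed by blast
    next
      case (step y)
      then show ?thesis using cover[OF step(1)] by force
    qed
  qed
  moreover have "finite ?D" "?D \<subseteq> Z" using E z by (auto simp: edges_in_def)
  ultimately have "\<exists>D. finite D \<and> D \<subseteq> Z \<and> (\<forall>x\<in>Z. \<exists>h\<in>L. \<exists>d\<in>D. x = act h d)" by blast
  moreover have "\<exists>E. finite E \<and> E \<subseteq> edges_in Z \<and>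
      (\<forall>(x, y)\<in>edges_in Z. \<exists>h\<in>L. \<exists>(p, q)\<in>E. x = act h p \<and> y = act h q)"
    using E cover by (intro exI[of _ E]) auto
  ultimately show ?thesis using Z inv unfolding cofinite_subtree_def by simp
qed

text \<open>
  In terms of the quotient graph: if finitely many oriented edges start at vertices of degree at
  least 2, then the connected quotient is finite. Indeed, if both ends of some edge have degree 1,
  that edge is the whole quotient; otherwise every edge, in one of its orientations, starts at a
  vertex of degree at least 2.
\<close>

lemma cofinite_subtree_if_cofinite_branching:
  assumes L: "subgroup L G" and Z: "subtree Z" "Z \<noteq> {}"
    and inv: "\<And>l x. l \<in> L \<Longrightarrow> x \<in> Z \<Longrightarrow> act l x \<in> Z"
    and E: "finite E" "E \<subseteq> V \<times> V"
    and branching: "\<And>x y y'. (x, y) \<in> edges_in Z \<Longrightarrow> (x, y') \<in> edges_in Z \<Longrightarrow>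
      (\<And>l. l \<in> stab L x \<Longrightarrow> act l y \<noteq> y') \<Longrightarrow> \<exists>l\<in>L. \<exists>(p, q)\<in>E. x = act l p \<and> y = act l q"
  shows "cofinite_subtree L Z"
proof -
  interpret L: subgroup L G by fact
  have ZV: "Z \<subseteq> V" using Z by (simp add: subtree_def)
  have eact: "(act l x, act l y) \<in> edges_in Z" if "l \<in> L" "(x, y) \<in> edges_in Z" for l x y
    using that inv by (intro act_edges_in) auto
  define transitive where
    "transitive x y \<longleftrightarrow> (\<forall>y'. (x, y') \<in> edges_in Z \<longrightarrow> (\<exists>l\<in>stab L x. y' = act l y))" for x y
  show ?thesis
  proof (cases "\<exists>x y. (x, y) \<in> edges_in Z \<and> transitive x y \<and> transitive y x")
    case True
    then obtain p q where pq: "(p, q) \<in> edges_in Z" "transitive p q" "transitive q p" by blast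
    then have pqZ: "p \<in> Z" "q \<in> Z" "p \<in> V" "q \<in> V" using ZV by (auto simp: edges_in_def)
    let ?E = "{(p, q), (q, p)}"
    have STEP: "\<exists>m\<in>L. x = act m a \<and> y = act m b"
      if ab: "transitive a b" "a \<in> V" "b \<in> V" and l: "l \<in> L" "x = act l a" "(x, y) \<in> edges_in Z" for l a b x y
    proof -
      have y: "y \<in> V" using l ZV by (auto simp: edges_in_def)
      have "(act (inv l) x, act (inv l) y) \<in> edges_in Z" using l by (intro eact) auto
      then have "(a, act (inv l) y) \<in> edges_in Z" using l ab by simp
      then obtain m where m: "m \<in> stab L a" "act (inv l) y = act m b" using ab(1) by (auto simp: transitive_def)
      then have mL: "m \<in> L" "act m a = a" by (auto simp: stab_def)
      have "y = act l (act m b)" using m(2) y l by (metis L.mem_carrier act_act_inv)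
      then have "y = act (l \<otimes> m) b" "x = act (l \<otimes> m) a" using mL l ab by (simp_all add: act_mult)
      then show ?thesis using mL l by blast
    qed
    have reach: "\<exists>l\<in>L. x = act l p \<or> x = act l q" if "x \<in> Z" for x
    proof -
      have "(p, x) \<in> (edges_in Z)\<^sup>*" using that pqZ Z by (simp add: subtree_def)
      then show ?thesis
      proof (induction)
        case base
        then show ?case using pqZ act_one by (metis L.one_closed)
      next
        case (step x y)
        then obtain l where l: "l \<in> L" "x = act l p \<or> x = act l q" by blast
        then show ?case
        proof (elim disjE)
          assume "x = act l p"
          from STEP[OF pq(2) pqZ(3,4) l(1) this step(2)] show ?thesis by blast
        next
          assume "x = act l q"
          from STEP[OF pq(3) pqZ(4,3) l(1) this step(2)] show ?thesis by blast
        qed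
      qed
    qed
    have "\<exists>l\<in>L. \<exists>(a, b)\<in>?E. x = act l a \<and> y = act l b" if xy: "(x, y) \<in> edges_in Z" for x y
    proof -
      obtain l where l: "l \<in> L" "x = act l p \<or> x = act l q" using reach xy by (auto simp: edges_in_def)
      from l(2) show ?thesis
      proof
        assume "x = act l p"
        from STEP[OF pq(2) pqZ(3,4) l(1) this xy] show ?thesis by auto
      next
        assume "x = act l q"
        from STEP[OF pq(3) pqZ(4,3) l(1) this xy] show ?thesis by auto
      qed
    qed
    moreover have "?E \<subseteq> edges_in Z" using pq(1) edges_in_sym by auto
    ultimately show ?thesis using L Z inv by (intro cofinite_subtree_if_cofinite_edges[of L Z ?E]) auto
  next
    case False
    let ?E = "(E \<union> E\<inverse>) \<inter> edges_in Z"
    have branch: "\<exists>l\<in>L. \<exists>(p, q)\<in>E \<inter> edges_in Z. x = act l p \<and> y = act l q"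
      if xy: "(x, y) \<in> edges_in Z" and nt: "\<not> transitive x y" for x y
    proof -
      obtain y' where y': "(x, y') \<in> edges_in Z" "\<And>l. l \<in> stab L x \<Longrightarrow> act l y \<noteq> y'"
        using nt by (auto simp: transitive_def)
      obtain l p q where l: "l \<in> L" "(p, q) \<in> E \<inter> V \<times> V" "x = act l p" "y = act l q"
        using branching[OF xy y'] E(2) by fast
      have "(act (inv l) x, act (inv l) y) \<in> edges_in Z" using l xy by (intro eact) auto
      then show ?thesis using l by auto
    qed
    have "\<exists>l\<in>L. \<exists>(a, b)\<in>?E. x = act l a \<and> y = act l b" if xy: "(x, y) \<in> edges_in Z" for x y
    proof (cases "transitive x y")
      case True
      then have "\<not> transitive y x" using False xy by blast
      from branch[OF _ this] xy obtain l p q where "l \<in> L" "(p, q) \<in> E" "(p, q) \<in> edges_in Z" "y = act l p" "x = act l q"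
        by (auto simp: edges_in_sym[of x])
      moreover have "(q, p) \<in> edges_in Z" using calculation by (simp add: edges_in_sym)
      ultimately show ?thesis by blast
    next
      case False
      from branch[OF xy this] show ?thesis by blast
    qed
    then show ?thesis using L Z inv E by (intro cofinite_subtree_if_cofinite_edges[of L Z ?E]) auto
  qed
qed

subsection \<open>Bridges\<close>

lemma subtree_vimage:
  assumes X: "subtree X" and g: "g \<in> carrier G"
  shows "subtree {x \<in> V. act g x \<in> X}" (is "subtree ?X")
proof -
  have "(x, y) \<in> (edges_in ?X)\<^sup>*" if "x \<in> ?X" "y \<in> ?X" for x y
  proof -
    have "(act g x, act g y) \<in> (edges_in X)\<^sup>*" using that X by (simp add: subtree_def)
    then have "(act (inv g) (act g x), act (inv g) (act g y)) \<in> (edges_in ?X)\<^sup>*"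
    proof (rule rtrancl_map)
      fix a b assume "(a, b) \<in> edges_in X"
      then have ab: "(a, b) \<in> adj" "a \<in> X" "b \<in> X" "a \<in> V" "b \<in> V" using X by (auto simp: edges_in_def subtree_def)
      then show "(act (inv g) a, act (inv g) b) \<in> edges_in ?X" using g by (simp add: edges_in_def act_adj)
    qed
    then show ?thesis using that g by simp
  qed
  then show ?thesis by (auto simp: subtree_def)
qed

text \<open>
  A shortest walk \<open>w\<close> from \<open>X\<close> to \<open>Y\<close> meets each of them in one vertex only. If \<open>l\<close> preserves \<open>X\<close> and \<open>Y\<close>,
  going from the start of \<open>w\<close> inside \<open>X\<close> to the start of \<open>l w\<close>, along \<open>l w\<close>, and inside \<open>Y\<close> to the end of
  \<open>w\<close> is a reduced walk with the same ends as \<open>w\<close>. By uniqueness it is \<open>w\<close>, and comparing lengths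
  shows \<open>l w = w\<close>.
\<close>

lemma bridge_between_disjoint_subtrees:
  assumes X: "subtree X" "X \<noteq> {}" and Y: "subtree Y" "Y \<noteq> {}" and disj: "X \<inter> Y = {}"
  obtains xs where "walk adj xs" "no_backtrack xs" "hd xs \<in> X" "last xs \<in> Y" "set xs \<subseteq> V"
    "\<And>l. l \<in> carrier G \<Longrightarrow> (\<And>x. x \<in> V \<Longrightarrow> act l x \<in> X \<longleftrightarrow> x \<in> X) \<Longrightarrow>
      (\<And>y. y \<in> V \<Longrightarrow> act l y \<in> Y \<longleftrightarrow> y \<in> Y) \<Longrightarrow> map (act l) xs = xs"
proof -
  define P where "P xs \<longleftrightarrow> walk adj xs \<and> no_backtrack xs \<and> hd xs \<in> X \<and> last xs \<in> Y" for xs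
  obtain x y where xy: "x \<in> X" "y \<in> Y" using X Y by blast
  then have "(x, y) \<in> adj\<^sup>*" using X Y by (intro connected) (auto simp: subtree_def)
  then have "\<exists>xs. P xs" using reduced_walk_exists[of x y adj] xy by (auto simp: P_def)
  then obtain xs where xs: "P xs" and min: "\<And>ys. P ys \<Longrightarrow> length xs \<le> length ys"
    using ex_has_least_nat[of P _ length] by blast
  have w: "walk adj xs" "no_backtrack xs" "hd xs \<in> X" "last xs \<in> Y" using xs by (auto simp: P_def)
  have ne: "xs \<noteq> []" "tl xs \<noteq> []" using w disj by (cases xs; cases "tl xs"; auto)+
  obtain x0 us where us: "xs = x0 # us" "us \<noteq> []" using ne by (cases xs) auto
  have "xs = butlast xs @ [last xs]" "butlast xs \<noteq> []" using us by auto
  then obtain xn vs where vs: "xs = vs @ [xn]" "vs \<noteq> []" by blast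
  have hdus: "hd us \<notin> X"
  proof
    assume "hd us \<in> X"
    then have "P us" using w us by (auto simp: P_def walk_Cons no_backtrack_Cons)
    from min[OF this] us show False by simp
  qed
  have lastvs: "last vs \<notin> Y"
  proof
    assume "last vs \<in> Y"
    then have "P vs" using w vs by (auto simp: P_def walk_append dest: no_backtrack_append)
    from min[OF this] vs show False by simp
  qed
  have XV: "X \<subseteq> V" and YV: "Y \<subseteq> V" using X Y by (auto simp: subtree_def)
  have setV: "set xs \<subseteq> V"
  proof -
    have "set ys \<subseteq> V" if "walk adj ys" "hd ys \<in> V" for ys :: "'v list"
      using that by (induction ys rule: no_backtrack.induct) (auto dest: adj_V)
    then show ?thesis using w XV by auto
  qed
  have "map (act l) xs = xs"
    if l: "l \<in> carrier G" and lX: "\<And>x. x \<in> V \<Longrightarrow> act l x \<in> X \<longleftrightarrow> x \<in> X"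
      and lY: "\<And>y. y \<in> V \<Longrightarrow> act l y \<in> Y \<longleftrightarrow> y \<in> Y" for l
  proof -
    have x0: "x0 \<in> X" "act l x0 \<in> X" using w(3) us lX setV by auto
    have "last xs = xn" "xn \<in> V" using vs setV by auto
    then have xn: "xn \<in> Y" "act l xn \<in> Y" using w(4) lY by auto
    obtain A where A: "walk adj A" "no_backtrack A" "hd A = x0" "last A = act l x0" "set A \<subseteq> X"
      using reduced_walk_in_subtree[OF X(1) x0] by blast
    obtain B where B: "walk adj B" "no_backtrack B" "hd B = act l xn" "last B = xn" "set B \<subseteq> Y"
      using reduced_walk_in_subtree[OF Y(1) xn(2,1)] by blast
    obtain A' where A': "A = A' @ [act l x0]" using A(1,4) by (cases A rule: rev_cases) auto
    obtain B' where B': "B = act l xn # B'" using B(1,3) by (cases B) auto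
    let ?w = "map (act l) xs"
    have lw: "walk adj ?w" "no_backtrack ?w"
      using act_walk[OF l w(1)] act_no_backtrack[OF l setV w(2)] by auto
    have nX: "act l (hd us) \<notin> X" using hdus lX us setV by (cases us) auto
    have nY: "act l (last vs) \<notin> Y" using lastvs lY vs setV by (cases vs rule: rev_cases) auto
    have w1: "walk adj (A' @ ?w)" "no_backtrack (A' @ ?w)"
    proof -
      show "walk adj (A' @ ?w)" using A(1) lw(1) A' us by (cases "A' = []") (auto simp: walk_append)
      have "no_backtrack (A' @ act l x0 # map (act l) us)"
      proof (rule no_backtrack_join)
        show "no_backtrack (A' @ [act l x0])" using A A' by simp
        show "no_backtrack (act l x0 # map (act l) us)" using lw us by simp
        show "last A' \<noteq> hd (map (act l) us)" if "A' \<noteq> []"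
          using A(5) A' nX us that by (auto simp: hd_map dest: last_in_set)
      qed
      then show "no_backtrack (A' @ ?w)" using us by simp
    qed
    have w2: "walk adj (A' @ ?w @ B')" "no_backtrack (A' @ ?w @ B')"
    proof -
      have "walk adj (tl B)" if "B' \<noteq> []" using B(1) B' that by (auto simp: walk_Cons)
      then show "walk adj (A' @ ?w @ B')"
        using w1(1) B(1) B' vs walk_append[of "A' @ ?w" B' adj]
        by (cases "B' = []") (simp_all add: walk_Cons)
      have "no_backtrack ((A' @ map (act l) vs) @ act l xn # B')"
      proof (rule no_backtrack_join)
        show "no_backtrack ((A' @ map (act l) vs) @ [act l xn])" using w1(2) vs by simp
        show "no_backtrack (act l xn # B')" using B B' by simp
        show "last (A' @ map (act l) vs) \<noteq> hd B'" if "B' \<noteq> []"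
          using B(5) B' nY vs that by (auto simp: last_map dest: hd_in_set)
      qed
      then show "no_backtrack (A' @ ?w @ B')" using vs by simp
    qed
    have "hd (A' @ ?w @ B') = hd xs" using A(3) A' us by (cases A') auto
    moreover have "last (A' @ ?w @ B') = last xs" using B(4) B' vs by (auto simp: last_append split: if_splits)
    ultimately have eq: "A' @ ?w @ B' = xs" by (intro reduced_walk_unique w2 w)
    from arg_cong[OF this, of length] have "A' = []" "B' = []" by auto
    with eq show ?thesis by simp
  qed
  with w setV show ?thesis by (intro that[of xs]) auto
qed

end

lemma finite_image_if_factors:
  assumes "finite (g ` S)" "\<And>x y. x \<in> S \<Longrightarrow> y \<in> S \<Longrightarrow> g x = g y \<Longrightarrow> f x = f y"
  shows "finite (f ` S)"
proof -
  have "f x = f (inv_into S g (g x))" if "x \<in> S" for x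
    using that by (intro assms(2)) (auto simp: inv_into_into f_inv_into_f)
  then have "f ` S \<subseteq> (\<lambda>E. f (inv_into S g E)) ` (g ` S)" by blast
  then show ?thesis using assms(1) finite_surj by blast
qed

section \<open>Double cosets\<close>

context group begin

lemma mem_dcoset_iff: "z \<in> dcoset G B h C \<longleftrightarrow> (\<exists>b\<in>B. \<exists>c\<in>C. z = b \<otimes> h \<otimes> c)"
  by (auto simp: dcoset_def r_coset_def set_mult_def)

lemma dcoset_self: "subgroup B G \<Longrightarrow> subgroup C G \<Longrightarrow> h \<in> carrier G \<Longrightarrow> h \<in> dcoset G B h C"
  unfolding mem_dcoset_iff by (metis r_one l_one subgroup.one_closed)

lemma dcoset_eqI:
  assumes B: "subgroup B G" and C: "subgroup C G" and h: "h \<in> carrier G" and h': "h' \<in> dcoset G B h C"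
  shows "dcoset G B h' C = dcoset G B h C"
proof -
  interpret B: subgroup B G by fact
  interpret C: subgroup C G by fact
  obtain b c where bc: "b \<in> B" "c \<in> C" "h' = b \<otimes> h \<otimes> c" using h' by (auto simp: mem_dcoset_iff)
  have "x \<otimes> h' \<otimes> y = (x \<otimes> b) \<otimes> h \<otimes> (c \<otimes> y)" "x \<otimes> h \<otimes> y = (x \<otimes> inv b) \<otimes> h' \<otimes> (inv c \<otimes> y)"
    if "x \<in> B" "y \<in> C" for x y
  proof -
    have car: "b \<in> carrier G" "c \<in> carrier G" "x \<in> carrier G" "y \<in> carrier G" using bc that by auto
    with h bc show "x \<otimes> h' \<otimes> y = (x \<otimes> b) \<otimes> h \<otimes> (c \<otimes> y)" by (simp add: m_assoc)
    from car h bc show "x \<otimes> h \<otimes> y = (x \<otimes> inv b) \<otimes> h' \<otimes> (inv c \<otimes> y)" by (simp add: m_assoc)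
  qed
  then have sub: "x \<otimes> h' \<otimes> y \<in> dcoset G B h C" "x \<otimes> h \<otimes> y \<in> dcoset G B h' C" if "x \<in> B" "y \<in> C" for x y
    unfolding mem_dcoset_iff using that bc(1,2) B.m_closed C.m_closed B.m_inv_closed C.m_inv_closed by blast+
  show ?thesis
  proof
    show "dcoset G B h' C \<subseteq> dcoset G B h C"
      by (rule subsetI, subst (asm) mem_dcoset_iff) (use sub(1) in \<open>elim bexE, simp\<close>)
    show "dcoset G B h C \<subseteq> dcoset G B h' C"
      by (rule subsetI, subst (asm) mem_dcoset_iff) (use sub(2) in \<open>elim bexE, simp\<close>)
  qed
qed

lemma dcoset_mult_eq:
  assumes H: "subgroup H G" and K: "subgroup K G" and "h \<in> H" "k \<in> K" "g \<in> carrier G"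
  shows "dcoset G H (h \<otimes> g \<otimes> k) K = dcoset G H g K"
  using assms by (intro dcoset_eqI) (auto simp: mem_dcoset_iff)

lemma mem_conj_set_iff: "H \<subseteq> carrier G \<Longrightarrow> g \<in> carrier G \<Longrightarrow>
    x \<in> conj_set G H g \<longleftrightarrow> x \<in> carrier G \<and> g \<otimes> x \<otimes> inv g \<in> H"
proof -
  assume H: "H \<subseteq> carrier G" and g: "g \<in> carrier G"
  show ?thesis
  proof
    assume "x \<in> conj_set G H g"
    then obtain h where h: "h \<in> H" "x = inv g \<otimes> h \<otimes> g"
      by (auto simp: conj_set_def l_coset_def r_coset_def)
    then have "h \<in> carrier G" using H by auto
    then have "g \<otimes> x \<otimes> inv g = h" unfolding h(2) using g by (simp add: m_assoc)
    with h g \<open>h \<in> carrier G\<close> show "x \<in> carrier G \<and> g \<otimes> x \<otimes> inv g \<in> H" by simp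
  next
    assume x: "x \<in> carrier G \<and> g \<otimes> x \<otimes> inv g \<in> H"
    then have "x = inv g \<otimes> (g \<otimes> x \<otimes> inv g) \<otimes> g" using g by (simp add: m_assoc)
    with x show "x \<in> conj_set G H g"
      unfolding conj_set_def l_coset_def r_coset_def by blast
  qed
qed

lemma conj_set_subgroup:
  assumes H: "subgroup H G" and g: "g \<in> carrier G"
  shows "subgroup (conj_set G H g) G"
proof -
  interpret H: subgroup H G by fact
  note mem = mem_conj_set_iff[OF H.subset g]
  show ?thesis
  proof (rule subgroupI)
    have "\<one> \<in> conj_set G H g" using g by (simp add: mem)
    then show "conj_set G H g \<noteq> {}" by blast
    show "conj_set G H g \<subseteq> carrier G" using mem by blast
    fix a b assume "a \<in> conj_set G H g"
    then have a: "a \<in> carrier G" "g \<otimes> a \<otimes> inv g \<in> H" by (simp_all add: mem)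
    have "inv (g \<otimes> a \<otimes> inv g) = g \<otimes> inv a \<otimes> inv g" using a(1) g by (simp add: inv_mult_group m_assoc)
    then have "g \<otimes> inv a \<otimes> inv g \<in> H" using H.m_inv_closed[OF a(2)] by simp
    then show "inv a \<in> conj_set G H g" using a(1) by (simp add: mem)
    assume "b \<in> conj_set G H g"
    then have b: "b \<in> carrier G" "g \<otimes> b \<otimes> inv g \<in> H" by (simp_all add: mem)
    have "(g \<otimes> a \<otimes> inv g) \<otimes> (g \<otimes> b \<otimes> inv g) = g \<otimes> (a \<otimes> b) \<otimes> inv g"
      using a(1) b(1) g by (simp add: m_assoc)
    then have "g \<otimes> (a \<otimes> b) \<otimes> inv g \<in> H" using H.m_closed[OF a(2) b(2)] by simp
    then show "a \<otimes> b \<in> conj_set G H g" using a(1) b(1) by (simp add: mem)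
  qed
qed

end

section \<open>Collisions counted by the f.c.i.p.\<close>

text \<open>
  If \<open>N\<close> is the number of elements of \<open>Q\<close> with image \<open>E\<close>, then \<open>E\<close> contributes \<open>max 0 (N - 1)\<close> to the sum
  in the f.c.i.p. So \<open>N\<close> is always finite, and \<open>N \<ge> 2\<close> for finitely many \<open>E\<close>: only finitely many
  elements share their image with another one.
\<close>

lemma fcip_rel_finite_collisions:
  fixes A :: "('c, 'm) monoid_scheme"
  assumes A: "group A" and fcip: "fcip_rel A I \<A>" and I: "finite I"
    and \<A>: "\<And>i. i \<in> I \<Longrightarrow> subgroup (\<A> i) A"
    and B: "fg_subgroup A B" and C: "fg_subgroup A C"
    and F: "\<And>i. i \<in> I \<Longrightarrow> finite (F i) \<and> F i \<subseteq> carrier A \<and> inj_on (\<lambda>f. dcoset A B f (\<A> i)) (F i)"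
    and F': "\<And>i. i \<in> I \<Longrightarrow> finite (F' i) \<and> F' i \<subseteq> carrier A \<and> inj_on (\<lambda>f. dcoset A C f (\<A> i)) (F' i)"
  defines "Q \<equiv> {((i, f, g), D). i \<in> I \<and> f \<in> F i \<and> g \<in> F' i \<and> D \<in> q_dom A (\<A> i) B C f g}"
    and "\<kappa> \<equiv> \<lambda>((i, f, g), D). q_map A B C f g D"
  shows "finite {q \<in> Q. \<exists>q'\<in>Q. q' \<noteq> q \<and> \<kappa> q' = \<kappa> q}"
proof -
  interpret group A by fact
  have BC: "subgroup B A" "subgroup C A" using B C by (auto intro: fg_subgroup_imp_subgroup)
  define Tr where "Tr = Sigma I (\<lambda>i. F i \<times> F' i)"
  have finTr: "finite Tr" using I F F' by (auto simp: Tr_def)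
  define fib where "fib t E = (case t of (i, f, g) \<Rightarrow> q_fibre A (\<A> i) B C f g E)" for t E
  define N where "N E = (\<Sum>t\<in>Tr. emeasure (count_space UNIV) (fib t E))" for E
  let ?DC = "dcosets A B (carrier A) C"
  have fin: "(\<Sum>\<^sub>\<infinity>E\<in>?DC. max 0 (N E - 1)) < (\<infinity> :: ennreal)"
  proof -
    have "(\<Sum>\<^sub>\<infinity>i\<in>I. \<Sum>f\<in>F i. \<Sum>g\<in>F' i. emeasure (count_space UNIV) (q_fibre A (\<A> i) B C f g E)) = N E" for E
    proof -
      have "N E = (\<Sum>i\<in>I. \<Sum>(f, g)\<in>F i \<times> F' i. emeasure (count_space UNIV) (q_fibre A (\<A> i) B C f g E))"
        unfolding N_def Tr_def fib_def using I F F' by (subst sum.Sigma) (auto intro!: sum.cong)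
      then show ?thesis using I by (simp add: sum.cartesian_product)
    qed
    moreover have "(\<Sum>\<^sub>\<infinity>E\<in>?DC. max 0 ((\<Sum>\<^sub>\<infinity>i\<in>I. \<Sum>f\<in>F i. \<Sum>g\<in>F' i.
        emeasure (count_space UNIV) (q_fibre A (\<A> i) B C f g E)) - 1)) < (\<infinity> :: ennreal)"
      using fcip[unfolded fcip_rel_def, rule_format, of B C F F'] B C F F' by blast
    ultimately show ?thesis by simp
  qed
  have summable: "(f :: _ \<Rightarrow> ennreal) summable_on S" for f S by (rule nonneg_summable_on_complete) simp
  have Nfin: "N E < \<infinity>" if "E \<in> ?DC" for E
  proof -
    have "max 0 (N E - 1) = (\<Sum>\<^sub>\<infinity>E\<in>{E}. max 0 (N E - 1))" by simp
    also have "\<dots> \<le> (\<Sum>\<^sub>\<infinity>E\<in>?DC. max 0 (N E - 1))"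
      using that by (intro infsum_mono_neutral summable) auto
    also have "\<dots> < \<infinity>" by (rule fin)
    finally show ?thesis by (cases "N E") (auto simp: top_unique max_def)
  qed
  have bad_fin: "finite {E \<in> ?DC. N E \<ge> 2}"
  proof (rule ccontr)
    assume "infinite {E \<in> ?DC. N E \<ge> 2}"
    then have "(\<Sum>\<^sub>\<infinity>E\<in>{E \<in> ?DC. N E \<ge> 2}. max 0 (N E - 1)) = \<infinity>"
    proof (rule infsum_superconst_infinite_ennreal[where b = 1, rotated 2])
      fix E assume "E \<in> {E \<in> ?DC. N E \<ge> 2}"
      then have "2 - 1 \<le> N E - 1" by (intro ennreal_minus_mono) auto
      moreover have "2 - 1 = (1 :: ennreal)" by (simp add: one_add_one[symmetric] del: one_add_one)
      ultimately show "1 \<le> max 0 (N E - 1)" by (simp add: max_def)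
    qed simp
    moreover have "(\<Sum>\<^sub>\<infinity>E\<in>{E \<in> ?DC. N E \<ge> 2}. max 0 (N E - 1)) \<le> (\<Sum>\<^sub>\<infinity>E\<in>?DC. max 0 (N E - 1))"
      by (intro infsum_mono_neutral summable) auto
    ultimately show False using fin by (simp add: top_unique)
  qed
  have fib_fin: "finite (fib t E)" if "t \<in> Tr" "E \<in> ?DC" for t E
  proof -
    have "emeasure (count_space UNIV) (fib t E) \<le> N E"
      unfolding N_def using that finTr by (intro member_le_sum) auto
    from le_less_trans[OF this Nfin[OF that(2)]] have "emeasure (count_space UNIV) (fib t E) < \<infinity>" .
    then show ?thesis by (auto simp: emeasure_count_space split: if_splits)
  qed
  have Qfib: "q \<in> Q \<longleftrightarrow> fst q \<in> Tr \<and> snd q \<in> fib (fst q) (\<kappa> q)" for q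
    by (cases q) (auto simp: Q_def Tr_def fib_def \<kappa>_def q_fibre_def)
  have \<kappa>DC: "\<kappa> q \<in> ?DC" if q: "q \<in> Q" for q
  proof -
    obtain i f g D where q': "q = ((i, f, g), D)" by (metis prod.collapse)
    have i: "i \<in> I" "f \<in> carrier A" "g \<in> carrier A" using q q' F F' by (auto simp: Q_def)
    obtain a where a: "a \<in> \<A> i" "D = dcoset A (\<A> i \<inter> conj_set A B f) a (\<A> i \<inter> conj_set A C g)"
      using q q' by (auto simp: Q_def q_dom_def dcosets_def)
    have "\<kappa> q = dcoset A B (f \<otimes>\<^bsub>A\<^esub> a \<otimes>\<^bsub>A\<^esub> inv\<^bsub>A\<^esub> g) C"
      unfolding q' \<kappa>_def prod.case a(2) using \<A>[OF i(1)] BC i a A by (intro q_map_dcoset)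
    moreover have "a \<in> carrier A" using a \<A>[OF i(1)] subgroup.subset by blast
    ultimately show ?thesis using i by (auto simp: dcosets_def)
  qed
  have two: "N (\<kappa> q) \<ge> 2" if q: "q \<in> Q" "q' \<in> Q" "q' \<noteq> q" "\<kappa> q' = \<kappa> q" for q q'
  proof -
    let ?e = "\<lambda>t. emeasure (count_space UNIV) (fib t (\<kappa> q))"
    have t: "fst q \<in> Tr" "snd q \<in> fib (fst q) (\<kappa> q)" "fst q' \<in> Tr" "snd q' \<in> fib (fst q') (\<kappa> q)"
      using q Qfib by metis+
    have card: "?e t = of_nat (card (fib t (\<kappa> q)))" if "t \<in> Tr" for t
      using fib_fin[OF that \<kappa>DC[OF q(1)]] by (simp add: emeasure_count_space)
    show ?thesis
    proof (cases "fst q = fst q'")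
      case True
      then have "snd q \<noteq> snd q'" using q by (simp add: prod_eq_iff)
      then have "card {snd q, snd q'} = 2" by simp
      moreover have "card {snd q, snd q'} \<le> card (fib (fst q) (\<kappa> q))"
        using t True fib_fin[OF t(1) \<kappa>DC[OF q(1)]] by (intro card_mono) auto
      ultimately have "2 \<le> card (fib (fst q) (\<kappa> q))" by simp
      then have "2 \<le> ?e (fst q)" using card[OF t(1)] by (metis of_nat_le_iff of_nat_numeral)
      also have "\<dots> \<le> N (\<kappa> q)" unfolding N_def using t finTr by (intro member_le_sum) auto
      finally show ?thesis .
    next
      case False
      have one: "1 \<le> ?e t" if "t \<in> Tr" "x \<in> fib t (\<kappa> q)" for t x
      proof -
        have "card {x} \<le> card (fib t (\<kappa> q))" using that fib_fin[OF that(1) \<kappa>DC[OF q(1)]] by (intro card_mono) auto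
        then have "1 \<le> card (fib t (\<kappa> q))" by simp
        then show ?thesis using card[OF that(1)] by (metis of_nat_le_iff of_nat_1)
      qed
      have "2 = 1 + (1 :: ennreal)" by simp
      also have "\<dots> \<le> ?e (fst q) + ?e (fst q')" using one t by (intro add_mono) blast+
      also have "\<dots> = sum ?e {fst q, fst q'}" using False by simp
      also have "\<dots> \<le> N (\<kappa> q)" unfolding N_def using t finTr by (intro sum_mono2) auto
      finally show ?thesis .
    qed
  qed
  have "{q \<in> Q. \<exists>q'\<in>Q. q' \<noteq> q \<and> \<kappa> q' = \<kappa> q} \<subseteq> (\<Union>E\<in>{E \<in> ?DC. N E \<ge> 2}. Sigma Tr (\<lambda>t. fib t E))"
  proof
    fix q assume "q \<in> {q \<in> Q. \<exists>q'\<in>Q. q' \<noteq> q \<and> \<kappa> q' = \<kappa> q}"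
    then obtain q' where "q \<in> Q" "q' \<in> Q" "q' \<noteq> q" "\<kappa> q' = \<kappa> q" by blast
    then have "q \<in> Q" "N (\<kappa> q) \<ge> 2" using two by blast+
    moreover have "q \<in> Sigma Tr (\<lambda>t. fib t (\<kappa> q))" using Qfib[of q] \<open>q \<in> Q\<close> by (cases q) auto
    ultimately show "q \<in> (\<Union>E\<in>{E \<in> ?DC. N E \<ge> 2}. Sigma Tr (\<lambda>t. fib t E))" using \<kappa>DC by blast
  qed
  moreover have "finite (\<Union>E\<in>{E \<in> ?DC. N E \<ge> 2}. Sigma Tr (\<lambda>t. fib t E))"
    using bad_fin finTr fib_fin by (intro finite_UN_I finite_SigmaI) auto
  ultimately show ?thesis by (rule finite_subset)
qed

section \<open>Actions with given vertex and edge groups\<close>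

text \<open>
  What is needed of the Bass-Serre tree. The vertices \<open>b u\<close> represent all orbits, and \<open>\<phi> u\<close> identifies
  the abstract group \<open>A u\<close> with the stabiliser of \<open>b u\<close>. The neighbours \<open>n i\<close>, for \<open>i \<in> I u\<close>, represent
  the orbits of edges at \<open>b u\<close>, without repetition, and \<open>Ed i\<close> is the stabiliser of such an edge inside
  \<open>A u\<close>.
\<close>

locale charted_tree_action = tree_action G V adj act
  for G (structure) and V :: "'v set" and adj act +
  fixes U :: "'u set" and b :: "'u \<Rightarrow> 'v" and A :: "'u \<Rightarrow> 'c monoid" and \<phi> :: "'u \<Rightarrow> 'c \<Rightarrow> 'a"
    and I :: "'u \<Rightarrow> 'i set" and Ed :: "'i \<Rightarrow> 'c set" and n :: "'i \<Rightarrow> 'v"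
  assumes V_nonempty: "V \<noteq> {}"
    and \<phi>_hom: "u \<in> U \<Longrightarrow> group_hom (A u) G (\<phi> u)"
    and \<phi>_inj: "u \<in> U \<Longrightarrow> inj_on (\<phi> u) (carrier (A u))"
    and b_V: "u \<in> U \<Longrightarrow> b u \<in> V"
    and \<phi>_image: "u \<in> U \<Longrightarrow> \<phi> u ` carrier (A u) = stab (carrier G) (b u)"
    and b_cover: "x \<in> V \<Longrightarrow> \<exists>u\<in>U. \<exists>g\<in>carrier G. x = act g (b u)"
    and I_finite: "u \<in> U \<Longrightarrow> finite (I u)"
    and n_adj: "u \<in> U \<Longrightarrow> i \<in> I u \<Longrightarrow> (b u, n i) \<in> adj"
    and Ed_eq: "u \<in> U \<Longrightarrow> i \<in> I u \<Longrightarrow> Ed i = {a \<in> carrier (A u). act (\<phi> u a) (n i) = n i}"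
    and n_cover: "u \<in> U \<Longrightarrow> (b u, y) \<in> adj \<Longrightarrow> \<exists>i\<in>I u. \<exists>a\<in>carrier (A u). y = act (\<phi> u a) (n i)"
    and n_unique: "u \<in> U \<Longrightarrow> i \<in> I u \<Longrightarrow> j \<in> I u \<Longrightarrow> a \<in> carrier (A u) \<Longrightarrow>
      act (\<phi> u a) (n i) = n j \<Longrightarrow> i = j"
    and no_inversion: "g \<in> carrier G \<Longrightarrow> (x, y) \<in> adj \<Longrightarrow> act g x = y \<Longrightarrow> act g y \<noteq> x"
    and fcip: "u \<in> U \<Longrightarrow> fcip_rel (A u) (I u) Ed"
    and Ed_fg: "u \<in> U \<Longrightarrow> i \<in> I u \<Longrightarrow> fg_subgroup (A u) (Ed i)"
    and edge_fgip: "(x, y) \<in> adj \<Longrightarrow> fgip_rel G (stab (carrier G) x \<inter> stab (carrier G) y)"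
begin

text \<open>
  The vertex \<open>p (b u)\<close> has many charts, one for each \<open>p\<close> leading to it; a vertex of one orbit can thus be
  compared with representatives of its \<open>H\<close>-orbit and its \<open>K\<close>-orbit.
\<close>

definition chart :: "'u \<Rightarrow> 'a \<Rightarrow> 'c \<Rightarrow> 'a" where
  "chart u p a = p \<otimes> \<phi> u a \<otimes> inv p"

definition pull :: "'u \<Rightarrow> 'a \<Rightarrow> 'a set \<Rightarrow> 'c set" where
  "pull u p H = {a \<in> carrier (A u). chart u p a \<in> H}"

lemma A_group: "u \<in> U \<Longrightarrow> group (A u)"
  using \<phi>_hom by (auto simp: group_hom_def)

lemma \<phi>_closed [simp]: "u \<in> U \<Longrightarrow> a \<in> carrier (A u) \<Longrightarrow> \<phi> u a \<in> carrier G"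
  using \<phi>_hom by (rule group_hom.hom_closed)

lemma \<phi>_mult: "u \<in> U \<Longrightarrow> a \<in> carrier (A u) \<Longrightarrow> a' \<in> carrier (A u) \<Longrightarrow>
    \<phi> u (a \<otimes>\<^bsub>A u\<^esub> a') = \<phi> u a \<otimes> \<phi> u a'"
  using \<phi>_hom by (rule group_hom.hom_mult)

lemma \<phi>_inv: "u \<in> U \<Longrightarrow> a \<in> carrier (A u) \<Longrightarrow> \<phi> u (inv\<^bsub>A u\<^esub> a) = inv (\<phi> u a)"
  using \<phi>_hom by (rule group_hom.hom_inv)

lemma \<phi>_fix: "u \<in> U \<Longrightarrow> a \<in> carrier (A u) \<Longrightarrow> act (\<phi> u a) (b u) = b u"
  using \<phi>_image by (auto simp: stab_def)

lemma \<phi>_surj: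
  assumes "u \<in> U" "g \<in> carrier G" "act g (b u) = b u"
  obtains a where "a \<in> carrier (A u)" "g = \<phi> u a"
  using assms \<phi>_image[OF assms(1)] by (auto simp: stab_def)

lemma n_V: "u \<in> U \<Longrightarrow> i \<in> I u \<Longrightarrow> n i \<in> V"
  using n_adj adj_V by blast

lemma chart_hom: "u \<in> U \<Longrightarrow> p \<in> carrier G \<Longrightarrow> group_hom (A u) G (chart u p)"
  unfolding group_hom_def group_hom_axioms_def
  by (auto simp: A_group intro!: homI) (auto simp: chart_def \<phi>_mult m_assoc A_group)

lemma chart_inj: "u \<in> U \<Longrightarrow> p \<in> carrier G \<Longrightarrow> inj_on (chart u p) (carrier (A u))"
  using \<phi>_inj[of u] by (auto simp: inj_on_def chart_def)

lemma chart_closed [simp]: "u \<in> U \<Longrightarrow> p \<in> carrier G \<Longrightarrow> a \<in> carrier (A u) \<Longrightarrow> chart u p a \<in> carrier G"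
  by (simp add: chart_def)

lemma chart_act: "u \<in> U \<Longrightarrow> p \<in> carrier G \<Longrightarrow> a \<in> carrier (A u) \<Longrightarrow> x \<in> V \<Longrightarrow>
    act (chart u p a) (act p x) = act p (act (\<phi> u a) x)"
  by (simp add: chart_def act_mult)

lemma chart_fix: "u \<in> U \<Longrightarrow> p \<in> carrier G \<Longrightarrow> a \<in> carrier (A u) \<Longrightarrow>
    act (chart u p a) (act p (b u)) = act p (b u)"
  by (simp add: chart_act b_V \<phi>_fix)

lemma chart_surj:
  assumes u: "u \<in> U" and p: "p \<in> carrier G" and g: "g \<in> carrier G" "act g (act p (b u)) = act p (b u)"
  obtains a where "a \<in> carrier (A u)" "g = chart u p a"
proof -
  have "act (inv p \<otimes> g \<otimes> p) (b u) = b u" using u p g b_V[OF u] by (simp add: act_mult)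
  then obtain a where a: "a \<in> carrier (A u)" "inv p \<otimes> g \<otimes> p = \<phi> u a"
    using \<phi>_surj[OF u, of "inv p \<otimes> g \<otimes> p"] p g by auto
  have "chart u p a = g" unfolding chart_def a(2)[symmetric] using p g by (simp add: m_assoc)
  with a that show ?thesis by blast
qed

lemma stab_eq_chart_pull:
  assumes "u \<in> U" "p \<in> carrier G" "H \<subseteq> carrier G"
  shows "stab H (act p (b u)) = chart u p ` pull u p H"
proof
  show "stab H (act p (b u)) \<subseteq> chart u p ` pull u p H"
  proof
    fix g assume g: "g \<in> stab H (act p (b u))"
    then have "g \<in> carrier G" using assms(3) by (auto simp: stab_def)
    with g obtain a where "a \<in> carrier (A u)" "g = chart u p a"
      using chart_surj[OF assms(1,2)] by (auto simp: stab_def)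
    with g show "g \<in> chart u p ` pull u p H" by (auto simp: pull_def stab_def)
  qed
  show "chart u p ` pull u p H \<subseteq> stab H (act p (b u))"
    using assms by (auto simp: pull_def stab_def chart_fix)
qed

lemma pull_subset: "pull u p H \<subseteq> carrier (A u)"
  by (auto simp: pull_def)

lemma fg_pull:
  assumes "u \<in> U" "p \<in> carrier G" "H \<subseteq> carrier G" and fg: "fg_subgroup G (stab H (act p (b u)))"
  shows "fg_subgroup (A u) (pull u p H)"
proof -
  interpret c: group_hom "A u" G "chart u p" using assms by (intro chart_hom)
  have "pull u p H = {a \<in> carrier (A u). chart u p a \<in> stab H (act p (b u))}"
    using assms by (auto simp: pull_def stab_def chart_fix)
  moreover have "stab H (act p (b u)) \<subseteq> chart u p ` carrier (A u)"
    using stab_eq_chart_pull[OF assms(1-3)] pull_subset by blast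
  ultimately show ?thesis using c.fg_subgroup_vimage[OF chart_inj fg] assms by simp
qed

lemma fg_stab:
  assumes H: "fg_subgroup G H" and X: "cofinite_subtree H X" and x: "x \<in> X"
  shows "fg_subgroup G (stab H x)"
proof (rule fg_stab_of_fg[OF H X x])
  fix x y assume "(x, y) \<in> edges_in X"
  then have "fg_subgroup G (H \<inter> (stab (carrier G) x \<inter> stab (carrier G) y))"
    using edge_fgip H by (auto simp: fgip_rel_def edges_in_def)
  moreover have "H \<inter> (stab (carrier G) x \<inter> stab (carrier G) y) = stab H x \<inter> stab H y"
    using subgroup.subset[OF fg_subgroup_imp_subgroup[OF H]] by (auto simp: stab_def)
  ultimately show "fg_subgroup G (stab H x \<inter> stab H y)" by simp
qed

lemma fg_stab_Int:
  assumes fgip: "\<And>u. u \<in> U \<Longrightarrow> fgip (A u)" and x: "x \<in> V"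
    and H: "H \<subseteq> carrier G" "fg_subgroup G (stab H x)" and K: "K \<subseteq> carrier G" "fg_subgroup G (stab K x)"
  shows "fg_subgroup G (stab (H \<inter> K) x)"
proof -
  obtain u p where u: "u \<in> U" "p \<in> carrier G" "x = act p (b u)" using b_cover[OF x] by blast
  interpret c: group_hom "A u" G "chart u p" using u by (intro chart_hom)
  have "fg_subgroup (A u) (pull u p H \<inter> pull u p K)"
    using fgip[OF u(1)] fg_pull[OF u(1,2)] H K u(3) by (auto simp: fgip_def)
  then have "fg_subgroup G (chart u p ` (pull u p H \<inter> pull u p K))" by (rule c.fg_subgroup_image)
  moreover have "pull u p H \<inter> pull u p K = pull u p (H \<inter> K)" by (auto simp: pull_def)
  ultimately show ?thesis using stab_eq_chart_pull[OF u(1,2) le_infI1[OF H(1)], of K] u(3) by simp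
qed

lemma Ed_subgroup: "u \<in> U \<Longrightarrow> i \<in> I u \<Longrightarrow> subgroup (Ed i) (A u)"
  using Ed_fg A_group group.fg_subgroup_imp_subgroup by metis

text \<open>
  The edges of \<open>X\<close> at \<open>p (b u)\<close> in the orbit of \<open>i\<close> are \<open>p f (n i)\<close> with \<open>f\<close> determined up to \<open>Ed i\<close>, so
  their orbits under the stabiliser in \<open>H\<close> are double cosets in \<open>A u\<close>. The sets \<open>F i\<close> are the finite
  sets of representatives that the f.c.i.p. asks for.
\<close>

lemma edge_orbit_representatives:
  assumes H: "fg_subgroup G H" and X: "cofinite_subtree H X" and u: "u \<in> U" "p \<in> carrier G"
    and x: "act p (b u) \<in> X"
  obtains F where "\<And>i. i \<in> I u \<Longrightarrow> finite (F i) \<and> F i \<subseteq> carrier (A u) \<and>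
      inj_on (\<lambda>f. dcoset (A u) (pull u p H) f (Ed i)) (F i)"
    and "\<And>y. (act p (b u), y) \<in> edges_in X \<Longrightarrow> \<exists>i\<in>I u. \<exists>f\<in>F i. \<exists>c\<in>pull u p H.
      y = act p (act (\<phi> u (c \<otimes>\<^bsub>A u\<^esub> f)) (n i))"
proof -
  interpret Au: group "A u" using u by (intro A_group)
  let ?B = "pull u p H" and ?x = "act p (b u)"
  have subH: "subgroup H G" using H by (rule fg_subgroup_imp_subgroup)
  have Hc: "H \<subseteq> carrier G" using subH by (rule subgroup.subset)
  have B: "subgroup ?B (A u)"
    using fg_pull[OF u Hc fg_stab[OF H X x]] by (rule Au.fg_subgroup_imp_subgroup)
  obtain D T where xD: "?x \<in> D" and "subtree_transversal G V adj act H X D T"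
    using exists_transversal[OF subH X x] by blast
  then interpret subtree_transversal G V adj act H X D T by simp
  define M where "M = (\<lambda>(d, l, d'). act l d') ` {t \<in> T. fst t = ?x}"
  have finM: "finite M" using T by (simp add: M_def)
  have "\<exists>i f. i \<in> I u \<and> f \<in> carrier (A u) \<and> m = act p (act (\<phi> u f) (n i))" if "m \<in> M" for m
  proof -
    have xm: "(?x, m) \<in> adj" using that T_adj by (auto simp: M_def)
    then have V: "m \<in> V" using adj_V by blast
    have "(act (inv p) ?x, act (inv p) m) \<in> adj" using xm u by (intro act_adj) auto
    then have "(b u, act (inv p) m) \<in> adj" using u b_V by simp
    then obtain i f where "i \<in> I u" "f \<in> carrier (A u)" "act (inv p) m = act (\<phi> u f) (n i)"
      using n_cover[OF u(1)] by blast
    moreover have "m = act p (act (inv p) m)" using u V by simp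
    ultimately show ?thesis by auto
  qed
  then obtain ii ff where ff: "\<And>m. m \<in> M \<Longrightarrow> ii m \<in> I u \<and> ff m \<in> carrier (A u) \<and>
      m = act p (act (\<phi> u (ff m)) (n (ii m)))"
    by metis
  define F0 where "F0 i = ff ` {m \<in> M. ii m = i}" for i
  have "\<exists>F. F \<subseteq> F0 i \<and> inj_on (\<lambda>f. dcoset (A u) ?B f (Ed i)) F \<and>
      (\<lambda>f. dcoset (A u) ?B f (Ed i)) ` F0 i = (\<lambda>f. dcoset (A u) ?B f (Ed i)) ` F" for i
    using subset_image_inj[of "(\<lambda>f. dcoset (A u) ?B f (Ed i)) ` F0 i" "\<lambda>f. dcoset (A u) ?B f (Ed i)" "F0 i"]
    by simp
  then obtain F where F: "\<And>i. F i \<subseteq> F0 i" "\<And>i. inj_on (\<lambda>f. dcoset (A u) ?B f (Ed i)) (F i)"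
    "\<And>i. (\<lambda>f. dcoset (A u) ?B f (Ed i)) ` F0 i = (\<lambda>f. dcoset (A u) ?B f (Ed i)) ` F i" by metis
  have F0: "finite (F0 i)" "F0 i \<subseteq> carrier (A u)" for i using finM ff by (auto simp: F0_def)
  show ?thesis
  proof (rule that)
    show "finite (F i) \<and> F i \<subseteq> carrier (A u) \<and> inj_on (\<lambda>f. dcoset (A u) ?B f (Ed i)) (F i)" for i
      using F(1,2)[of i] F0[of i] finite_subset by blast
    fix y assume "(?x, y) \<in> edges_in X"
    from T_cover[OF xD this] obtain a l d' where a: "a \<in> stab H ?x" "(?x, l, d') \<in> T" "y = act (a \<otimes> l) d'"
      by blast
    then have m: "act l d' \<in> M" by (force simp: M_def)
    define i where "i = ii (act l d')"
    define f where "f = ff (act l d')"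
    have i: "i \<in> I u" and f: "f \<in> carrier (A u)" and eq: "act l d' = act p (act (\<phi> u f) (n i))"
      using ff[OF m] by (auto simp: i_def f_def)
    have "dcoset (A u) ?B f (Ed i) \<in> (\<lambda>f. dcoset (A u) ?B f (Ed i)) ` F i"
      using m F(3)[of i] by (auto simp: F0_def i_def f_def)
    then obtain f' where f': "f' \<in> F i" "dcoset (A u) ?B f (Ed i) = dcoset (A u) ?B f' (Ed i)" by blast
    have f'c: "f' \<in> carrier (A u)" using f' F(1) F0(2) by blast
    have "f \<in> dcoset (A u) ?B f' (Ed i)"
      using Au.dcoset_self[OF B Ed_subgroup[OF u(1) i] f] f'(2) by simp
    then obtain c \<alpha> where c: "c \<in> ?B" "\<alpha> \<in> Ed i" "f = c \<otimes>\<^bsub>A u\<^esub> f' \<otimes>\<^bsub>A u\<^esub> \<alpha>"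
      by (auto simp: Au.mem_dcoset_iff)
    obtain c' where c': "c' \<in> ?B" "a = chart u p c'"
      using a(1) stab_eq_chart_pull[OF u Hc] by auto
    have car: "c \<in> carrier (A u)" "c' \<in> carrier (A u)" "\<alpha> \<in> carrier (A u)" "act (\<phi> u \<alpha>) (n i) = n i"
      using c c' pull_subset Ed_eq[OF u(1) i] by auto
    have "a \<in> carrier G" "l \<in> carrier G" "d' \<in> V"
      using a(1) T_D[OF a(2)] Hc D_V by (auto simp: stab_def)
    then have "y = act (chart u p c') (act l d')" unfolding a(3) c'(2)[symmetric] by (simp add: act_mult)
    also have "\<dots> = act p (act (\<phi> u c') (act (\<phi> u f) (n i)))"
      unfolding eq using u car f n_V[OF u(1) i] by (simp add: chart_act)
    also have "\<dots> = act p (act (\<phi> u (c' \<otimes>\<^bsub>A u\<^esub> c \<otimes>\<^bsub>A u\<^esub> f')) (n i))"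
      using u car f f'c n_V[OF u(1) i] by (simp add: c(3) \<phi>_mult act_mult)
    finally have "y = act p (act (\<phi> u (c' \<otimes>\<^bsub>A u\<^esub> c \<otimes>\<^bsub>A u\<^esub> f')) (n i))" .
    moreover have "c' \<otimes>\<^bsub>A u\<^esub> c \<in> ?B" using B c(1) c'(1) by (intro subgroup.m_closed)
    ultimately show "\<exists>i\<in>I u. \<exists>f\<in>F i. \<exists>c\<in>?B. y = act p (act (\<phi> u (c \<otimes>\<^bsub>A u\<^esub> f)) (n i))"
      using i f'(1) by blast
  qed
qed

subsection \<open>Branching and the f.c.i.p.\<close>

text \<open>
  Let \<open>y\<close> be a neighbour of \<open>q (b u)\<close> in \<open>Y\<close> such that \<open>g\<close> maps this edge to an edge at \<open>p (b u)\<close> in \<open>X\<close>.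
  In terms of the representatives \<open>f\<close> and \<open>f'\<close> of the two edges and \<open>g = p a q\<^sup>-\<^sup>1\<close>, this means
  \<open>a = s (f \<alpha> f'\<^sup>-\<^sup>1) t\<^sup>-\<^sup>1\<close> with \<open>\<alpha> \<in> Ed i\<close>; here \<open>s\<close> and \<open>t\<close> are the elements of the two stabilisers that
  move the representatives to the given edges. The double coset \<open>D\<close> of \<open>\<alpha>\<close> is the element which the
  f.c.i.p. counts, and \<open>q_map\<close> sends it to the double coset of \<open>a\<close>.
\<close>

definition coded :: "'u \<Rightarrow> 'a \<Rightarrow> 'a \<Rightarrow> 'a set \<Rightarrow> 'a set \<Rightarrow> 'a \<Rightarrow> 'v \<Rightarrow> ('i \<times> 'c \<times> 'c) \<times> 'c set \<Rightarrow> bool" where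
  "coded u p q H K g y = (\<lambda>((i, f, f'), D). \<exists>\<alpha>\<in>Ed i. \<exists>s\<in>pull u p H. \<exists>t\<in>pull u q K.
     D = dcoset (A u) (Ed i \<inter> conj_set (A u) (pull u p H) f) \<alpha> (Ed i \<inter> conj_set (A u) (pull u q K) f') \<and>
     g = p \<otimes> \<phi> u (s \<otimes>\<^bsub>A u\<^esub> (f \<otimes>\<^bsub>A u\<^esub> \<alpha> \<otimes>\<^bsub>A u\<^esub> inv\<^bsub>A u\<^esub> f') \<otimes>\<^bsub>A u\<^esub> inv\<^bsub>A u\<^esub> t) \<otimes> inv q \<and>
     y = act q (act (\<phi> u (t \<otimes>\<^bsub>A u\<^esub> f')) (n i)))"

lemma pull_subgroup:
  assumes "u \<in> U" "p \<in> carrier G" "subgroup H G"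
  shows "subgroup (pull u p H) (A u)"
proof -
  interpret c: group_hom "A u" G "chart u p" using assms by (intro chart_hom)
  interpret H: subgroup H G by fact
  show ?thesis
    by (rule c.G.subgroupI) (auto simp: pull_def intro!: exI[of _ "\<one>\<^bsub>A u\<^esub>"])
qed

text \<open>
  A code leaves the choice of \<open>\<alpha>\<close> in \<open>D\<close> and of \<open>s\<close> and \<open>t\<close>. Changing \<open>\<alpha>\<close> within its double coset amounts
  to changing \<open>s\<close> and \<open>t\<close>, and these come from \<open>H\<close> and \<open>K\<close>.
\<close>

lemma coded_unique:
  assumes u: "u \<in> U" and pq: "p \<in> carrier G" "q \<in> carrier G"
    and H: "subgroup H G" and K: "subgroup K G"
    and i: "i \<in> I u" and f: "f \<in> carrier (A u)" "f' \<in> carrier (A u)"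
    and 1: "coded u p q H K g1 y1 ((i, f, f'), D)" and 2: "coded u p q H K g2 y2 ((i, f, f'), D)"
  shows "\<exists>h\<in>H. \<exists>k\<in>K. g2 = h \<otimes> g1 \<otimes> inv k \<and> act k (act q (b u)) = act q (b u) \<and> act k y1 = y2"
proof -
  interpret Au: group "A u" using u by (rule A_group)
  let ?B = "pull u p H" and ?C = "pull u q K"
  let ?m = "monoid.mult (A u)" and ?i = "m_inv (A u)"
  have B: "subgroup ?B (A u)" and C: "subgroup ?C (A u)" using u pq H K by (auto intro: pull_subgroup)
  interpret B: subgroup ?B "A u" by (rule B)
  interpret C: subgroup ?C "A u" by (rule C)
  interpret E: subgroup "Ed i" "A u" using u i by (rule Ed_subgroup)
  obtain \<alpha> s t where s: "\<alpha> \<in> Ed i" "s \<in> ?B" "t \<in> ?C"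
    and D: "D = dcoset (A u) (Ed i \<inter> conj_set (A u) ?B f) \<alpha> (Ed i \<inter> conj_set (A u) ?C f')"
    and g1: "g1 = p \<otimes> \<phi> u (?m (?m s (?m (?m f \<alpha>) (?i f'))) (?i t)) \<otimes> inv q"
    and y1: "y1 = act q (act (\<phi> u (?m t f')) (n i))"
    using 1 unfolding coded_def prod.case by blast
  obtain \<alpha>' s' t' where s': "\<alpha>' \<in> Ed i" "s' \<in> ?B" "t' \<in> ?C"
    and D': "D = dcoset (A u) (Ed i \<inter> conj_set (A u) ?B f) \<alpha>' (Ed i \<inter> conj_set (A u) ?C f')"
    and g2: "g2 = p \<otimes> \<phi> u (?m (?m s' (?m (?m f \<alpha>') (?i f'))) (?i t')) \<otimes> inv q"
    and y2: "y2 = act q (act (\<phi> u (?m t' f')) (n i))"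
    using 2 unfolding coded_def prod.case by blast
  have sub: "subgroup (Ed i \<inter> conj_set (A u) ?B f) (A u)" "subgroup (Ed i \<inter> conj_set (A u) ?C f') (A u)"
    using Au.subgroups_Inter_pair[OF E.subgroup_axioms] Au.conj_set_subgroup B C f by auto
  have "\<alpha>' \<in> D" unfolding D' using s'(1) sub by (intro Au.dcoset_self) auto
  then obtain \<beta> \<gamma> where \<beta>: "\<beta> \<in> Ed i" "\<beta> \<in> conj_set (A u) ?B f" and \<gamma>: "\<gamma> \<in> Ed i" "\<gamma> \<in> conj_set (A u) ?C f'"
    and \<alpha>': "\<alpha>' = ?m (?m \<beta> \<alpha>) \<gamma>"
    unfolding D Au.mem_dcoset_iff by blast
  define b0 where "b0 = ?m (?m f \<beta>) (?i f)"
  define c0 where "c0 = ?m (?m f' \<gamma>) (?i f')"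
  have b0: "b0 \<in> ?B" using \<beta>(2) f by (simp add: b0_def Au.mem_conj_set_iff B.subset)
  have c0: "c0 \<in> ?C" using \<gamma>(2) f by (simp add: c0_def Au.mem_conj_set_iff C.subset)
  have car: "\<alpha> \<in> carrier (A u)" "\<beta> \<in> carrier (A u)" "\<gamma> \<in> carrier (A u)" "s \<in> carrier (A u)" "s' \<in> carrier (A u)"
    "t \<in> carrier (A u)" "t' \<in> carrier (A u)" "b0 \<in> carrier (A u)" "c0 \<in> carrier (A u)"
    using s s' \<beta> \<gamma> b0 c0 by auto
  define h' where "h' = ?m (?m s' b0) (?i s)"
  define k' where "k' = ?m (?m t' (?i c0)) (?i t)"
  have h': "h' \<in> ?B" using s s' b0 by (simp add: h'_def)
  have k': "k' \<in> ?C" using s s' c0 by (simp add: k'_def)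
  have car': "h' \<in> carrier (A u)" "k' \<in> carrier (A u)" using h' k' by auto
  have arg: "?m (?m s' (?m (?m f \<alpha>') (?i f'))) (?i t') =
      ?m (?m h' (?m (?m s (?m (?m f \<alpha>) (?i f'))) (?i t))) (?i k')"
    using car f by (simp add: \<alpha>' h'_def k'_def b0_def c0_def Au.m_assoc Au.inv_mult_group)
  have "g2 = chart u p h' \<otimes> g1 \<otimes> inv (chart u q k')"
  proof -
    let ?w = "?m (?m s (?m (?m f \<alpha>) (?i f'))) (?i t)"
    have w: "?w \<in> carrier (A u)" using car f by simp
    then have "\<phi> u (?m (?m h' ?w) (?i k')) = \<phi> u h' \<otimes> \<phi> u ?w \<otimes> inv (\<phi> u k')"
      using u car' by (simp add: \<phi>_mult[OF u] \<phi>_inv[OF u])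
    then show ?thesis
      unfolding g2 arg g1 chart_def using u pq car' w by (simp add: m_assoc inv_mult_group)
  qed
  moreover have "act (chart u q k') y1 = y2"
  proof -
    have "?m k' (?m t f') = ?m (?m t' f') (?i \<gamma>)"
      using car f by (simp add: k'_def c0_def Au.m_assoc Au.inv_mult_group)
    moreover have "act (\<phi> u (?m (?m t' f') (?i \<gamma>))) (n i) = act (\<phi> u (?m t' f')) (act (\<phi> u (?i \<gamma>)) (n i))"
      using u car f n_V[OF u i] \<phi>_mult[OF u, of "?m t' f'" "?i \<gamma>"] by (simp add: act_mult)
    moreover have "act (\<phi> u (?i \<gamma>)) (n i) = n i"
      using Ed_eq[OF u i] E.m_inv_closed[OF \<gamma>(1)] by blast
    ultimately have e1: "act (\<phi> u (?m k' (?m t f'))) (n i) = act (\<phi> u (?m t' f')) (n i)" by simp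
    have "act (chart u q k') y1 = act q (act (\<phi> u k') (act (\<phi> u (?m t f')) (n i)))"
      unfolding y1 using u pq car car' f n_V[OF u i] by (intro chart_act) auto
    also have "act (\<phi> u k') (act (\<phi> u (?m t f')) (n i)) = act (\<phi> u (?m k' (?m t f'))) (n i)"
      using u car car' f n_V[OF u i] \<phi>_mult[OF u, of k' "?m t f'"] by (simp add: act_mult)
    finally show ?thesis unfolding e1 y2 .
  qed
  moreover have "chart u p h' \<in> H" "chart u q k' \<in> K" using h' k' by (simp_all only: pull_def mem_Collect_eq)
  moreover have "act (chart u q k') (act q (b u)) = act q (b u)" using u pq car' by (simp add: chart_fix)
  ultimately show ?thesis by blast
qed

lemma q_map_coded:
  assumes u: "u \<in> U" and pq: "p \<in> carrier G" "q \<in> carrier G"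
    and H: "subgroup H G" and K: "subgroup K G"
    and i: "i \<in> I u" and f: "f \<in> carrier (A u)" "f' \<in> carrier (A u)"
    and c: "coded u p q H K g y ((i, f, f'), D)"
    and a: "a \<in> carrier (A u)" "g = p \<otimes> \<phi> u a \<otimes> inv q"
  shows "q_map (A u) (pull u p H) (pull u q K) f f' D = dcoset (A u) (pull u p H) a (pull u q K)"
    and "D \<in> q_dom (A u) (Ed i) (pull u p H) (pull u q K) f f'"
proof -
  interpret Au: group "A u" using u by (rule A_group)
  let ?B = "pull u p H" and ?C = "pull u q K"
  let ?m = "monoid.mult (A u)" and ?i = "m_inv (A u)"
  have B: "subgroup ?B (A u)" and C: "subgroup ?C (A u)" using u pq H K by (auto intro: pull_subgroup)
  interpret B: subgroup ?B "A u" by (rule B)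
  interpret C: subgroup ?C "A u" by (rule C)
  interpret E: subgroup "Ed i" "A u" using u i by (rule Ed_subgroup)
  obtain \<alpha> s t where s: "\<alpha> \<in> Ed i" "s \<in> ?B" "t \<in> ?C"
    and D: "D = dcoset (A u) (Ed i \<inter> conj_set (A u) ?B f) \<alpha> (Ed i \<inter> conj_set (A u) ?C f')"
    and g: "g = p \<otimes> \<phi> u (?m (?m s (?m (?m f \<alpha>) (?i f'))) (?i t)) \<otimes> inv q"
    using c unfolding coded_def prod.case by blast
  show "D \<in> q_dom (A u) (Ed i) ?B ?C f f'"
    unfolding q_dom_def dcosets_def D using s(1) by blast
  let ?z = "?m (?m f \<alpha>) (?i f')"
  have car: "\<alpha> \<in> carrier (A u)" "s \<in> carrier (A u)" "t \<in> carrier (A u)" "?z \<in> carrier (A u)"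
    using s f by auto
  have "\<phi> u a = \<phi> u (?m (?m s ?z) (?i t))" using g a(2) u pq a(1) car by simp
  then have a_eq: "a = ?m (?m s ?z) (?i t)"
    using \<phi>_inj[OF u] a(1) car by (simp add: inj_on_eq_iff)
  have "dcoset (A u) ?B a ?C = dcoset (A u) ?B ?z ?C"
    using s car unfolding a_eq by (intro Au.dcoset_eqI[OF B C]) (auto simp: Au.mem_dcoset_iff)
  then show "q_map (A u) ?B ?C f f' D = dcoset (A u) ?B a ?C"
    unfolding D using q_map_dcoset[OF Au.is_group E.subgroup_axioms B C f s(1)] by simp
qed

text \<open>
  The group \<open>H \<times> K\<close> acts on pairs by \<open>(h, k) \<cdot> (g, y) = (h g k\<^sup>-\<^sup>1, k y)\<close>. The orbits of pairs with
  \<open>y \<in> Y\<close> and \<open>g y \<in> X\<close> are the vertices of the union, over the double cosets \<open>H g K\<close>, of the quotients of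
  \<open>g\<^sup>-\<^sup>1X \<inter> Y\<close> by \<open>g\<^sup>-\<^sup>1Hg \<inter> K\<close>. An edge is branching if its initial vertex has degree at least 2 in
  this quotient.
\<close>

definition branching_edge :: "'a set \<Rightarrow> 'v set \<Rightarrow> 'a set \<Rightarrow> 'v set \<Rightarrow> 'a \<Rightarrow> 'v \<Rightarrow> 'v \<Rightarrow> bool" where
  "branching_edge H X K Y g y y1 \<longleftrightarrow> g \<in> carrier G \<and> (y, y1) \<in> edges_in Y \<and> act g y \<in> X \<and> act g y1 \<in> X \<and>
     (\<exists>y2. (y, y2) \<in> edges_in Y \<and> act g y2 \<in> X \<and>
       (\<forall>k\<in>K. g \<otimes> k \<otimes> inv g \<in> H \<longrightarrow> act k y = y \<longrightarrow> act k y1 \<noteq> y2))"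

text \<open>
  Two inequivalent edges at the same \<open>(g, y)\<close> are coded by different elements with the same image
  under \<open>q_map\<close>, since that image depends only on \<open>g\<close>. The f.c.i.p. leaves finitely many such codes,
  and a code determines its edge up to the action of \<open>H \<times> K\<close>.
\<close>

lemma finite_branching_at_vertex_pair:
  assumes H: "fg_subgroup G H" and X: "cofinite_subtree H X"
    and K: "fg_subgroup G K" and Y: "cofinite_subtree K Y"
    and u: "u \<in> U" and pq: "p \<in> carrier G" "q \<in> carrier G"
    and x: "act p (b u) \<in> X" and y: "act q (b u) \<in> Y"
  shows "\<exists>Fin. finite Fin \<and> Fin \<subseteq> carrier G \<times> V \<times> V \<and>
    (\<forall>g y1. act g (act q (b u)) = act p (b u) \<longrightarrow> branching_edge H X K Y g (act q (b u)) y1 \<longrightarrow>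
      (\<exists>(g', z, z')\<in>Fin. \<exists>h\<in>H. \<exists>k\<in>K. g = h \<otimes> g' \<otimes> inv k \<and> act q (b u) = act k z \<and> y1 = act k z'))"
proof -
  interpret Au: group "A u" using u by (rule A_group)
  let ?B = "pull u p H" and ?C = "pull u q K" and ?y = "act q (b u)" and ?x = "act p (b u)"
  let ?m = "monoid.mult (A u)" and ?i = "m_inv (A u)"
  have subH: "subgroup H G" and subK: "subgroup K G" using H K by (auto intro: fg_subgroup_imp_subgroup)
  interpret H: subgroup H G by (rule subH)
  interpret K: subgroup K G by (rule subK)
  have fgB: "fg_subgroup (A u) ?B" using fg_pull[OF u pq(1) H.subset fg_stab[OF H X x]] .
  have fgC: "fg_subgroup (A u) ?C" using fg_pull[OF u pq(2) K.subset fg_stab[OF K Y y]] .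
  have B: "subgroup ?B (A u)" and C: "subgroup ?C (A u)" using u pq subH subK by (auto intro: pull_subgroup)
  interpret B: subgroup ?B "A u" by (rule B)
  interpret C: subgroup ?C "A u" by (rule C)
  have XV: "X \<subseteq> V" and YV: "Y \<subseteq> V" using X Y by (auto simp: cofinite_subtree_def subtree_def)
  obtain F where F: "\<And>i. i \<in> I u \<Longrightarrow> finite (F i) \<and> F i \<subseteq> carrier (A u) \<and> inj_on (\<lambda>f. dcoset (A u) ?B f (Ed i)) (F i)"
    and Fc: "\<And>y. (?x, y) \<in> edges_in X \<Longrightarrow> \<exists>i\<in>I u. \<exists>f\<in>F i. \<exists>c\<in>?B. y = act p (act (\<phi> u (?m c f)) (n i))"
    using edge_orbit_representatives[OF H X u pq(1) x] by blast
  obtain F' where F': "\<And>i. i \<in> I u \<Longrightarrow> finite (F' i) \<and> F' i \<subseteq> carrier (A u) \<and> inj_on (\<lambda>f. dcoset (A u) ?C f (Ed i)) (F' i)"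
    and F'c: "\<And>y'. (?y, y') \<in> edges_in Y \<Longrightarrow> \<exists>i\<in>I u. \<exists>f\<in>F' i. \<exists>c\<in>?C. y' = act q (act (\<phi> u (?m c f)) (n i))"
    using edge_orbit_representatives[OF K Y u pq(2) y] by blast
  define Q where "Q = {((i, f, g), D). i \<in> I u \<and> f \<in> F i \<and> g \<in> F' i \<and> D \<in> q_dom (A u) (Ed i) ?B ?C f g}"
  define \<kappa> where "\<kappa> = (\<lambda>((i :: 'i, f, g), D). q_map (A u) ?B ?C f g D)"
  define Bad where "Bad = {c \<in> Q. \<exists>c'\<in>Q. c' \<noteq> c \<and> \<kappa> c' = \<kappa> c}"
  have Bad: "finite Bad"
    unfolding Bad_def Q_def \<kappa>_def using u
    by (intro fcip_rel_finite_collisions[OF Au.is_group fcip[OF u] I_finite[OF u] Ed_subgroup[OF u] fgB fgC F F'])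
  have code: "\<exists>c\<in>Q. coded u p q H K g y1 c \<and> \<kappa> c = dcoset (A u) ?B a ?C"
    if g: "g \<in> carrier G" "a \<in> carrier (A u)" "g = p \<otimes> \<phi> u a \<otimes> inv q"
      and y1: "(?y, y1) \<in> edges_in Y" "act g y1 \<in> X" for g y1 a
  proof -
    have gy: "act g ?y = ?x" unfolding g(3) using u pq g(2) b_V by (simp add: act_mult \<phi>_fix)
    obtain i f' t where i: "i \<in> I u" "f' \<in> F' i" "t \<in> ?C" and y1_eq: "y1 = act q (act (\<phi> u (?m t f')) (n i))"
      using F'c[OF y1(1)] by blast
    have "(act g ?y, act g y1) \<in> adj" using y1 g by (intro act_adj) (auto simp: edges_in_def)
    then have "(?x, act g y1) \<in> edges_in X" using y1 x gy by (simp add: edges_in_def)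
    then obtain j f s where j: "j \<in> I u" "f \<in> F j" "s \<in> ?B" and gy1: "act g y1 = act p (act (\<phi> u (?m s f)) (n j))"
      using Fc by blast
    have car: "f \<in> carrier (A u)" "f' \<in> carrier (A u)" "s \<in> carrier (A u)" "t \<in> carrier (A u)"
      using i j F F' by auto
    have nV: "n i \<in> V" "n j \<in> V" using n_V[OF u] i j by auto
    have "act p (act (\<phi> u (?m a (?m t f'))) (n i)) = act p (act (\<phi> u (?m s f)) (n j))"
      unfolding gy1[symmetric] unfolding y1_eq g(3) using u pq g(2) car nV by (simp add: \<phi>_mult act_mult)
    then have eq: "act (\<phi> u (?m a (?m t f'))) (n i) = act (\<phi> u (?m s f)) (n j)"
      using u pq g(2) car nV by (simp add: act_inj)
    define \<alpha> where "\<alpha> = ?m (?i (?m s f)) (?m a (?m t f'))"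
    have \<alpha>c: "\<alpha> \<in> carrier (A u)" using car g(2) by (simp add: \<alpha>_def)
    have "act (\<phi> u \<alpha>) (n i) = act (inv (\<phi> u (?m s f))) (act (\<phi> u (?m s f)) (n j))"
      unfolding \<alpha>_def eq[symmetric] using u car g(2) nV by (simp add: \<phi>_mult[of u "?i (?m s f)"] \<phi>_inv act_mult)
    then have \<alpha>n: "act (\<phi> u \<alpha>) (n i) = n j" using u car nV by simp
    have ij: "i = j" using n_unique[OF u i(1) j(1) \<alpha>c \<alpha>n] .
    have \<alpha>E: "\<alpha> \<in> Ed i" using Ed_eq[OF u i(1)] \<alpha>c \<alpha>n ij by simp
    have "?m (?m s (?m (?m f \<alpha>) (?i f'))) (?i t) = a"
      using car g(2) by (simp add: \<alpha>_def Au.m_assoc Au.inv_mult_group)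
    then have "coded u p q H K g y1 ((i, f, f'), dcoset (A u) (Ed i \<inter> conj_set (A u) ?B f) \<alpha> (Ed i \<inter> conj_set (A u) ?C f'))"
      (is "coded _ _ _ _ _ _ _ (_, ?D)")
      unfolding coded_def prod.case using \<alpha>E j(3) i(3) y1_eq g(3) by (intro bexI[of _ \<alpha>] bexI[of _ s] bexI[of _ t]) auto
    moreover from q_map_coded[OF u pq subH subK i(1) car(1,2) this g(2,3)]
    have "((i, f, f'), ?D) \<in> Q" "\<kappa> ((i, f, f'), ?D) = dcoset (A u) ?B a ?C"
      using i j ij by (auto simp: Q_def \<kappa>_def)
    ultimately show ?thesis by blast
  qed
  define wit where "wit c = (SOME gy. fst gy \<in> carrier G \<and> snd gy \<in> V \<and> coded u p q H K (fst gy) (snd gy) c)" for c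
  define Fin where "Fin = (\<lambda>c. (fst (wit c), ?y, snd (wit c))) ` {c \<in> Bad. \<exists>g\<in>carrier G. \<exists>y\<in>V. coded u p q H K g y c}"
  have wit: "fst (wit c) \<in> carrier G" "snd (wit c) \<in> V" "coded u p q H K (fst (wit c)) (snd (wit c)) c"
    if "g \<in> carrier G" "y \<in> V" "coded u p q H K g y c" for c g y
  proof -
    have "\<exists>gy. fst gy \<in> carrier G \<and> snd gy \<in> V \<and> coded u p q H K (fst gy) (snd gy) c"
      using that by (intro exI[of _ "(g, y)"]) simp
    from someI_ex[OF this] show "fst (wit c) \<in> carrier G" "snd (wit c) \<in> V" "coded u p q H K (fst (wit c)) (snd (wit c)) c"
      unfolding wit_def by blast+
  qed
  show ?thesis
  proof (intro exI[of _ Fin] conjI ballI allI impI)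
    show "finite Fin" using Bad by (simp add: Fin_def)
    show "Fin \<subseteq> carrier G \<times> V \<times> V" using wit(1,2) y YV by (auto simp: Fin_def)
    fix g y1
    assume gy: "act g ?y = ?x" and "branching_edge H X K Y g ?y y1"
    then obtain y2 where g: "g \<in> carrier G"
      and y1: "(?y, y1) \<in> edges_in Y" and y2: "(?y, y2) \<in> edges_in Y"
      and gy1: "act g y1 \<in> X" and gy2: "act g y2 \<in> X"
      and ne: "\<forall>k\<in>K. g \<otimes> k \<otimes> inv g \<in> H \<longrightarrow> act k ?y = ?y \<longrightarrow> act k y1 \<noteq> y2"
      unfolding branching_edge_def by blast
    have "act (inv p \<otimes> g \<otimes> q) (b u) = b u" using u pq g gy b_V by (simp add: act_mult)
    then obtain a where a: "a \<in> carrier (A u)" "inv p \<otimes> g \<otimes> q = \<phi> u a"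
      using \<phi>_surj[OF u, of "inv p \<otimes> g \<otimes> q"] pq g by auto
    have ga: "g = p \<otimes> \<phi> u a \<otimes> inv q" unfolding a(2)[symmetric] using pq g by (simp add: m_assoc)
    obtain c1 where c1: "c1 \<in> Q" "coded u p q H K g y1 c1" "\<kappa> c1 = dcoset (A u) ?B a ?C"
      using code[OF g a(1) ga y1 gy1] by blast
    obtain c2 where c2: "c2 \<in> Q" "coded u p q H K g y2 c2" "\<kappa> c2 = dcoset (A u) ?B a ?C"
      using code[OF g a(1) ga y2 gy2] by blast
    have same: "\<exists>h\<in>H. \<exists>k\<in>K. g2 = h \<otimes> g1 \<otimes> inv k \<and> act k ?y = ?y \<and> act k z1 = z2"
      if "c \<in> Q" "coded u p q H K g1 z1 c" "coded u p q H K g2 z2 c" for c g1 g2 z1 z2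
    proof -
      obtain i f f' D where c: "c = ((i, f, f'), D)" by (metis prod.collapse)
      then have "i \<in> I u" "f \<in> carrier (A u)" "f' \<in> carrier (A u)" using that(1) F F' by (auto simp: Q_def)
      from coded_unique[OF u pq subH subK this] that(2,3) c show ?thesis by blast
    qed
    have y1V: "y1 \<in> V" using y1 YV by (auto simp: edges_in_def)
    have "c1 \<noteq> c2"
    proof
      assume "c1 = c2"
      then obtain h k where hk: "h \<in> H" "k \<in> K" "g = h \<otimes> g \<otimes> inv k" "act k ?y = ?y" "act k y1 = y2"
        using same[OF c1(1,2)] c2(2) by blast
      have "g \<otimes> k \<otimes> inv g = h"
      proof -
        have "g \<otimes> k = h \<otimes> g" using hk(1,2) g arg_cong[OF hk(3), of "\<lambda>x. x \<otimes> k"] by (simp add: m_assoc)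
        then show ?thesis using hk(1) g by (simp add: m_assoc)
      qed
      then show False using ne hk by blast
    qed
    then have bad: "c1 \<in> Bad" using c1(1,3) c2(1,3) unfolding Bad_def by auto
    note w = wit[OF g y1V c1(2)]
    obtain h k where hk: "h \<in> H" "k \<in> K" "g = h \<otimes> fst (wit c1) \<otimes> inv k" "act k ?y = ?y" "act k (snd (wit c1)) = y1"
      using same[OF c1(1) w(3) c1(2)] by blast
    have "(fst (wit c1), ?y, snd (wit c1)) \<in> Fin" using bad g y1V c1(2) by (auto simp: Fin_def)
    moreover have "\<exists>h\<in>H. \<exists>k\<in>K. g = h \<otimes> fst (wit c1) \<otimes> inv k \<and> ?y = act k ?y \<and> y1 = act k (snd (wit c1))"
      using hk by metis
    ultimately show "\<exists>(g', z, z')\<in>Fin. \<exists>h\<in>H. \<exists>k\<in>K. g = h \<otimes> g' \<otimes> inv k \<and> ?y = act k z \<and> y1 = act k z'"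
      by blast
  qed
qed

lemma finite_branching:
  assumes H: "fg_subgroup G H" and X: "cofinite_subtree H X"
    and K: "fg_subgroup G K" and Y: "cofinite_subtree K Y"
  obtains Fin where "finite Fin" "Fin \<subseteq> carrier G \<times> V \<times> V"
    "\<And>g y y1. branching_edge H X K Y g y y1 \<Longrightarrow>
      \<exists>(g', z, z')\<in>Fin. \<exists>h\<in>H. \<exists>k\<in>K. g = h \<otimes> g' \<otimes> inv k \<and> y = act k z \<and> y1 = act k z'"
proof -
  interpret H: subgroup H G using H by (rule fg_subgroup_imp_subgroup)
  interpret K: subgroup K G using K by (rule fg_subgroup_imp_subgroup)
  have XV: "X \<subseteq> V" and YV: "Y \<subseteq> V" using X Y by (auto simp: cofinite_subtree_def subtree_def)
  have invX: "h \<in> H \<Longrightarrow> x \<in> X \<Longrightarrow> act h x \<in> X" for h x using X by (simp add: cofinite_subtree_def)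
  have invY: "h \<in> K \<Longrightarrow> x \<in> Y \<Longrightarrow> act h x \<in> Y" for h x using Y by (simp add: cofinite_subtree_def)
  obtain DX where DX: "finite DX" "DX \<subseteq> X" "\<And>x. x \<in> X \<Longrightarrow> \<exists>h\<in>H. \<exists>d\<in>DX. x = act h d"
    using cofinite_subtree_vertices[OF X] by blast
  obtain DY where DY: "finite DY" "DY \<subseteq> Y" "\<And>x. x \<in> Y \<Longrightarrow> \<exists>h\<in>K. \<exists>d\<in>DY. x = act h d"
    using cofinite_subtree_vertices[OF Y] by blast
  define P where "P x0 y0 F \<longleftrightarrow> finite F \<and> F \<subseteq> carrier G \<times> V \<times> V \<and>
    (\<forall>g y1. act g y0 = x0 \<longrightarrow> branching_edge H X K Y g y0 y1 \<longrightarrow>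
      (\<exists>(g', z, z')\<in>F. \<exists>h\<in>H. \<exists>k\<in>K. g = h \<otimes> g' \<otimes> inv k \<and> y0 = act k z \<and> y1 = act k z'))" for x0 y0 F
  have "\<exists>F. P x0 y0 F" if xy: "x0 \<in> DX" "y0 \<in> DY" for x0 y0
  proof (cases "\<exists>g\<in>carrier G. act g y0 = x0")
    case True
    then obtain g where g: "g \<in> carrier G" "act g y0 = x0" by blast
    obtain u q where u: "u \<in> U" "q \<in> carrier G" "y0 = act q (b u)" using b_cover xy DY YV by blast
    have p: "g \<otimes> q \<in> carrier G" "x0 = act (g \<otimes> q) (b u)" using u g b_V by (auto simp: act_mult)
    have "act (g \<otimes> q) (b u) \<in> X" "act q (b u) \<in> Y" using xy DX DY u(3) p(2) by auto
    from finite_branching_at_vertex_pair[OF H X K Y u(1) p(1) u(2) this]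
    show ?thesis unfolding P_def p(2)[symmetric] u(3)[symmetric] .
  next
    case False
    then show ?thesis by (intro exI[of _ "{}"]) (auto simp: P_def branching_edge_def)
  qed
  then obtain F where F: "\<And>x0 y0. x0 \<in> DX \<Longrightarrow> y0 \<in> DY \<Longrightarrow> P x0 y0 (F x0 y0)" by metis
  define Fin where "Fin = (\<Union>x0\<in>DX. \<Union>y0\<in>DY. F x0 y0)"
  show ?thesis
  proof (rule that)
    show "finite Fin" using DX(1) DY(1) F by (auto simp: Fin_def P_def)
    show "Fin \<subseteq> carrier G \<times> V \<times> V" using F unfolding Fin_def P_def by blast
    fix g y y1 assume "branching_edge H X K Y g y y1"
    then obtain y2 where g: "g \<in> carrier G" and y1: "(y, y1) \<in> edges_in Y" and y2: "(y, y2) \<in> edges_in Y"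
      and gX: "act g y \<in> X" "act g y1 \<in> X" "act g y2 \<in> X"
      and ne: "\<And>k. k \<in> K \<Longrightarrow> g \<otimes> k \<otimes> inv g \<in> H \<Longrightarrow> act k y = y \<Longrightarrow> act k y1 \<noteq> y2"
      unfolding branching_edge_def by blast
    have V: "y \<in> V" "y1 \<in> V" "y2 \<in> V" using y1 y2 YV by (auto simp: edges_in_def)
    have "y \<in> Y" using y1 by (auto simp: edges_in_def)
    then obtain k0 y0 where k0: "k0 \<in> K" "y0 \<in> DY" "y = act k0 y0" using DY(3) by blast
    obtain h0 x0 where h0: "h0 \<in> H" "x0 \<in> DX" "act g y = act h0 x0" using DX(3)[OF gX(1)] by blast
    have V0: "y0 \<in> V" "x0 \<in> V" using k0 h0 DX DY XV YV by auto
    have c: "k0 \<in> carrier G" "h0 \<in> carrier G" using k0 h0 by auto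
    let ?g = "inv h0 \<otimes> g \<otimes> k0" and ?y1 = "act (inv k0) y1" and ?y2 = "act (inv k0) y2"
    have y0: "y0 = act (inv k0) y" using k0(3) c V0 by simp
    have e: "(act (inv k0) y, act (inv k0) z) \<in> edges_in Y" if "(y, z) \<in> edges_in Y" for z
      using that k0 invY by (intro act_edges_in) auto
    have "P x0 y0 (F x0 y0)" by (rule F[OF h0(2) k0(2)])
    moreover have gy0: "act ?g y0 = x0"
      using c g V0 h0(3) k0(3) by (simp add: act_mult)
    moreover have "branching_edge H X K Y ?g y0 ?y1"
    proof -
      have "?g \<in> carrier G" using c g by simp
      moreover have "act ?g y0 \<in> X" using gy0 h0(2) DX(2) by auto
      moreover have "(y0, ?y1) \<in> edges_in Y" "(y0, ?y2) \<in> edges_in Y" using e[OF y1] e[OF y2] y0 by auto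
      moreover have "act ?g ?y1 = act (inv h0) (act g y1)" "act ?g ?y2 = act (inv h0) (act g y2)"
        using c g V by (simp_all add: act_mult)
      then have "act ?g ?y1 \<in> X" "act ?g ?y2 \<in> X" using invX h0(1) gX by auto
      moreover have "\<forall>k\<in>K. ?g \<otimes> k \<otimes> inv ?g \<in> H \<longrightarrow> act k y0 = y0 \<longrightarrow> act k ?y1 \<noteq> ?y2"
      proof (intro ballI impI notI)
        fix k assume k: "k \<in> K" and kH: "?g \<otimes> k \<otimes> inv ?g \<in> H" and ky: "act k y0 = y0" "act k ?y1 = ?y2"
        let ?k = "k0 \<otimes> k \<otimes> inv k0"
        have kc: "k \<in> carrier G" using k by simp
        have "g \<otimes> ?k \<otimes> inv g = h0 \<otimes> (?g \<otimes> k \<otimes> inv ?g) \<otimes> inv h0"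
          using c g kc by (simp add: m_assoc inv_mult_group)
        then have "g \<otimes> ?k \<otimes> inv g \<in> H" using kH h0 by simp
        moreover have "act ?k y = y" using c kc V V0 ky(1) k0(3) by (simp add: act_mult)
        moreover have "act ?k y1 = y2" using c kc V ky(2) by (simp add: act_mult)
        ultimately show False using ne[of ?k] k k0 by simp
      qed
      ultimately show ?thesis unfolding branching_edge_def by blast
    qed
    ultimately obtain g' z z' h k where w: "(g', z, z') \<in> F x0 y0" "h \<in> H" "k \<in> K"
      "?g = h \<otimes> g' \<otimes> inv k" "y0 = act k z" "?y1 = act k z'"
      unfolding P_def by blast
    have wF: "(g', z, z') \<in> Fin" using w(1) h0(2) k0(2) by (auto simp: Fin_def)
    have wV: "g' \<in> carrier G" "z \<in> V" "z' \<in> V" using w(1) F[OF h0(2) k0(2)] by (auto simp: P_def)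
    have "h \<in> carrier G" "k \<in> carrier G" using w by auto
    note cc = this c g wV
    have "g = h0 \<otimes> ?g \<otimes> inv k0" using cc by (simp add: m_assoc)
    also have "\<dots> = (h0 \<otimes> h) \<otimes> g' \<otimes> inv (k0 \<otimes> k)" unfolding w(4) using cc by (simp add: m_assoc inv_mult_group)
    finally have "g = (h0 \<otimes> h) \<otimes> g' \<otimes> inv (k0 \<otimes> k)" .
    moreover have "y = act (k0 \<otimes> k) z" using cc w(5) k0(3) by (simp add: act_mult)
    moreover have "y1 = act k0 ?y1" using cc V by simp
    then have "y1 = act (k0 \<otimes> k) z'" unfolding w(6) using cc by (simp add: act_mult)
    moreover have "h0 \<otimes> h \<in> H" "k0 \<otimes> k \<in> K" using w h0 k0 by auto
    ultimately show "\<exists>(g', z, z')\<in>Fin. \<exists>h\<in>H. \<exists>k\<in>K. g = h \<otimes> g' \<otimes> inv k \<and> y = act k z \<and> y1 = act k z'"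
      using wF by blast
  qed
qed

subsection \<open>The f.g.i.p.\<close>

theorem fgip_if_vertex_groups_fgip:
  assumes fgip: "\<And>u. u \<in> U \<Longrightarrow> fgip (A u)"
  shows "fgip G"
  unfolding fgip_def
proof (intro allI impI, elim conjE)
  fix H K assume H: "fg_subgroup G H" and K: "fg_subgroup G K"
  interpret H: subgroup H G using H by (rule fg_subgroup_imp_subgroup)
  interpret K: subgroup K G using K by (rule fg_subgroup_imp_subgroup)
  obtain v where v: "v \<in> V" using V_nonempty by blast
  obtain X where X: "v \<in> X" "cofinite_subtree H X" using exists_cofinite_subtree[OF H v] by blast
  obtain Y where Y: "v \<in> Y" "cofinite_subtree K Y" using exists_cofinite_subtree[OF K v] by blast
  have XV: "X \<subseteq> V" and YV: "Y \<subseteq> V" using X Y by (auto simp: cofinite_subtree_def subtree_def)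
  have L: "subgroup (H \<inter> K) G" using H.subgroup_axioms K.subgroup_axioms by (rule subgroups_Inter_pair)
  let ?Z = "X \<inter> Y"
  obtain Fin where Fin: "finite Fin" "Fin \<subseteq> carrier G \<times> V \<times> V"
    "\<And>g y y1. branching_edge H X K Y g y y1 \<Longrightarrow>
      \<exists>(g', z, z')\<in>Fin. \<exists>h\<in>H. \<exists>k\<in>K. g = h \<otimes> g' \<otimes> inv k \<and> y = act k z \<and> y1 = act k z'"
    by (rule finite_branching[OF H X(2) K Y(2)]) (rule that)
  \<comment> \<open>Edges over \<open>g = 1\<close> in the orbit of \<open>(g', z, z')\<close> are moved to one edge; their orbits under \<open>H \<inter> K\<close> then agree.\<close>
  define kk where "kk g' = (SOME k. k \<in> K \<and> k \<otimes> inv g' \<in> H)" for g'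
  let ?E = "(\<lambda>(g', z, z'). (act (kk g') z, act (kk g') z')) `
      {t \<in> Fin. \<exists>k. k \<in> K \<and> k \<otimes> inv (fst t) \<in> H}"
  have kk: "kk g' \<in> K" "kk g' \<otimes> inv g' \<in> H" if "k \<in> K" "k \<otimes> inv g' \<in> H" for k g'
    unfolding kk_def using someI[of "\<lambda>k. k \<in> K \<and> k \<otimes> inv g' \<in> H" k] that by auto
  have "cofinite_subtree (H \<inter> K) ?Z"
  proof (rule cofinite_subtree_if_cofinite_branching[OF L])
    show "subtree ?Z" using X Y by (intro subtree_Int) (auto simp: cofinite_subtree_def)
    show "?Z \<noteq> {}" using X Y by blast
    show "act l x \<in> ?Z" if "l \<in> H \<inter> K" "x \<in> ?Z" for l x
      using that X(2) Y(2) by (simp add: cofinite_subtree_def)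
    show "finite ?E" using Fin(1) by simp
    show "?E \<subseteq> V \<times> V"
    proof
      fix e assume "e \<in> ?E"
      then obtain g' z z' k where "(g', z, z') \<in> Fin" "k \<in> K" "k \<otimes> inv g' \<in> H" "e = (act (kk g') z, act (kk g') z')"
        by auto
      moreover have "kk g' \<in> carrier G" using kk(1) calculation by simp
      ultimately show "e \<in> V \<times> V" using Fin(2) by auto
    qed
    fix x y y'
    assume y: "(x, y) \<in> edges_in ?Z" and y': "(x, y') \<in> edges_in ?Z"
      and ne: "\<And>l. l \<in> stab (H \<inter> K) x \<Longrightarrow> act l y \<noteq> y'"
    have V: "x \<in> V" "y \<in> V" "y' \<in> V" using y y' XV by (auto simp: edges_in_def)
    have "act k y \<noteq> y'" if "k \<in> K" "\<one> \<otimes> k \<otimes> inv \<one> \<in> H" "act k x = x" for k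
      using that ne[of k] by (simp add: stab_def)
    moreover have "(x, y) \<in> edges_in Y" "(x, y') \<in> edges_in Y" "act \<one> x \<in> X" "act \<one> y \<in> X" "act \<one> y' \<in> X"
      using y y' V by (auto simp: edges_in_def act_one)
    ultimately have "branching_edge H X K Y \<one> x y" unfolding branching_edge_def by blast
    then obtain g' z z' h k where w: "(g', z, z') \<in> Fin" "h \<in> H" "k \<in> K" "\<one> = h \<otimes> g' \<otimes> inv k"
      "x = act k z" "y = act k z'"
      using Fin(3)[of \<one> x y] by blast
    have c: "g' \<in> carrier G" "z \<in> V" "z' \<in> V" "h \<in> carrier G" "k \<in> carrier G" using Fin(2) w by auto
    have "h \<otimes> g' = k" using w(4) c by (metis inv_equality inv_inv inv_closed m_closed)
    then have "k \<otimes> inv g' = h" using c by (simp add: m_assoc[symmetric] inv_solve_right')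
    then have kH: "k \<otimes> inv g' \<in> H" using w by simp
    note kk' = kk[OF w(3) kH]
    have kkc: "kk g' \<in> carrier G" using kk' by simp
    let ?l = "k \<otimes> inv (kk g')"
    have "?l = (k \<otimes> inv g') \<otimes> inv (kk g' \<otimes> inv g')" using c kkc by (simp add: m_assoc inv_mult_group)
    then have "?l \<in> H" using kk'(2) kH by simp
    moreover have "?l \<in> K" using kk'(1) w(3) by simp
    moreover have "x = act ?l (act (kk g') z)" "y = act ?l (act (kk g') z')"
      using w c kkc by (simp_all add: act_mult)
    moreover have "(act (kk g') z, act (kk g') z') \<in> ?E" using w(1,3) kH by force
    ultimately show "\<exists>l\<in>H \<inter> K. \<exists>(p, q)\<in>?E. x = act l p \<and> y = act l q" by blast
  qed
  then show "fg_subgroup G (H \<inter> K)"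
  proof (rule fg_of_fg_stabs[OF L])
    show "?Z \<noteq> {}" using X Y by blast
    fix x assume x: "x \<in> ?Z"
    then show "fg_subgroup G (stab (H \<inter> K) x)"
      using fg_stab[OF H X(2)] fg_stab[OF K Y(2)] XV by (intro fg_stab_Int fgip) auto
  qed
qed

subsection \<open>The strong f.g.i.p.\<close>

definition collar :: "'a set \<Rightarrow> 'v set \<Rightarrow> 'v set" where
  "collar H X = X \<union> {y. \<exists>x\<in>X. (x, y) \<in> adj \<and> stab H x \<inter> stab H y \<noteq> {\<one>}}"

text \<open>
  Let \<open>B\<close> be the stabiliser of \<open>x\<close> in \<open>H\<close>, seen in \<open>A u\<close>. The edge \<open>a (n i)\<close> has non-trivial stabiliser
  in \<open>B\<close> iff \<open>B\<^sup>a \<inter> Ed i \<noteq> 1\<close>, so the s.f.g.i.p. of \<open>A u\<close> applies to \<open>B\<close> and \<open>Ed i\<close>.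
\<close>

lemma finite_nontrivial_edge_orbits:
  assumes sfgip: "\<And>u. u \<in> U \<Longrightarrow> sfgip (A u)" and H: "fg_subgroup G H" and x: "x \<in> V"
    and fgx: "fg_subgroup G (stab H x)"
  shows "\<exists>M. finite M \<and> (\<forall>m\<in>M. (x, m) \<in> adj) \<and>
    (\<forall>y. (x, y) \<in> adj \<longrightarrow> stab H x \<inter> stab H y \<noteq> {\<one>} \<longrightarrow> (\<exists>h\<in>stab H x. \<exists>m\<in>M. y = act h m))"
proof -
  have subH: "subgroup H G" using H by (rule fg_subgroup_imp_subgroup)
  interpret H: subgroup H G by (rule subH)
  obtain u p where u: "u \<in> U" "p \<in> carrier G" "x = act p (b u)" using b_cover[OF x] by blast
  interpret Au: group "A u" using u by (intro A_group)
  let ?B = "pull u p H"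
  let ?m = "monoid.mult (A u)" and ?i = "m_inv (A u)"
  have fgB: "fg_subgroup (A u) ?B" using fg_pull[OF u(1,2) H.subset] fgx u(3) by simp
  have B: "subgroup ?B (A u)" using fgB by (rule Au.fg_subgroup_imp_subgroup)
  interpret B: subgroup ?B "A u" by (rule B)
  define \<Delta> where "\<Delta> i = {dcoset (A u) ?B a (Ed i) | a. a \<in> carrier (A u) \<and> conj_set (A u) ?B a \<inter> Ed i \<noteq> {\<one>\<^bsub>A u\<^esub>}}" for i
  have fin\<Delta>: "finite (\<Delta> i)" if "i \<in> I u" for i
    using sfgip[OF u(1)] fgB Ed_fg[OF u(1) that] unfolding sfgip_def \<Delta>_def by blast
  define r where "r i E = (SOME a. a \<in> carrier (A u) \<and> dcoset (A u) ?B a (Ed i) = E)" for i E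
  have r: "r i E \<in> carrier (A u)" "dcoset (A u) ?B (r i E) (Ed i) = E" if "E \<in> \<Delta> i" for i E
  proof -
    have "\<exists>a. a \<in> carrier (A u) \<and> dcoset (A u) ?B a (Ed i) = E" using that by (auto simp: \<Delta>_def)
    from someI_ex[OF this] show "r i E \<in> carrier (A u)" "dcoset (A u) ?B (r i E) (Ed i) = E" by (auto simp: r_def)
  qed
  let ?M = "(\<Union>i\<in>I u. (\<lambda>E. act p (act (\<phi> u (r i E)) (n i))) ` \<Delta> i)"
  show ?thesis
  proof (intro exI[of _ ?M] conjI ballI allI impI)
    show "finite ?M" using I_finite[OF u(1)] fin\<Delta> by blast
    fix m assume "m \<in> ?M"
    then obtain i E where m: "i \<in> I u" "E \<in> \<Delta> i" "m = act p (act (\<phi> u (r i E)) (n i))" by blast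
    have "(act p (act (\<phi> u (r i E)) (b u)), m) \<in> adj"
      unfolding m(3) using u m n_adj r by (intro act_adj) auto
    then show "(x, m) \<in> adj" using u m r(1) by (simp add: \<phi>_fix)
  next
    fix y assume xy: "(x, y) \<in> adj" and nt: "stab H x \<inter> stab H y \<noteq> {\<one>}"
    have yV: "y \<in> V" using xy adj_V by blast
    have "(act (inv p) x, act (inv p) y) \<in> adj" using xy u by (intro act_adj) auto
    then have "(b u, act (inv p) y) \<in> adj" using u b_V by simp
    then obtain i a where i: "i \<in> I u" and a: "a \<in> carrier (A u)" "act (inv p) y = act (\<phi> u a) (n i)"
      using n_cover[OF u(1)] by blast
    have y: "y = act p (act (\<phi> u a) (n i))" unfolding a(2)[symmetric] using u yV by simp
    have nV: "n i \<in> V" using u i by (intro n_V)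
    interpret E: subgroup "Ed i" "A u" using u(1) i by (rule Ed_subgroup)
    have "\<one> \<in> stab H x \<inter> stab H y" using x yV by (simp add: stab_def act_one)
    with nt obtain h where h: "h \<in> stab H x" "h \<in> stab H y" "h \<noteq> \<one>" by blast
    then obtain c where c: "c \<in> ?B" "h = chart u p c"
      using stab_eq_chart_pull[OF u(1,2) H.subset] u(3) by auto
    have cc: "c \<in> carrier (A u)" using c by simp
    have "c \<noteq> \<one>\<^bsub>A u\<^esub>"
    proof
      assume "c = \<one>\<^bsub>A u\<^esub>"
      moreover have "\<phi> u \<one>\<^bsub>A u\<^esub> = \<one>" using \<phi>_hom[OF u(1)] by (rule group_hom.hom_one)
      ultimately have "h = \<one>" using c u by (simp add: chart_def)
      with h show False by simp
    qed
    let ?d = "?m (?m (?i a) c) a"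
    have "act h y = y" using h by (simp add: stab_def)
    then have "act p (act (\<phi> u c) (act (\<phi> u a) (n i))) = act p (act (\<phi> u a) (n i))"
      unfolding c(2) y using u cc a nV by (simp add: chart_act)
    then have e: "act (\<phi> u c) (act (\<phi> u a) (n i)) = act (\<phi> u a) (n i)"
      using u cc a nV by (simp add: act_inj)
    have "act (\<phi> u ?d) (n i) = act (inv (\<phi> u a)) (act (\<phi> u c) (act (\<phi> u a) (n i)))"
      using u cc a nV by (simp add: \<phi>_mult[OF u(1)] \<phi>_inv[OF u(1)] act_mult)
    then have "act (\<phi> u ?d) (n i) = n i" unfolding e using u a nV by simp
    moreover have "?d \<in> carrier (A u)" using cc a by simp
    ultimately have "?d \<in> Ed i" unfolding Ed_eq[OF u(1) i] by blast
    moreover have "?m (?m a ?d) (?i a) = c" using cc a by (simp add: Au.m_assoc)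
    then have "?d \<in> conj_set (A u) ?B a" using Au.mem_conj_set_iff[OF B.subset a(1)] c cc a by simp
    moreover have "?d \<noteq> \<one>\<^bsub>A u\<^esub>"
    proof
      assume d1: "?d = \<one>\<^bsub>A u\<^esub>"
      have "c = ?m (?m a ?d) (?i a)" using cc a by (simp add: Au.m_assoc)
      with \<open>c \<noteq> \<one>\<^bsub>A u\<^esub>\<close> show False unfolding d1 using a by simp
    qed
    ultimately have E: "dcoset (A u) ?B a (Ed i) \<in> \<Delta> i" (is "?E \<in> _") using a(1) unfolding \<Delta>_def by blast
    obtain w where w: "w \<in> carrier (A u)" "dcoset (A u) ?B w (Ed i) = ?E"
      and wM: "act p (act (\<phi> u w) (n i)) \<in> ?M"
      using r[OF E] i E by blast
    have "a \<in> dcoset (A u) ?B w (Ed i)"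
      unfolding w(2) using B E.subgroup_axioms a(1) by (rule Au.dcoset_self)
    then obtain s \<alpha> where s: "s \<in> ?B" "\<alpha> \<in> Ed i" "a = ?m (?m s w) \<alpha>" unfolding Au.mem_dcoset_iff by blast
    have \<alpha>: "\<alpha> \<in> carrier (A u)" "act (\<phi> u \<alpha>) (n i) = n i"
      using s(2) unfolding Ed_eq[OF u(1) i] by blast+
    have "y = act p (act (\<phi> u s) (act (\<phi> u w) (act (\<phi> u \<alpha>) (n i))))"
      unfolding y s(3) using u s(1) \<alpha>(1) nV w(1) by (simp add: \<phi>_mult[OF u(1)] act_mult)
    also have "\<dots> = act (chart u p s) (act p (act (\<phi> u w) (n i)))"
      unfolding \<alpha>(2) using u s(1) nV w(1) by (simp add: chart_act)
    finally have "y = act (chart u p s) (act p (act (\<phi> u w) (n i)))" .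
    moreover have "chart u p s \<in> stab H x" using stab_eq_chart_pull[OF u(1,2) H.subset] u(3) s(1) by auto
    ultimately show "\<exists>h\<in>stab H x. \<exists>m\<in>?M. y = act h m" using wM by blast
  qed
qed

lemma stab_conj_nontrivial:
  assumes H: "subgroup H G" and h: "h \<in> H" and V: "x \<in> V" "y \<in> V"
    and nt: "stab H x \<inter> stab H y \<noteq> {\<one>}"
  shows "stab H (act h x) \<inter> stab H (act h y) \<noteq> {\<one>}"
proof -
  interpret H: subgroup H G by fact
  have "\<one> \<in> stab H x \<inter> stab H y" using V by (simp add: stab_def act_one)
  with nt obtain l where l: "l \<in> H" "act l x = x" "act l y = y" "l \<noteq> \<one>" by (auto simp: stab_def)
  let ?l = "h \<otimes> l \<otimes> inv h"
  have "?l \<in> stab H (act h x) \<inter> stab H (act h y)" using l h V by (simp add: stab_def act_mult)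
  moreover have "?l \<noteq> \<one>"
  proof
    assume "?l = \<one>"
    then have "inv h \<otimes> ?l \<otimes> h = inv h \<otimes> \<one> \<otimes> h" by simp
    then have "l = \<one>" using l h by (simp add: m_assoc)
    with l show False by simp
  qed
  ultimately show ?thesis by blast
qed

lemma cofinite_collar:
  assumes sfgip: "\<And>u. u \<in> U \<Longrightarrow> sfgip (A u)" and H: "fg_subgroup G H" and X: "cofinite_subtree H X"
  shows "cofinite_subtree H (collar H X)"
proof -
  have subH: "subgroup H G" using H by (rule fg_subgroup_imp_subgroup)
  interpret H: subgroup H G by (rule subH)
  have treeX: "subtree X" and XV: "X \<subseteq> V" using X by (auto simp: cofinite_subtree_def subtree_def)
  have invX: "act h x \<in> X" if "h \<in> H" "x \<in> X" for h x using X that by (simp add: cofinite_subtree_def)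
  obtain D where D: "finite D" "D \<subseteq> X" "\<And>x. x \<in> X \<Longrightarrow> \<exists>h\<in>H. \<exists>d\<in>D. x = act h d"
    using cofinite_subtree_vertices[OF X] by blast
  obtain E where E: "finite E" "E \<subseteq> edges_in X"
    "\<And>x y. (x, y) \<in> edges_in X \<Longrightarrow> \<exists>h\<in>H. \<exists>p q. (p, q) \<in> E \<and> x = act h p \<and> y = act h q"
    by (rule cofinite_subtree_edges[OF X]) (rule that)
  let ?X = "collar H X"
  have collarV: "?X \<subseteq> V" using XV adj_V by (auto simp: collar_def)
  have inv: "act h x \<in> ?X" if h: "h \<in> H" and x: "x \<in> ?X" for h x
  proof (cases "x \<in> X")
    case False
    then obtain z where z: "z \<in> X" "(z, x) \<in> adj" "stab H z \<inter> stab H x \<noteq> {\<one>}" using x by (auto simp: collar_def)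
    then have "stab H (act h z) \<inter> stab H (act h x) \<noteq> {\<one>}"
      using subH h adj_V by (intro stab_conj_nontrivial) auto
    moreover have "(act h z, act h x) \<in> adj" using z h by (intro act_adj) auto
    ultimately show ?thesis using invX[OF h z(1)] unfolding collar_def by blast
  qed (use invX h in \<open>auto simp: collar_def\<close>)
  have "\<exists>M. finite M \<and> (\<forall>m\<in>M. (x, m) \<in> adj) \<and>
    (\<forall>y. (x, y) \<in> adj \<longrightarrow> stab H x \<inter> stab H y \<noteq> {\<one>} \<longrightarrow> (\<exists>h\<in>stab H x. \<exists>m\<in>M. y = act h m))"
    if "x \<in> D" for x
    using that D(2) XV fg_stab[OF H X] by (intro finite_nontrivial_edge_orbits sfgip H) auto
  then obtain M where M: "\<And>x. x \<in> D \<Longrightarrow> finite (M x)" "\<And>x m. x \<in> D \<Longrightarrow> m \<in> M x \<Longrightarrow> (x, m) \<in> adj"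
    "\<And>x y. x \<in> D \<Longrightarrow> (x, y) \<in> adj \<Longrightarrow> stab H x \<inter> stab H y \<noteq> {\<one>} \<Longrightarrow> \<exists>h\<in>stab H x. \<exists>m\<in>M x. y = act h m"
    by metis
  define M' where "M' x = M x \<inter> ?X" for x
  define E1 where "E1 = Sigma D M'"
  define E' where "E' = E \<union> E1 \<union> E1\<inverse>"
  define D' where "D' = D \<union> (\<Union>d\<in>D. M' d)"
  define R where "R = {(act h p, act h q) | h p q. h \<in> H \<and> (p, q) \<in> E'}"
  have XX: "X \<subseteq> ?X" by (auto simp: collar_def)
  have new: "\<exists>h\<in>H. \<exists>d\<in>D. \<exists>m\<in>M' d. x = act h d \<and> y = act h m"
    if x: "x \<in> X" and xy: "(x, y) \<in> adj" "stab H x \<inter> stab H y \<noteq> {\<one>}" for x y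
  proof -
    obtain h d where h: "h \<in> H" "d \<in> D" "x = act h d" using D(3)[OF x] by blast
    have V: "x \<in> V" "y \<in> V" "d \<in> V" using xy adj_V h D(2) XV by auto
    have d: "d = act (inv h) x" using h V by simp
    have adj': "(d, act (inv h) y) \<in> adj" unfolding d using xy h by (intro act_adj) auto
    have nt: "stab H d \<inter> stab H (act (inv h) y) \<noteq> {\<one>}"
      unfolding d using xy h V subH by (intro stab_conj_nontrivial) auto
    from M(3)[OF h(2) adj' nt] obtain k m where k: "k \<in> stab H d" "m \<in> M d" "act (inv h) y = act k m" by blast
    have kH: "k \<in> H" "act k d = d" using k by (auto simp: stab_def)
    have mV: "m \<in> V" using M(2)[OF h(2) k(2)] adj_V by blast
    have y: "y = act (h \<otimes> k) m" using k(3) h kH V mV by (metis H.mem_carrier act_act_inv act_mult)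
    have yX: "y \<in> ?X" using x xy by (auto simp: collar_def)
    have "m = act (inv (h \<otimes> k)) y" unfolding y using h kH mV by simp
    also have "\<dots> \<in> ?X" using h kH yX by (intro inv) auto
    finally have "m \<in> M' d" using k(2) by (simp add: M'_def)
    moreover have "x = act (h \<otimes> k) d" using h kH V by (simp add: act_mult)
    moreover have "h \<otimes> k \<in> H" using h kH by simp
    ultimately show ?thesis using y h(2) by blast
  qed
  have RX: "edges_in X \<subseteq> R"
  proof (rule subrelI)
    fix x y assume "(x, y) \<in> edges_in X"
    from E(3)[OF this] show "(x, y) \<in> R" unfolding R_def E'_def by blast
  qed
  have Rnew: "\<exists>x\<in>X. (x, y) \<in> R\<^sup>* \<and> (y, x) \<in> R\<^sup>*" if y: "y \<in> ?X" for y
  proof (cases "y \<in> X")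
    case False
    then obtain x where x: "x \<in> X" "(x, y) \<in> adj" "stab H x \<inter> stab H y \<noteq> {\<one>}" using y by (auto simp: collar_def)
    from new[OF this] obtain h d m where "h \<in> H" "d \<in> D" "m \<in> M' d" "x = act h d" "y = act h m" by blast
    then have "(x, y) \<in> R" "(y, x) \<in> R" unfolding R_def E'_def E1_def by blast+
    with x(1) show ?thesis by blast
  qed auto
  show ?thesis
  proof (rule cofinite_subtreeI[OF subH collarV inv _ _ _ _ _ R_def])
    show "finite D'" using D(1) M(1) by (auto simp: D'_def M'_def)
    show "D' \<subseteq> ?X" using D(2) XX by (auto simp: D'_def M'_def)
    show "finite E'" using D(1) M(1) E(1) by (auto simp: E'_def E1_def M'_def)
    have "E1 \<subseteq> edges_in ?X" using D(2) M(2) XX by (auto simp: E1_def M'_def edges_in_def)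
    moreover have "E \<subseteq> edges_in ?X" using E(2) XX by (auto simp: edges_in_def)
    ultimately show "E' \<subseteq> edges_in ?X" using edges_in_sym unfolding E'_def by blast
    show "\<exists>h\<in>H. \<exists>d\<in>D'. x = act h d" if x: "x \<in> ?X" for x
    proof (cases "x \<in> X")
      case True
      from D(3)[OF this] show ?thesis unfolding D'_def by blast
    next
      case False
      then obtain z where "z \<in> X" "(z, x) \<in> adj" "stab H z \<inter> stab H x \<noteq> {\<one>}" using x by (auto simp: collar_def)
      from new[OF this] show ?thesis unfolding D'_def by blast
    qed
    fix x y assume x: "x \<in> ?X" and y: "y \<in> ?X"
    obtain x' where x': "x' \<in> X" "(x, x') \<in> R\<^sup>*" using Rnew[OF x] by blast
    obtain y' where y': "y' \<in> X" "(y', y) \<in> R\<^sup>*" using Rnew[OF y] by blast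
    have "(x', y') \<in> (edges_in X)\<^sup>*" using treeX x' y' by (simp add: subtree_def)
    then have "(x', y') \<in> R\<^sup>*" using rtrancl_mono[OF RX] by blast
    with x' y' show "(x, y) \<in> R\<^sup>*" by (meson rtrancl_trans)
  qed
qed

text \<open>
  Here \<open>g = p a q\<^sup>-\<^sup>1\<close> with \<open>a \<in> A u\<close>, and \<open>HgK\<close> depends only on \<open>BaC\<close>, where \<open>B\<close> and \<open>C\<close> are the two
  stabilisers. A non-trivial element of \<open>g\<^sup>-\<^sup>1Hg \<inter> K\<close> that fixes the vertex shows \<open>B\<^sup>a \<inter> C \<noteq> 1\<close>.
\<close>

lemma finite_dcosets_fixing_vertex_pair:
  assumes sfgip: "\<And>u. u \<in> U \<Longrightarrow> sfgip (A u)"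
    and H: "fg_subgroup G H" and X: "cofinite_subtree H X"
    and K: "fg_subgroup G K" and Y: "cofinite_subtree K Y"
    and u: "u \<in> U" and pq: "p \<in> carrier G" "q \<in> carrier G"
    and x: "act p (b u) \<in> X" and y: "act q (b u) \<in> Y"
  shows "finite {dcoset G H g K | g. g \<in> carrier G \<and> act g (act q (b u)) = act p (b u) \<and>
    (\<exists>l\<in>K. l \<noteq> \<one> \<and> act l (act q (b u)) = act q (b u) \<and> g \<otimes> l \<otimes> inv g \<in> H)}" (is "finite ?S")
proof -
  interpret Au: group "A u" using u by (rule A_group)
  let ?B = "pull u p H" and ?C = "pull u q K"
  let ?m = "monoid.mult (A u)" and ?i = "m_inv (A u)"
  have subH: "subgroup H G" and subK: "subgroup K G" using H K by (auto intro: fg_subgroup_imp_subgroup)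
  interpret H: subgroup H G by (rule subH)
  interpret K: subgroup K G by (rule subK)
  have fgB: "fg_subgroup (A u) ?B" using fg_pull[OF u pq(1) H.subset fg_stab[OF H X x]] .
  have fgC: "fg_subgroup (A u) ?C" using fg_pull[OF u pq(2) K.subset fg_stab[OF K Y y]] .
  have B: "subgroup ?B (A u)" and C: "subgroup ?C (A u)" using u pq subH subK by (auto intro: pull_subgroup)
  interpret B: subgroup ?B "A u" by (rule B)
  define N where "N = {a \<in> carrier (A u). conj_set (A u) ?B a \<inter> ?C \<noteq> {\<one>\<^bsub>A u\<^esub>}}"
  define f where "f a = dcoset G H (p \<otimes> \<phi> u a \<otimes> inv q) K" for a
  have "finite {dcoset (A u) ?B a ?C | a. a \<in> carrier (A u) \<and> conj_set (A u) ?B a \<inter> ?C \<noteq> {\<one>\<^bsub>A u\<^esub>}}"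
    using sfgip[OF u] fgB fgC unfolding sfgip_def by blast
  moreover have "(\<lambda>a. dcoset (A u) ?B a ?C) ` N =
      {dcoset (A u) ?B a ?C | a. a \<in> carrier (A u) \<and> conj_set (A u) ?B a \<inter> ?C \<noteq> {\<one>\<^bsub>A u\<^esub>}}"
    unfolding N_def by blast
  ultimately have "finite ((\<lambda>a. dcoset (A u) ?B a ?C) ` N)" by simp
  then have "finite (f ` N)"
  proof (rule finite_image_if_factors)
    fix a a' assume a: "a \<in> N" "a' \<in> N" and eq: "dcoset (A u) ?B a ?C = dcoset (A u) ?B a' ?C"
    have ac: "a \<in> carrier (A u)" "a' \<in> carrier (A u)" using a by (auto simp: N_def)
    have "a \<in> dcoset (A u) ?B a' ?C" unfolding eq[symmetric] using B C ac(1) by (rule Au.dcoset_self)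
    then obtain s t where s: "s \<in> ?B" "t \<in> ?C" "a = ?m (?m s a') t" unfolding Au.mem_dcoset_iff by blast
    have sc: "s \<in> carrier (A u)" "t \<in> carrier (A u)" "chart u p s \<in> H" "chart u q t \<in> K"
      using s(1,2) unfolding pull_def by blast+
    have "p \<otimes> \<phi> u a \<otimes> inv q = chart u p s \<otimes> (p \<otimes> \<phi> u a' \<otimes> inv q) \<otimes> chart u q t"
      unfolding s(3) chart_def using u pq ac(2) sc(1,2) by (simp add: \<phi>_mult m_assoc)
    moreover have "p \<otimes> \<phi> u a' \<otimes> inv q \<in> carrier G" using u pq ac(2) by simp
    ultimately show "f a = f a'"
      unfolding f_def using dcoset_mult_eq[OF subH subK sc(3,4)] by metis
  qed
  moreover have "?S \<subseteq> f ` N"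
  proof
    fix E assume "E \<in> ?S"
    then obtain g l where E: "E = dcoset G H g K" and g: "g \<in> carrier G" "act g (act q (b u)) = act p (b u)"
      and l: "l \<in> K" "l \<noteq> \<one>" "act l (act q (b u)) = act q (b u)" "g \<otimes> l \<otimes> inv g \<in> H" by blast
    have "act (inv p \<otimes> g \<otimes> q) (b u) = b u" using u pq g b_V by (simp add: act_mult)
    then obtain a where a: "a \<in> carrier (A u)" "inv p \<otimes> g \<otimes> q = \<phi> u a"
      using \<phi>_surj[OF u, of "inv p \<otimes> g \<otimes> q"] pq g by auto
    have ga: "g = p \<otimes> \<phi> u a \<otimes> inv q" unfolding a(2)[symmetric] using pq g by (simp add: m_assoc)
    obtain c where c: "c \<in> carrier (A u)" "l = chart u q c"
      using chart_surj[OF u pq(2) _ l(3)] l(1) K.mem_carrier by blast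
    have cC: "c \<in> ?C" using c l(1) unfolding pull_def by blast
    have "g \<otimes> l \<otimes> inv g = chart u p (?m (?m a c) (?i a))"
      unfolding ga c(2) chart_def using u pq a(1) c(1) by (simp add: \<phi>_mult \<phi>_inv m_assoc inv_mult_group)
    then have "chart u p (?m (?m a c) (?i a)) \<in> H" using l(4) by simp
    moreover have "?m (?m a c) (?i a) \<in> carrier (A u)" using a(1) c(1) by simp
    ultimately have "?m (?m a c) (?i a) \<in> ?B" unfolding pull_def by blast
    then have "c \<in> conj_set (A u) ?B a \<inter> ?C" using Au.mem_conj_set_iff[OF B.subset a(1)] c(1) cC by simp
    moreover have "c \<noteq> \<one>\<^bsub>A u\<^esub>"
    proof
      assume "c = \<one>\<^bsub>A u\<^esub>"
      moreover have "\<phi> u \<one>\<^bsub>A u\<^esub> = \<one>" using \<phi>_hom[OF u] by (rule group_hom.hom_one)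
      ultimately have "l = \<one>" using c pq by (simp add: chart_def)
      with l show False by simp
    qed
    ultimately have "a \<in> N" using a(1) unfolding N_def by blast
    moreover have "E = f a" unfolding E f_def using ga by simp
    ultimately show "E \<in> f ` N" by (rule image_eqI[rotated])
  qed
  ultimately show ?thesis by (rule finite_subset[rotated])
qed

lemma finite_dcosets_fixing_vertex:
  assumes sfgip: "\<And>u. u \<in> U \<Longrightarrow> sfgip (A u)"
    and H: "fg_subgroup G H" and X: "cofinite_subtree H X"
    and K: "fg_subgroup G K" and Y: "cofinite_subtree K Y"
  shows "finite {dcoset G H g K | g. g \<in> carrier G \<and>
    (\<exists>y\<in>Y. act g y \<in> X \<and> (\<exists>l\<in>K. l \<noteq> \<one> \<and> act l y = y \<and> g \<otimes> l \<otimes> inv g \<in> H))}" (is "finite ?S")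
proof -
  have subH: "subgroup H G" and subK: "subgroup K G" using H K by (auto intro: fg_subgroup_imp_subgroup)
  interpret H: subgroup H G by (rule subH)
  interpret K: subgroup K G by (rule subK)
  have XV: "X \<subseteq> V" and YV: "Y \<subseteq> V" using X Y by (auto simp: cofinite_subtree_def subtree_def)
  obtain DX where DX: "finite DX" "DX \<subseteq> X" "\<And>x. x \<in> X \<Longrightarrow> \<exists>h\<in>H. \<exists>d\<in>DX. x = act h d"
    using cofinite_subtree_vertices[OF X] by blast
  obtain DY where DY: "finite DY" "DY \<subseteq> Y" "\<And>x. x \<in> Y \<Longrightarrow> \<exists>h\<in>K. \<exists>d\<in>DY. x = act h d"
    using cofinite_subtree_vertices[OF Y] by blast
  define T where "T x0 y0 = {dcoset G H g K | g. g \<in> carrier G \<and> act g y0 = x0 \<and>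
    (\<exists>l\<in>K. l \<noteq> \<one> \<and> act l y0 = y0 \<and> g \<otimes> l \<otimes> inv g \<in> H)}" for x0 y0
  have finT: "finite (T x0 y0)" if xy: "x0 \<in> DX" "y0 \<in> DY" for x0 y0
  proof (cases "\<exists>g\<in>carrier G. act g y0 = x0")
    case True
    then obtain g where g: "g \<in> carrier G" "act g y0 = x0" by blast
    obtain u q where u: "u \<in> U" "q \<in> carrier G" "y0 = act q (b u)" using b_cover xy DY YV by blast
    have p: "g \<otimes> q \<in> carrier G" "x0 = act (g \<otimes> q) (b u)" using u g b_V by (auto simp: act_mult)
    have "act (g \<otimes> q) (b u) \<in> X" "act q (b u) \<in> Y" using xy DX DY u(3) p(2) by auto
    from finite_dcosets_fixing_vertex_pair[OF sfgip H X K Y u(1) p(1) u(2) this]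
    show ?thesis unfolding T_def p(2)[symmetric] u(3)[symmetric] .
  next
    case False
    then have "T x0 y0 = {}" by (auto simp: T_def)
    then show ?thesis by simp
  qed
  have "?S \<subseteq> (\<Union>x0\<in>DX. \<Union>y0\<in>DY. T x0 y0)"
  proof
    fix E assume "E \<in> ?S"
    then obtain g y l where E: "E = dcoset G H g K" and g: "g \<in> carrier G" and y: "y \<in> Y" "act g y \<in> X"
      and l: "l \<in> K" "l \<noteq> \<one>" "act l y = y" "g \<otimes> l \<otimes> inv g \<in> H" by blast
    obtain k0 y0 where k0: "k0 \<in> K" "y0 \<in> DY" "y = act k0 y0" using DY(3)[OF y(1)] by blast
    obtain h0 x0 where h0: "h0 \<in> H" "x0 \<in> DX" "act g y = act h0 x0" using DX(3)[OF y(2)] by blast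
    have V0: "y0 \<in> V" "x0 \<in> V" "y \<in> V" using k0 h0 y DX DY XV YV by auto
    have c: "k0 \<in> carrier G" "h0 \<in> carrier G" "l \<in> carrier G" using k0 h0 l by auto
    let ?g = "inv h0 \<otimes> g \<otimes> k0" and ?l = "inv k0 \<otimes> l \<otimes> k0"
    have "?l \<in> K" using k0 l by simp
    moreover have "?l \<noteq> \<one>"
    proof
      assume "?l = \<one>"
      then have "k0 \<otimes> ?l \<otimes> inv k0 = k0 \<otimes> \<one> \<otimes> inv k0" by simp
      then show False using c l by (simp add: m_assoc)
    qed
    moreover have "act ?l y0 = y0"
      using c V0 l(3) k0(3) by (simp add: act_mult)
    moreover have "?g \<otimes> ?l \<otimes> inv ?g = inv h0 \<otimes> (g \<otimes> l \<otimes> inv g) \<otimes> h0"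
      using c g by (simp add: m_assoc inv_mult_group)
    then have "?g \<otimes> ?l \<otimes> inv ?g \<in> H" using h0(1) l(4) by simp
    moreover have "act ?g y0 = x0" using c g V0 h0(3) k0(3) by (simp add: act_mult)
    moreover have "?g \<in> carrier G" using c g by simp
    ultimately have "dcoset G H ?g K \<in> T x0 y0" unfolding T_def by blast
    moreover have "dcoset G H ?g K = E" unfolding E using h0 k0 g by (intro dcoset_mult_eq[OF subH subK]) auto
    ultimately show "E \<in> (\<Union>x0\<in>DX. \<Union>y0\<in>DY. T x0 y0)" using h0(2) k0(2) by blast
  qed
  moreover have "finite (\<Union>x0\<in>DX. \<Union>y0\<in>DY. T x0 y0)" using DX(1) DY(1) finT by blast
  ultimately show ?thesis by (rule finite_subset)
qed

text \<open>
  A non-trivial element \<open>l\<close> of \<open>g\<^sup>-\<^sup>1Hg \<inter> K\<close> fixes the bridge from \<open>g\<^sup>-\<^sup>1X\<close> to \<open>Y\<close> pointwise. So the bridge has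
  fewer than \<open>k\<close> edges, and each of them has non-trivial stabiliser in \<open>g\<^sup>-\<^sup>1Hg\<close>: the \<open>i\<close>-th vertex lies
  in the \<open>i\<close>-th collar.
\<close>

lemma collar_reaches:
  assumes H: "fg_subgroup G H" and X: "cofinite_subtree H X"
    and K: "fg_subgroup G K" and Y: "cofinite_subtree K Y" and ne: "X \<noteq> {}" "Y \<noteq> {}"
    and acyl: "\<And>xs g. walk adj xs \<Longrightarrow> no_backtrack xs \<Longrightarrow> length xs = Suc k \<Longrightarrow> g \<in> carrier G \<Longrightarrow>
      act g (hd xs) = hd xs \<Longrightarrow> act g (last xs) = last xs \<Longrightarrow> g = \<one>"
    and g: "g \<in> carrier G" and l: "l \<in> K" "l \<noteq> \<one>" "g \<otimes> l \<otimes> inv g \<in> H"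
  shows "\<exists>y\<in>Y. act g y \<in> (collar H ^^ k) X"
proof -
  interpret H: subgroup H G using H by (rule fg_subgroup_imp_subgroup)
  interpret K: subgroup K G using K by (rule fg_subgroup_imp_subgroup)
  have treeX: "subtree X" "X \<subseteq> V" and treeY: "subtree Y" "Y \<subseteq> V" using X Y by (auto simp: cofinite_subtree_def subtree_def)
  have invX: "act h x \<in> X" if "h \<in> H" "x \<in> X" for h x using X that by (simp add: cofinite_subtree_def)
  have invY: "act h x \<in> Y" if "h \<in> K" "x \<in> Y" for h x using Y that by (simp add: cofinite_subtree_def)
  have iffX: "act h x \<in> X \<longleftrightarrow> x \<in> X" if "h \<in> H" "x \<in> V" for h x
    using invX[OF that(1), of x] invX[of "inv h" "act h x"] that by auto
  have iffY: "act h x \<in> Y \<longleftrightarrow> x \<in> Y" if "h \<in> K" "x \<in> V" for h x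
    using invY[OF that(1), of x] invY[of "inv h" "act h x"] that by auto
  have mono: "(collar H ^^ i) X \<subseteq> (collar H ^^ j) X" if "i \<le> j" for i j
    using that by (induction rule: dec_induct) (auto simp: collar_def)
  have lc: "l \<in> carrier G" using l by simp
  let ?X = "{x \<in> V. act g x \<in> X}"
  show ?thesis
  proof (cases "?X \<inter> Y = {}")
    case False
    then show ?thesis using mono[of 0 k] by auto
  next
    case True
    have "subtree ?X" using treeX(1) g by (rule subtree_vimage)
    moreover have "?X \<noteq> {}"
    proof -
      obtain x where "x \<in> X" using ne by blast
      then have "act (inv g) x \<in> ?X" using treeX(2) g by auto
      then show ?thesis by blast
    qed
    ultimately obtain xs where xs: "walk adj xs" "no_backtrack xs" "hd xs \<in> ?X" "last xs \<in> Y" "set xs \<subseteq> V"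
      and rigid: "\<And>l. l \<in> carrier G \<Longrightarrow> (\<And>x. x \<in> V \<Longrightarrow> act l x \<in> ?X \<longleftrightarrow> x \<in> ?X) \<Longrightarrow>
        (\<And>y. y \<in> V \<Longrightarrow> act l y \<in> Y \<longleftrightarrow> y \<in> Y) \<Longrightarrow> map (act l) xs = xs"
      using bridge_between_disjoint_subtrees[OF _ _ treeY(1) ne(2) True] by blast
    have "act l x \<in> ?X \<longleftrightarrow> x \<in> ?X" if "x \<in> V" for x
    proof -
      have "act g (act l x) = act (g \<otimes> l \<otimes> inv g) (act g x)" using that g lc by (simp add: act_mult)
      then show ?thesis using iffX[OF l(3), of "act g x"] that g lc by auto
    qed
    then have "map (act l) xs = xs" using iffY l(1) lc by (intro rigid) auto
    then have fixl: "act l x = x" if "x \<in> set xs" for x using that by (metis map_eq_conv map_ident)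
    have len: "length xs \<le> k"
    proof (rule ccontr)
      assume long: "\<not> length xs \<le> k"
      let ?ys = "take (Suc k) xs"
      have ys: "walk adj ?ys" "no_backtrack ?ys"
      proof -
        show "walk adj ?ys" using xs(1) by (auto simp: walk_def successively_conv_nth)
        show "no_backtrack ?ys" using no_backtrack_append[of ?ys "drop (Suc k) xs"] xs(2) by simp
      qed
      have "l = \<one>"
      proof (rule acyl[OF ys])
        show "length ?ys = Suc k" using long by simp
        have ne: "?ys \<noteq> []" using long by auto
        have "set ?ys \<subseteq> set xs" by (rule set_take_subset)
        then have "hd ?ys \<in> set xs" "last ?ys \<in> set xs" using hd_in_set[OF ne] last_in_set[OF ne] by blast+
        then show "act l (hd ?ys) = hd ?ys" "act l (last ?ys) = last ?ys" using fixl by auto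
      qed (use lc in auto)
      with l show False by simp
    qed
    have coll: "act g (xs ! i) \<in> (collar H ^^ i) X" if "i < length xs" for i
      using that
    proof (induction i)
      case 0
      then show ?case using xs(3) by (simp add: hd_conv_nth)
    next
      case (Suc i)
      let ?x = "xs ! i" and ?y = "xs ! Suc i"
      have V: "?x \<in> V" "?y \<in> V" "act l ?x = ?x" "act l ?y = ?y" using Suc.prems xs(5) fixl by auto
      have "(?x, ?y) \<in> adj" using xs(1) Suc.prems by (simp add: walk_def successively_conv_nth)
      then have adj': "(act g ?x, act g ?y) \<in> adj" using g by (rule act_adj[rotated])
      have "g \<otimes> l \<otimes> inv g \<in> stab H (act g ?x) \<inter> stab H (act g ?y)"
        using l g lc V by (simp add: stab_def act_mult)
      moreover have "g \<otimes> l \<otimes> inv g \<noteq> \<one>"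
      proof
        assume "g \<otimes> l \<otimes> inv g = \<one>"
        then have "inv g \<otimes> (g \<otimes> l \<otimes> inv g) \<otimes> g = inv g \<otimes> \<one> \<otimes> g" by simp
        then show False using g lc l by (simp add: m_assoc)
      qed
      ultimately have "stab H (act g ?x) \<inter> stab H (act g ?y) \<noteq> {\<one>}" by blast
      then show ?case using Suc adj' by (auto simp: collar_def)
    qed
    have ne: "xs \<noteq> []" using xs(1) by auto
    then have "act g (last xs) \<in> (collar H ^^ (length xs - 1)) X"
      using coll[of "length xs - 1"] by (simp add: last_conv_nth)
    moreover have "length xs - 1 \<le> k" using len by simp
    ultimately have "act g (last xs) \<in> (collar H ^^ k) X" using mono by blast
    with xs(4) show ?thesis by blast
  qed
qed

text \<open>
  The tree \<open>g\<^sup>-\<^sup>1X \<inter> Y\<close> is non-empty for the iterated collar \<open>X\<close>. If \<open>g\<^sup>-\<^sup>1Hg \<inter> K\<close> acts freely on it and no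
  edge is branching, every vertex has at most one neighbour, so the tree has at most two vertices;
  a non-trivial element would fix a vertex or invert the edge.
\<close>

theorem sfgip_if_vertex_groups_sfgip:
  assumes sfgip: "\<And>u. u \<in> U \<Longrightarrow> sfgip (A u)"
    and acyl: "\<And>xs g. walk adj xs \<Longrightarrow> no_backtrack xs \<Longrightarrow> length xs = Suc k \<Longrightarrow> g \<in> carrier G \<Longrightarrow>
      act g (hd xs) = hd xs \<Longrightarrow> act g (last xs) = last xs \<Longrightarrow> g = \<one>"
  shows "sfgip G"
  unfolding sfgip_def
proof (intro conjI allI impI, goal_cases)
  case 1
  show ?case using sfgip by (intro fgip_if_vertex_groups_fgip) (auto simp: sfgip_def)
next
  case (2 H K)
  then have H: "fg_subgroup G H" and K: "fg_subgroup G K" by auto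
  have subH: "subgroup H G" and subK: "subgroup K G" using H K by (auto intro: fg_subgroup_imp_subgroup)
  interpret H: subgroup H G by (rule subH)
  interpret K: subgroup K G by (rule subK)
  obtain v where v: "v \<in> V" using V_nonempty by blast
  obtain X0 where X0: "v \<in> X0" "cofinite_subtree H X0" using exists_cofinite_subtree[OF H v] by blast
  obtain Y where Y: "v \<in> Y" "cofinite_subtree K Y" using exists_cofinite_subtree[OF K v] by blast
  define X where "X = (collar H ^^ k) X0"
  have "cofinite_subtree H ((collar H ^^ i) X0)" for i
    by (induction i) (use X0(2) cofinite_collar[OF sfgip H] in auto)
  then have X: "cofinite_subtree H X" by (simp add: X_def)
  have treeX: "subtree X" "X \<subseteq> V" and treeY: "subtree Y" "Y \<subseteq> V" using X Y by (auto simp: cofinite_subtree_def subtree_def)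
  have invX: "act h x \<in> X" if "h \<in> H" "x \<in> X" for h x using X that by (simp add: cofinite_subtree_def)
  have invY: "act h x \<in> Y" if "h \<in> K" "x \<in> Y" for h x using Y that by (simp add: cofinite_subtree_def)
  obtain Fin where Fin: "finite Fin" "Fin \<subseteq> carrier G \<times> V \<times> V"
    "\<And>g y y1. branching_edge H X K Y g y y1 \<Longrightarrow>
      \<exists>(g', z, z')\<in>Fin. \<exists>h\<in>H. \<exists>k\<in>K. g = h \<otimes> g' \<otimes> inv k \<and> y = act k z \<and> y1 = act k z'"
    by (rule finite_branching[OF H X K Y(2)]) (rule that)
  let ?S1 = "{dcoset G H g K | g. g \<in> carrier G \<and>
    (\<exists>y\<in>Y. act g y \<in> X \<and> (\<exists>l\<in>K. l \<noteq> \<one> \<and> act l y = y \<and> g \<otimes> l \<otimes> inv g \<in> H))}"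
  let ?S2 = "(\<lambda>(g, _, _). dcoset G H g K) ` Fin"
  have "{dcoset G H g K | g. g \<in> carrier G \<and> conj_set G H g \<inter> K \<noteq> {\<one>}} \<subseteq> ?S1 \<union> ?S2"
  proof
    fix E assume "E \<in> {dcoset G H g K | g. g \<in> carrier G \<and> conj_set G H g \<inter> K \<noteq> {\<one>}}"
    then obtain g where E: "E = dcoset G H g K" and g: "g \<in> carrier G" and nt: "conj_set G H g \<inter> K \<noteq> {\<one>}"
      by blast
    have "\<one> \<in> conj_set G H g \<inter> K" using g by (simp add: mem_conj_set_iff[OF H.subset])
    with nt obtain l where l: "l \<in> K" "l \<noteq> \<one>" "g \<otimes> l \<otimes> inv g \<in> H"
      using mem_conj_set_iff[OF H.subset g] by blast
    have lc: "l \<in> carrier G" using l by simp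
    show "E \<in> ?S1 \<union> ?S2"
    proof (cases "E \<in> ?S1")
      case False
      then have free: "m = \<one>" if "m \<in> K" "g \<otimes> m \<otimes> inv g \<in> H" "z \<in> Y" "act g z \<in> X" "act m z = z" for m z
        using that g unfolding E by blast
      let ?Z = "{x \<in> V. act g x \<in> X} \<inter> Y"
      have Z: "subtree ?Z" using treeX treeY g by (intro subtree_Int subtree_vimage)
      have lZ: "act l z \<in> ?Z" if "z \<in> ?Z" for z
      proof -
        have "act g (act l z) = act (g \<otimes> l \<otimes> inv g) (act g z)" using that g lc by (simp add: act_mult)
        then show ?thesis using that invX[OF l(3)] invY[OF l(1)] lc by auto
      qed
      have "\<exists>y\<in>Y. act g y \<in> X"
        unfolding X_def
      proof (rule collar_reaches[OF H X0(2) K Y(2) _ _ _ g l])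
        show "X0 \<noteq> {}" "Y \<noteq> {}" using X0(1) Y(1) by blast+
      qed (rule acyl)
      then obtain y where y: "y \<in> ?Z" using treeY(2) by blast
      have ly: "act l z \<noteq> z" if "z \<in> ?Z" for z using free[OF l(1,3)] that l(2) by auto
      have "\<exists>z z'. branching_edge H X K Y g z z'"
      proof (rule ccontr)
        assume nb: "\<nexists>z z'. branching_edge H X K Y g z z'"
        have unique: "z' = z''" if "(z, z') \<in> edges_in ?Z" "(z, z'') \<in> edges_in ?Z" for z z' z''
        proof -
          have "(z, z') \<in> edges_in Y" "(z, z'') \<in> edges_in Y" "act g z \<in> X" "act g z' \<in> X" "act g z'' \<in> X"
            and z: "z \<in> Y" "z' \<in> V"
            using that by (auto simp: edges_in_def)
          moreover have "\<not> branching_edge H X K Y g z z'" using nb by blast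
          ultimately obtain m where m: "m \<in> K" "g \<otimes> m \<otimes> inv g \<in> H" "act m z = z" "act m z' = z''"
            using g unfolding branching_edge_def by blast
          then have "m = \<one>" using free \<open>act g z \<in> X\<close> z by blast
          with m z show ?thesis by (simp add: act_one)
        qed
        have "(y, act l y) \<in> (edges_in ?Z)\<^sup>*" using Z y lZ[OF y] by (simp add: subtree_def)
        then obtain y1 where y1: "(y, y1) \<in> edges_in ?Z"
          using ly[OF y] by (metis converse_rtranclE)
        then have y1y: "(y1, y) \<in> edges_in ?Z" by (simp add: edges_in_sym)
        have two: "z = y \<or> z = y1" if "z \<in> ?Z" for z
        proof -
          have "(y, z) \<in> (edges_in ?Z)\<^sup>*" using Z y that by (simp add: subtree_def)
          then show ?thesis
          proof induction
            case (step z w)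
            then show ?case using unique[OF y1] unique[OF y1y] by blast
          qed simp
        qed
        have y1Z: "y1 \<in> ?Z" using y1 by (auto simp: edges_in_def)
        have "act l y = y1" using two[OF lZ[OF y]] ly[OF y] by blast
        moreover have "act l y1 = y" using two[OF lZ[OF y1Z]] ly[OF y1Z] by blast
        ultimately show False using no_inversion[OF lc, of y y1] y1 by (auto simp: edges_in_def)
      qed
      then obtain z z' where "branching_edge H X K Y g z z'" by blast
      from Fin(3)[OF this] obtain g' w w' h k where w: "(g', w, w') \<in> Fin" "h \<in> H" "k \<in> K" "g = h \<otimes> g' \<otimes> inv k"
        by blast
      have "g' \<in> carrier G" using w Fin(2) by auto
      then have "E = dcoset G H g' K" unfolding E w(4) using w by (intro dcoset_mult_eq[OF subH subK]) auto
      then show ?thesis using w(1) by force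
    qed simp
  qed
  moreover have "finite (?S1 \<union> ?S2)"
    using finite_dcosets_fixing_vertex[OF sfgip H X K Y(2)] Fin(1) by simp
  ultimately show ?case by (rule finite_subset)
qed

end

section \<open>Normal forms of paths in a graph of groups\<close>

locale based_graph_of_groups = graph_of_groups A
  for A :: "('v, 'e, 'a, 'b) graph_of_groups" +
  fixes u0 :: 'v
  assumes u0: "u0 \<in> gverts A"
    and paths_exist: "v \<in> gverts A \<Longrightarrow> \<exists>p. is_apath A u0 p v"
begin

abbreviation vmult :: "'v \<Rightarrow> 'a \<Rightarrow> 'a \<Rightarrow> 'a" where "vmult u \<equiv> monoid.mult (vgroup A u)"
abbreviation vone :: "'v \<Rightarrow> 'a" where "vone u \<equiv> one (vgroup A u)"
abbreviation vinv :: "'v \<Rightarrow> 'a \<Rightarrow> 'a" where "vinv u \<equiv> m_inv (vgroup A u)"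
abbreviation vcarrier :: "'v \<Rightarrow> 'a set" where "vcarrier u \<equiv> carrier (vgroup A u)"
abbreviation ecarrier :: "'e \<Rightarrow> 'b set" where "ecarrier e \<equiv> carrier (egroup A e)"

lemma alpha_hom: "e \<in> gedges A \<Longrightarrow> group_hom (egroup A e) (vgroup A (org A e)) (alpha A e)"
  using alpha_mon[of e] egroup[of e] vgroup[of "org A e"]
  by (auto simp: group_hom_def group_hom_axioms_def mon_def)

lemma omega_hom: "e \<in> gedges A \<Longrightarrow> group_hom (egroup A e) (vgroup A (trg A e)) (omega A e)"
  using alpha_hom[of "einv A e"] by (simp add: omega_def egroup_inv)

lemma edge_image_subgroup: "e \<in> gedges A \<Longrightarrow> subgroup (edge_image A e) (vgroup A (org A e))"
  unfolding edge_image_def by (rule group_hom.img_is_subgroup[OF alpha_hom])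

text \<open>
  The element of a coset of the edge group chosen to represent it; the edge group itself is
  represented by 1, so that a backtracking letter can be recognised by its representative.
\<close>

definition rep :: "'e \<Rightarrow> 'a \<Rightarrow> 'a" where
  "rep e a = (if a \<in> edge_image A e then vone (org A e)
     else SOME s. s \<in> a <#\<^bsub>vgroup A (org A e)\<^esub> edge_image A e)"

definition rest :: "'e \<Rightarrow> 'a \<Rightarrow> 'b" where
  "rest e a = (SOME x. x \<in> ecarrier e \<and> a = vmult (org A e) (rep e a) (alpha A e x))"

lemma rep_in_coset:
  assumes e: "e \<in> gedges A" and a: "a \<in> vcarrier (org A e)"
  shows "\<exists>x\<in>ecarrier e. rep e a = vmult (org A e) a (alpha A e x)"
proof -
  interpret G: group "vgroup A (org A e)" using e by (intro vgroup) auto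
  interpret \<alpha>: group_hom "egroup A e" "vgroup A (org A e)" "alpha A e" using e by (rule alpha_hom)
  show ?thesis
  proof (cases "a \<in> edge_image A e")
    case True
    then obtain x where x: "x \<in> ecarrier e" "a = alpha A e x" by (auto simp: edge_image_def)
    then have "rep e a = vmult (org A e) a (alpha A e (inv\<^bsub>egroup A e\<^esub> x))"
      using True by (simp add: rep_def)
    then show ?thesis using x by blast
  next
    case False
    have "vmult (org A e) a (alpha A e \<one>\<^bsub>egroup A e\<^esub>) \<in> a <#\<^bsub>vgroup A (org A e)\<^esub> edge_image A e"
      unfolding l_coset_def edge_image_def by blast
    then have "rep e a \<in> a <#\<^bsub>vgroup A (org A e)\<^esub> edge_image A e"
      using False by (simp add: rep_def someI[of "\<lambda>s. s \<in> a <#\<^bsub>vgroup A (org A e)\<^esub> edge_image A e"])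
    then show ?thesis by (auto simp: l_coset_def edge_image_def)
  qed
qed

lemma rep_closed [simp]: "e \<in> gedges A \<Longrightarrow> a \<in> vcarrier (org A e) \<Longrightarrow> rep e a \<in> vcarrier (org A e)"
  using rep_in_coset[of e a] alpha_closed[of e] by auto

lemma rest:
  assumes e: "e \<in> gedges A" and a: "a \<in> vcarrier (org A e)"
  shows "rest e a \<in> ecarrier e" "a = vmult (org A e) (rep e a) (alpha A e (rest e a))"
proof -
  interpret G: group "vgroup A (org A e)" using e by (intro vgroup) auto
  interpret \<alpha>: group_hom "egroup A e" "vgroup A (org A e)" "alpha A e" using e by (rule alpha_hom)
  obtain x where x: "x \<in> ecarrier e" "rep e a = vmult (org A e) a (alpha A e x)" using rep_in_coset[OF assms] by blast
  have "\<exists>x. x \<in> ecarrier e \<and> a = vmult (org A e) (rep e a) (alpha A e x)"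
    using x a by (intro exI[of _ "inv\<^bsub>egroup A e\<^esub> x"]) (simp add: G.m_assoc)
  from someI_ex[OF this] show "rest e a \<in> ecarrier e" "a = vmult (org A e) (rep e a) (alpha A e (rest e a))"
    unfolding rest_def by blast+
qed

lemma rest_unique:
  assumes e: "e \<in> gedges A" and a: "a \<in> vcarrier (org A e)" and x: "x \<in> ecarrier e"
    and eq: "a = vmult (org A e) (rep e a) (alpha A e x)"
  shows "rest e a = x"
proof -
  interpret G: group "vgroup A (org A e)" using e by (intro vgroup) auto
  have "vmult (org A e) (rep e a) (alpha A e x) = vmult (org A e) (rep e a) (alpha A e (rest e a))"
    using eq rest(2)[OF e a] by simp
  then have "alpha A e x = alpha A e (rest e a)"
    using rep_closed[OF e a] alpha_closed[OF e] x rest(1)[OF e a] by simp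
  then show ?thesis using alpha_mon[OF e] x rest(1)[OF e a] by (auto simp: mon_def inj_on_def)
qed

lemma rep_mult:
  assumes e: "e \<in> gedges A" and a: "a \<in> vcarrier (org A e)" and x: "x \<in> ecarrier e"
  shows "rep e (vmult (org A e) a (alpha A e x)) = rep e a"
proof -
  interpret G: group "vgroup A (org A e)" using e by (intro vgroup) auto
  interpret E: subgroup "edge_image A e" "vgroup A (org A e)" using e by (rule edge_image_subgroup)
  let ?x = "alpha A e x"
  have xE: "?x \<in> edge_image A e" using x by (simp add: edge_image_def)
  have "vmult (org A e) a ?x \<in> a <#\<^bsub>vgroup A (org A e)\<^esub> edge_image A e"
    using xE by (auto simp: l_coset_def)
  then have "vmult (org A e) a ?x <#\<^bsub>vgroup A (org A e)\<^esub> edge_image A e = a <#\<^bsub>vgroup A (org A e)\<^esub> edge_image A e"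
    using a E.subgroup_axioms G.l_repr_independence by metis
  moreover have "vmult (org A e) a ?x \<in> edge_image A e \<longleftrightarrow> a \<in> edge_image A e"
  proof
    assume "vmult (org A e) a ?x \<in> edge_image A e"
    from E.m_closed[OF this E.m_inv_closed[OF xE]]
    have "vmult (org A e) (vmult (org A e) a ?x) (vinv (org A e) ?x) \<in> edge_image A e" .
    moreover have "vmult (org A e) (vmult (org A e) a ?x) (vinv (org A e) ?x) = a"
      using a E.mem_carrier[OF xE] by (simp add: G.m_assoc)
    ultimately show "a \<in> edge_image A e" by simp
  qed (use xE in auto)
  ultimately show ?thesis by (simp add: rep_def)
qed

lemma rest_mult:
  assumes e: "e \<in> gedges A" and a: "a \<in> vcarrier (org A e)" and x: "x \<in> ecarrier e"
  shows "rest e (vmult (org A e) a (alpha A e x)) = rest e a \<otimes>\<^bsub>egroup A e\<^esub> x"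
proof (rule rest_unique[OF e])
  interpret G: group "vgroup A (org A e)" using e by (intro vgroup) auto
  interpret \<alpha>: group_hom "egroup A e" "vgroup A (org A e)" "alpha A e" using e by (rule alpha_hom)
  note r = rest[OF e a]
  show "vmult (org A e) a (alpha A e x) \<in> vcarrier (org A e)" using a x by simp
  show "rest e a \<otimes>\<^bsub>egroup A e\<^esub> x \<in> ecarrier e" using r x by simp
  have "vmult (org A e) (rep e a) (alpha A e (rest e a \<otimes>\<^bsub>egroup A e\<^esub> x)) =
      vmult (org A e) (vmult (org A e) (rep e a) (alpha A e (rest e a))) (alpha A e x)"
    using r(1) x rep_closed[OF e a] by (simp add: G.m_assoc)
  then show "vmult (org A e) a (alpha A e x) = vmult (org A e) (rep e (vmult (org A e) a (alpha A e x)))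
      (alpha A e (rest e a \<otimes>\<^bsub>egroup A e\<^esub> x))"
    using r(2) rep_mult[OF e a x] by simp
qed

lemma rep_eq_imp:
  assumes e: "e \<in> gedges A" and ab: "a \<in> vcarrier (org A e)" "b \<in> vcarrier (org A e)" and eq: "rep e a = rep e b"
  shows "vmult (org A e) (vinv (org A e) a) b \<in> edge_image A e"
proof -
  interpret G: group "vgroup A (org A e)" using e by (intro vgroup) auto
  interpret E: subgroup "edge_image A e" "vgroup A (org A e)" using e by (rule edge_image_subgroup)
  define s where "s = rep e a"
  define x where "x = alpha A e (rest e a)"
  define y where "y = alpha A e (rest e b)"
  have xy: "x \<in> edge_image A e" "y \<in> edge_image A e" using rest(1)[OF e] ab by (auto simp: x_def y_def edge_image_def)
  have a: "a = vmult (org A e) s x" and b: "b = vmult (org A e) s y"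
    using rest(2)[OF e ab(1)] rest(2)[OF e ab(2)] eq by (auto simp: s_def x_def y_def)
  have s: "s \<in> vcarrier (org A e)" using e ab by (simp add: s_def)
  have "vmult (org A e) (vinv (org A e) a) b = vmult (org A e) (vinv (org A e) x) y"
    unfolding a b using s xy E.mem_carrier
    by (simp add: G.inv_mult_group G.m_assoc)
  then show ?thesis using xy by simp
qed

lemma rep_eq_iff:
  assumes e: "e \<in> gedges A" and ab: "a \<in> vcarrier (org A e)" "b \<in> vcarrier (org A e)"
  shows "rep e a = rep e b \<longleftrightarrow> vmult (org A e) (vinv (org A e) a) b \<in> edge_image A e"
proof
  assume "vmult (org A e) (vinv (org A e) a) b \<in> edge_image A e"
  then obtain x where x: "x \<in> ecarrier e" "vmult (org A e) (vinv (org A e) a) b = alpha A e x" by (auto simp: edge_image_def)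
  interpret G: group "vgroup A (org A e)" using e by (intro vgroup) auto
  have "b = vmult (org A e) a (alpha A e x)"
    unfolding x(2)[symmetric] using ab by (simp add: G.m_assoc[symmetric])
  then show "rep e a = rep e b" using rep_mult[OF e ab(1) x(1)] by simp
qed (rule rep_eq_imp[OF assms])

lemma rep_one: "e \<in> gedges A \<Longrightarrow> a \<in> edge_image A e \<Longrightarrow> rep e a = vone (org A e)"
  by (simp add: rep_def)

lemma rep_eq_one_iff:
  assumes e: "e \<in> gedges A" and a: "a \<in> vcarrier (org A e)"
  shows "rep e a = vone (org A e) \<longleftrightarrow> a \<in> edge_image A e"
proof
  assume r: "rep e a = vone (org A e)"
  interpret G: group "vgroup A (org A e)" using e by (intro vgroup) auto
  have "a = alpha A e (rest e a)" using rest[OF e a] r alpha_closed[OF e] by simp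
  then show "a \<in> edge_image A e" using rest(1)[OF e a] by (auto simp: edge_image_def)
qed (simp add: rep_def)

lemma rep_rep:
  assumes e: "e \<in> gedges A" and a: "a \<in> vcarrier (org A e)"
  shows "rep e (rep e a) = rep e a" 
proof -
  obtain x where "x \<in> ecarrier e" "rep e a = vmult (org A e) a (alpha A e x)" using rep_in_coset[OF assms] by blast
  then show ?thesis using rep_mult[OF e a] by metis
qed

subsection \<open>Normal words\<close>

text \<open>
  The word \<open>[(s\<^sub>k, e\<^sub>k), \<dots>, (s\<^sub>1, e\<^sub>1)]\<close> stands for the path \<open>s\<^sub>1 e\<^sub>1 \<dots> s\<^sub>k e\<^sub>k\<close> from \<open>u0\<close>; the last edge comes
  first, as this is the end where paths act. A state is a normal word followed by an element of the
  vertex group at its end, and will be seen to be a normal form of congruence classes of paths.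
\<close>

fun word_end :: "('a \<times> 'e) list \<Rightarrow> 'v" where
  "word_end [] = u0"
| "word_end ((s, e) # w) = trg A e"

fun normal_word :: "('a \<times> 'e) list \<Rightarrow> bool" where
  "normal_word [] \<longleftrightarrow> True"
| "normal_word ((s, e) # w) \<longleftrightarrow> e \<in> gedges A \<and> org A e = word_end w \<and> s \<in> vcarrier (org A e) \<and> rep e s = s \<and>
     normal_word w \<and> (w \<noteq> [] \<longrightarrow> snd (hd w) = einv A e \<longrightarrow> s \<noteq> vone (org A e))"

definition state_at :: "'v \<Rightarrow> ('a \<times> 'e) list \<times> 'a \<Rightarrow> bool" where
  "state_at u st \<longleftrightarrow> normal_word (fst st) \<and> word_end (fst st) = u \<and> snd st \<in> vcarrier u"

definition pops :: "'e \<Rightarrow> ('a \<times> 'e) list \<Rightarrow> 'a \<Rightarrow> bool" where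
  "pops e w a \<longleftrightarrow> w \<noteq> [] \<and> snd (hd w) = einv A e \<and> a \<in> edge_image A e"

text \<open>
  Appending an edge to \<open>(w, a)\<close>: the part of \<open>a\<close> in the edge group slides across the edge, and the
  edge is either recorded or cancels against the last edge of \<open>w\<close>.
\<close>

definition edge_step :: "'e \<Rightarrow> ('a \<times> 'e) list \<times> 'a \<Rightarrow> ('a \<times> 'e) list \<times> 'a" where
  "edge_step e = (\<lambda>(w, a). if pops e w a then (tl w, vmult (trg A e) (fst (hd w)) (omega A e (rest e a)))
     else ((rep e a, e) # w, omega A e (rest e a)))"

fun run_list :: "('a \<times> 'e) list \<times> 'a \<Rightarrow> 'a \<Rightarrow> ('e \<times> 'a) list \<Rightarrow> ('a \<times> 'e) list \<times> 'a" where
  "run_list st b [] = (fst st, vmult (word_end (fst st)) (snd st) b)"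
| "run_list st b ((e, c) # xs) = run_list (edge_step e (fst st, vmult (org A e) (snd st) b)) c xs"

definition run :: "('a \<times> 'e) list \<times> 'a \<Rightarrow> ('e, 'a) apath \<Rightarrow> ('a \<times> 'e) list \<times> 'a" where
  "run st p = run_list st (fst p) (snd p)"

lemma word_end_in: "normal_word w \<Longrightarrow> word_end w \<in> gverts A"
  by (cases w rule: normal_word.cases) (auto simp: u0)

lemma state_at_vert: "state_at u st \<Longrightarrow> u \<in> gverts A"
  by (auto simp: state_at_def word_end_in)

lemma edge_step_state:
  assumes e: "e \<in> gedges A" and st: "state_at (org A e) (w, a)"
  shows "state_at (trg A e) (edge_step e (w, a))"
proof -
  have a: "a \<in> vcarrier (org A e)" "normal_word w" "word_end w = org A e" using st by (auto simp: state_at_def)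
  have r: "omega A e (rest e a) \<in> vcarrier (trg A e)" using e rest(1)[OF e a(1)] by (intro omega_closed)
  show ?thesis
  proof (cases "pops e w a")
    case True
    then obtain s w' where w: "w = (s, einv A e) # w'" by (cases w) (auto simp: pops_def)
    with a(2) e have "s \<in> vcarrier (trg A e)" "normal_word w'" "word_end w' = trg A e" by auto
    with True r e show ?thesis by (simp add: edge_step_def w state_at_def)
  next
    case False
    have "w \<noteq> [] \<longrightarrow> snd (hd w) = einv A e \<longrightarrow> rep e a \<noteq> vone (org A e)"
      using False rep_eq_one_iff[OF e a(1)] by (auto simp: pops_def)
    with False r e a show ?thesis by (simp add: edge_step_def state_at_def rep_rep)
  qed
qed

lemma vmult_state: "state_at u (w, a) \<Longrightarrow> b \<in> vcarrier u \<Longrightarrow> state_at u (w, vmult u a b)"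
  using state_at_vert[of u "(w, a)"] by (auto simp: state_at_def)

lemma run_state: "is_apath A u p v \<Longrightarrow> state_at u st \<Longrightarrow> state_at v (run st p)"
proof -
  obtain b xs where p: "p = (b, xs)" by force
  assume "is_apath A u p v" "state_at u st"
  then show ?thesis unfolding p run_def fst_conv snd_conv
  proof (induction xs arbitrary: u b st)
    case Nil
    then show ?case using vmult_state[of u "fst st" "snd st" b] by (auto simp: is_apath_Nil state_at_def)
  next
    case (Cons x xs)
    obtain e c where x: "x = (e, c)" by force
    have e: "b \<in> vcarrier u" "e \<in> gedges A" "u = org A e" "is_apath A (trg A e) (c, xs) v"
      using Cons.prems(1) by (auto simp: x is_apath_Cons)
    have "state_at (org A e) (fst st, vmult (org A e) (snd st) b)"
      using vmult_state[of u "fst st" "snd st" b] Cons.prems(2) e by simp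
    from Cons.IH[OF e(4) edge_step_state[OF e(2) this]] show ?case by (simp add: x)
  qed
qed

lemma run_mult:
  assumes "is_apath A u p v" "is_apath A v q w" "state_at u st"
  shows "run st (path_mult A v p q) = run (run st p) q"
proof -
  obtain b xs where p: "p = (b, xs)" by force
  obtain c ys where q: "q = (c, ys)" by force
  show ?thesis using assms(1,3) unfolding p run_def fst_conv snd_conv
  proof (induction xs arbitrary: u b st)
    case Nil
    then have u: "u = v" "u \<in> gverts A" "b \<in> vcarrier u" by (auto simp: is_apath_Nil)
    interpret group "vgroup A v" using u vgroup by simp
    have st: "word_end (fst st) = u" "snd st \<in> vcarrier u" using Nil by (auto simp: state_at_def)
    have c: "c \<in> vcarrier u" using assms(2) u by (simp add: q is_apath_def)
    have assoc: "vmult u (snd st) (vmult u b c) = vmult u (vmult u (snd st) b) c"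
      using st c u by (simp add: m_assoc)
    have "run_list st (vmult u b c) ys = run_list (fst st, vmult u (snd st) b) c ys"
    proof (cases ys)
      case (Cons y ys')
      obtain e d where y: "y = (e, d)" by force
      have "u = org A e" using assms(2) u by (auto simp: q Cons y is_apath_Cons)
      then show ?thesis using assoc by (simp add: Cons y)
    qed (use st assoc in simp)
    then show ?case using u st by (simp add: q)
  next
    case (Cons x xs)
    obtain e d where x: "x = (e, d)" by force
    have e: "b \<in> vcarrier u" "e \<in> gedges A" "u = org A e" "is_apath A (trg A e) (d, xs) v"
      using Cons.prems(1) by (auto simp: x is_apath_Cons)
    have "state_at (org A e) (fst st, vmult (org A e) (snd st) b)"
      using vmult_state[of u "fst st" "snd st" b] Cons.prems(2) e by simp
    from Cons.IH[OF e(4) edge_step_state[OF e(2) this]] show ?case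
      by (cases "path_mult A v (d, xs) q") (simp add: x)
  qed
qed

text \<open>
  Going along \<open>e\<close> and back: if the first step is recorded, the second cancels it; if the first
  cancels the last edge of the word, normality of the word prevents a second cancellation, and the
  second step restores that edge.
\<close>

lemma run_base:
  assumes e: "e \<in> gedges A" and x: "x \<in> ecarrier e" and st: "state_at (org A e) (w, a)"
  shows "run (w, a) (vone (org A e), [(e, omega A e x), (einv A e, vone (org A e))]) = run (w, a) (alpha A e x, [])"
proof -
  let ?f = "einv A e"
  have f: "?f \<in> gedges A" "org A ?f = trg A e" "trg A ?f = org A e" "ecarrier ?f = ecarrier e" "egroup A ?f = egroup A e"
    using e by (auto simp: egroup_inv)
  have om: "omega A e = alpha A ?f" "omega A ?f = alpha A e" by (auto simp: omega_def)
  interpret G: group "vgroup A (org A e)" using e by (intro vgroup) auto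
  interpret T: group "vgroup A (trg A e)" using e by (intro vgroup) auto
  interpret E: group "egroup A e" using e by (rule egroup)
  interpret \<omega>: group_hom "egroup A e" "vgroup A (trg A e)" "omega A e" using e by (rule omega_hom)
  interpret \<alpha>: group_hom "egroup A e" "vgroup A (org A e)" "alpha A e" using e by (rule alpha_hom)
  have a: "a \<in> vcarrier (org A e)" "normal_word w" "word_end w = org A e" using st by (auto simp: state_at_def)
  define y where "y = rest e a"
  have y: "y \<in> ecarrier e" "a = vmult (org A e) (rep e a) (alpha A e y)" using rest[OF e a(1)] by (auto simp: y_def)
  define st1 where "st1 = edge_step e (w, a)"
  have st1: "state_at (trg A e) st1" unfolding st1_def using e st by (rule edge_step_state)
  have end1: "word_end (fst st1) = trg A e" using st1 by (simp add: state_at_def)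
  define st2 where "st2 = edge_step ?f (fst st1, vmult (trg A e) (snd st1) (omega A e x))"
  have st2: "state_at (org A e) st2"
    unfolding st2_def f(3)[symmetric]
    using f(1,2) st1 x vmult_state[of "trg A e" "fst st1" "snd st1" "omega A e x"] by (intro edge_step_state) auto
  have lhs: "run (w, a) (vone (org A e), [(e, omega A e x), (?f, vone (org A e))]) = (fst st2, snd st2)"
    using a st2 f st1 x by (simp add: run_def st1_def[symmetric] st2_def[symmetric] state_at_def)
  have "st2 = (w, vmult (org A e) a (alpha A e x))"
  proof (cases "pops e w a")
    case True
    then obtain s w' where w: "w = (s, ?f) # w'" by (cases w) (auto simp: pops_def)
    have s: "s \<in> vcarrier (trg A e)" "rep ?f s = s" "normal_word w'" "word_end w' = trg A e"
      "w' \<noteq> [] \<longrightarrow> snd (hd w') = e \<longrightarrow> s \<noteq> vone (trg A e)"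
      using a(2) f by (auto simp: w)
    have 1: "st1 = (w', vmult (trg A e) s (omega A e y))" using True by (simp add: st1_def edge_step_def w y_def)
    let ?b = "vmult (trg A e) (vmult (trg A e) s (omega A e y)) (omega A e x)"
    have b: "?b = vmult (org A ?f) s (alpha A ?f (y \<otimes>\<^bsub>egroup A e\<^esub> x))"
      using s y x f by (simp add: om[symmetric] T.m_assoc)
    have rs: "rest ?f s = \<one>\<^bsub>egroup A e\<^esub>"
      using s f alpha_one[OF f(1)] by (intro rest_unique) (auto simp: E.one_closed)
    have "rep ?f ?b = s" "rest ?f ?b = y \<otimes>\<^bsub>egroup A e\<^esub> x"
      unfolding b using rep_mult[OF f(1), of s] rest_mult[OF f(1), of s] s f y x rs by simp_all
    moreover have "\<not> pops ?f w' ?b"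
    proof
      assume p: "pops ?f w' ?b"
      then have "rep ?f ?b = vone (trg A e)" using f by (simp add: pops_def rep_def)
      with \<open>rep ?f ?b = s\<close> s(5) p show False by (simp add: pops_def)
    qed
    ultimately have "st2 = ((s, ?f) # w', omega A ?f (y \<otimes>\<^bsub>egroup A e\<^esub> x))"
      by (simp add: st2_def 1 edge_step_def)
    moreover have "a \<in> edge_image A e" using True by (simp add: pops_def)
    then have "a = alpha A e y" using y rep_one[OF e] by simp
    ultimately show ?thesis using y(1) x by (simp add: w om)
  next
    case False
    then have 1: "st1 = ((rep e a, e) # w, omega A e y)" by (simp add: st1_def edge_step_def y_def)
    let ?b = "vmult (trg A e) (omega A e y) (omega A e x)"
    have b: "?b = alpha A ?f (y \<otimes>\<^bsub>egroup A e\<^esub> x)" using y x by (simp add: om[symmetric])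
    have bE: "?b \<in> edge_image A ?f" unfolding b edge_image_def using y x f by simp
    have "rest ?f ?b = y \<otimes>\<^bsub>egroup A e\<^esub> x"
      using rep_one[OF f(1) bE] f y x \<omega>.hom_closed by (intro rest_unique[OF f(1)]) (auto simp: b[symmetric] om[symmetric])
    moreover have "pops ?f (fst st1) ?b" using bE by (simp add: pops_def 1)
    ultimately have "st2 = (w, vmult (org A e) (rep e a) (alpha A e (y \<otimes>\<^bsub>egroup A e\<^esub> x)))"
      using f by (simp add: st2_def 1 edge_step_def om)
    moreover have "vmult (org A e) (rep e a) (alpha A e (y \<otimes>\<^bsub>egroup A e\<^esub> x)) =
        vmult (org A e) (vmult (org A e) (rep e a) (alpha A e y)) (alpha A e x)"
      using y(1) x e a(1) by (simp add: G.m_assoc)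
    ultimately show ?thesis using y(2) by simp
  qed
  moreover have "run (w, a) (alpha A e x, []) = (w, vmult (org A e) a (alpha A e x))"
    using a by (simp add: run_def)
  ultimately show ?thesis unfolding lhs by simp
qed

lemma run_cong: "path_cong A u v p q \<Longrightarrow> state_at u st \<Longrightarrow> run st p = run st q"
proof (induction arbitrary: st rule: path_cong.induct)
  case (base e x)
  then show ?case using run_base[of e x "fst st" "snd st"] by simp
next
  case (mult u v p p' w q q')
  have p: "is_apath A u p v" "is_apath A u p' v" "is_apath A v q w" "is_apath A v q' w"
    using path_cong_is_apath mult.hyps by blast+
  have "state_at v (run st p')" using p(2) mult.prems by (rule run_state)
  then show ?case using mult.IH mult.prems p by (simp add: run_mult)
qed auto

subsection \<open>Uniqueness of normal forms\<close>

fun state_path :: "('a \<times> 'e) list \<Rightarrow> 'a \<Rightarrow> ('e, 'a) apath" where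
  "state_path [] a = (a, [])"
| "state_path ((s, e) # w) a = path_mult A (org A e) (state_path w s) (vone (org A e), [(e, a)])"

lemma edge_apath: "e \<in> gedges A \<Longrightarrow> a \<in> vcarrier (org A e) \<Longrightarrow> b \<in> vcarrier (trg A e) \<Longrightarrow>
    is_apath A (org A e) (a, [(e, b)]) (trg A e)"
  by (simp add: is_apath_Cons is_apath_Nil)

lemma state_path_apath: "state_at u (w, a) \<Longrightarrow> is_apath A u0 (state_path w a) u"
proof (induction w arbitrary: a u rule: normal_word.induct)
  case 1
  then show ?case using u0 by (auto simp: state_at_def is_apath_Nil)
next
  case (2 s e w)
  then have e: "e \<in> gedges A" "u = trg A e" "a \<in> vcarrier u" "state_at (org A e) (w, s)" by (auto simp: state_at_def)
  then have "is_apath A (org A e) (vone (org A e), [(e, a)]) u" using edge_apath by simp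
  then show ?case using is_apath_mult[OF 2(1)[OF e(4)]] by simp
qed

abbreviation root_state :: "('a \<times> 'e) list \<times> 'a" where
  "root_state \<equiv> ([], vone u0)"

lemma root_state: "state_at u0 root_state"
  by (simp add: state_at_def u0)

lemma run_state_path: "state_at u (w, a) \<Longrightarrow> run root_state (state_path w a) = (w, a)"
proof (induction w arbitrary: a u rule: normal_word.induct)
  case 1
  interpret group "vgroup A u0" using u0 by (rule vgroup)
  have "a \<in> vcarrier u0" using 1 by (auto simp: state_at_def)
  then show ?case by (simp add: run_def)
next
  case (2 s e w)
  then have e: "e \<in> gedges A" "u = trg A e" "a \<in> vcarrier u" "state_at (org A e) (w, s)" "rep e s = s"
    "s \<in> vcarrier (org A e)" "w \<noteq> [] \<longrightarrow> snd (hd w) = einv A e \<longrightarrow> s \<noteq> vone (org A e)"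
    by (auto simp: state_at_def)
  interpret G: group "vgroup A (org A e)" using e by (intro vgroup) auto
  interpret T: group "vgroup A (trg A e)" using e by (intro vgroup) auto
  have step: "is_apath A (org A e) (vone (org A e), [(e, a)]) u" using e edge_apath by simp
  have "run root_state (state_path ((s, e) # w) a) = run (w, s) (vone (org A e), [(e, a)])"
    using run_mult[OF state_path_apath[OF e(4)] step root_state] 2(1)[OF e(4)] by simp
  moreover have np: "\<not> pops e w s" using e rep_eq_one_iff[OF e(1,6)] by (auto simp: pops_def)
  have "rest e s = \<one>\<^bsub>egroup A e\<^esub>"
    using e alpha_one[OF e(1)] egroup[OF e(1)] by (intro rest_unique) (auto simp: group.is_monoid monoid.one_closed)
  then have "omega A e (rest e s) = vone (trg A e)"
    using e alpha_one[of "einv A e"] by (simp add: omega_def egroup_inv)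
  ultimately show ?case using e np by (simp add: run_def edge_step_def)
qed

lemma state_path_mult:
  "state_at u (w, a) \<Longrightarrow> b \<in> vcarrier u \<Longrightarrow> path_mult A u (state_path w a) (b, []) = state_path w (vmult u a b)"
proof (cases w rule: normal_word.cases)
  case (2 s e w')
  assume st: "state_at u (w, a)" and b: "b \<in> vcarrier u"
  then have e: "e \<in> gedges A" "u = trg A e" "a \<in> vcarrier u" "state_at (org A e) (w', s)"
    by (auto simp: state_at_def 2)
  have 1: "is_apath A (org A e) (vone (org A e), [(e, a)]) u" using e edge_apath by simp
  have 3: "is_apath A u (b, []) u" using b e by (simp add: is_apath_Nil)
  show ?thesis using path_mult_assoc[OF state_path_apath[OF e(4)] 1 3] e by (simp add: 2)
qed (auto simp: state_at_def)

lemma path_cong_trans_mult: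
  "path_cong A u v p p' \<Longrightarrow> is_apath A v q w \<Longrightarrow> path_cong A u w (path_mult A v p q) (path_mult A v p' q)"
  "is_apath A u p v \<Longrightarrow> path_cong A v w q q' \<Longrightarrow> path_cong A u w (path_mult A v p q) (path_mult A v p q')"
  by (auto intro: path_cong.mult path_cong.refl)

lemma slide:
  assumes e: "e \<in> gedges A" and x: "x \<in> ecarrier e"
  shows "path_cong A (org A e) (trg A e) (alpha A e x, [(e, vone (trg A e))]) (vone (org A e), [(e, omega A e x)])"
proof -
  let ?f = "einv A e"
  have f: "?f \<in> gedges A" "org A ?f = trg A e" "trg A ?f = org A e" using e by auto
  interpret G: group "vgroup A (org A e)" using e by (intro vgroup) auto
  interpret T: group "vgroup A (trg A e)" using e by (intro vgroup) auto
  have c: "alpha A e x \<in> vcarrier (org A e)" "omega A e x \<in> vcarrier (trg A e)"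
    using e x by (auto intro: alpha_closed omega_closed)
  let ?e = "(vone (org A e), [(e, vone (trg A e))])"
  have pe: "is_apath A (org A e) ?e (trg A e)" using e edge_apath by simp
  have "path_cong A (org A e) (trg A e)
     (path_mult A (org A e) (vone (org A e), [(e, omega A e x), (?f, vone (org A e))]) ?e)
     (path_mult A (org A e) (alpha A e x, []) ?e)"
    using path_cong.base[OF e x] pe by (rule path_cong_trans_mult)
  then have 1: "path_cong A (org A e) (trg A e)
     (vone (org A e), [(e, omega A e x), (?f, vone (org A e)), (e, vone (trg A e))]) (alpha A e x, [(e, vone (trg A e))])"
    using c by simp
  have b: "path_cong A (trg A e) (trg A e) (vone (trg A e), [(?f, vone (org A e)), (e, vone (trg A e))]) (vone (trg A e), [])"
    using path_cong.base[OF f(1), of "\<one>\<^bsub>egroup A ?f\<^esub>"] alpha_one[OF f(1)] alpha_one[OF e] egroup[OF f(1)] f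
    by (simp add: omega_def egroup_inv[OF e] group.is_monoid monoid.one_closed)
  have px: "is_apath A (org A e) (vone (org A e), [(e, omega A e x)]) (trg A e)" using e c edge_apath by simp
  have "path_cong A (org A e) (trg A e)
     (path_mult A (trg A e) (vone (org A e), [(e, omega A e x)]) (vone (trg A e), [(?f, vone (org A e)), (e, vone (trg A e))]))
     (path_mult A (trg A e) (vone (org A e), [(e, omega A e x)]) (vone (trg A e), []))"
    using px b by (rule path_cong_trans_mult)
  then have 2: "path_cong A (org A e) (trg A e)
     (vone (org A e), [(e, omega A e x), (?f, vone (org A e)), (e, vone (trg A e))]) (vone (org A e), [(e, omega A e x)])"
    using c by simp
  show ?thesis using path_cong.sym[OF 1] 2 by (rule path_cong.trans)
qed

text \<open>
  The action of an edge on states is realised by congruences, either \<open>\<alpha>\<^sub>e(x) e = e \<omega>\<^sub>e(x)\<close> or the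
  defining congruence for the inverse edge.
\<close>

lemma state_path_step:
  assumes e: "e \<in> gedges A" and st: "state_at (org A e) (w, a)"
  shows "path_cong A u0 (trg A e) (path_mult A (org A e) (state_path w a) (vone (org A e), [(e, vone (trg A e))]))
    (case_prod state_path (edge_step e (w, a)))"
proof -
  let ?e = "(vone (org A e), [(e, vone (trg A e))])"
  have a: "a \<in> vcarrier (org A e)" "normal_word w" "word_end w = org A e" using st by (auto simp: state_at_def)
  interpret G: group "vgroup A (org A e)" using e by (intro vgroup) auto
  interpret T: group "vgroup A (trg A e)" using e by (intro vgroup) auto
  define x where "x = rest e a"
  have x: "x \<in> ecarrier e" "a = vmult (org A e) (rep e a) (alpha A e x)" using rest[OF e a(1)] by (auto simp: x_def)
  have c: "alpha A e x \<in> vcarrier (org A e)" "omega A e x \<in> vcarrier (trg A e)"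
    using e x(1) by (auto intro: alpha_closed omega_closed)
  have pe: "is_apath A (org A e) ?e (trg A e)" using e edge_apath by simp
  show ?thesis
  proof (cases "pops e w a")
    case True
    let ?f = "einv A e"
    have f: "?f \<in> gedges A" "org A ?f = trg A e" "trg A ?f = org A e" using e by auto
    obtain s w' where w: "w = (s, ?f) # w'" using True by (cases w) (auto simp: pops_def)
    have s: "state_at (trg A e) (w', s)" using a(2) f by (auto simp: w state_at_def)
    have "a \<in> edge_image A e" using True by (simp add: pops_def)
    then have ax: "a = alpha A e x" using x c rep_one[OF e] by simp
    have 1: "is_apath A (trg A e) (vone (trg A e), [(?f, a)]) (org A e)" using f a edge_apath[OF f(1)] by simp
    have "path_mult A (org A e) (state_path w a) ?e =
       path_mult A (trg A e) (state_path w' s) (path_mult A (org A e) (vone (trg A e), [(?f, a)]) ?e)"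
      using path_mult_assoc[OF state_path_apath[OF s] 1 pe] f by (simp add: w)
    moreover have "path_cong A (trg A e) (trg A e) (path_mult A (org A e) (vone (trg A e), [(?f, a)]) ?e) (omega A e x, [])"
      using path_cong.base[OF f(1), of x] f x(1) c unfolding ax by (simp add: omega_def egroup_inv[OF e])
    ultimately have "path_cong A u0 (trg A e) (path_mult A (org A e) (state_path w a) ?e)
       (path_mult A (trg A e) (state_path w' s) (omega A e x, []))"
      using path_cong_trans_mult(2)[OF state_path_apath[OF s]] by simp
    then show ?thesis using True state_path_mult[OF s c(2)] by (simp add: edge_step_def w x_def)
  next
    case False
    define s where "s = rep e a"
    have s: "state_at (org A e) (w, s)" using a e by (simp add: s_def state_at_def)
    have xa: "is_apath A (org A e) (alpha A e x, []) (org A e)" using c e by (simp add: is_apath_Nil)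
    have "path_mult A (org A e) (state_path w a) ?e = path_mult A (org A e) (state_path w s) (path_mult A (org A e) (alpha A e x, []) ?e)"
      using path_mult_assoc[OF state_path_apath[OF s] xa pe] state_path_mult[OF s c(1)] x(2) by (simp add: s_def)
    also have "path_mult A (org A e) (alpha A e x, []) ?e = (alpha A e x, [(e, vone (trg A e))])" using c by simp
    finally have "path_cong A u0 (trg A e) (path_mult A (org A e) (state_path w a) ?e)
       (path_mult A (org A e) (state_path w s) (vone (org A e), [(e, omega A e x)]))"
      using path_cong_trans_mult(2)[OF state_path_apath[OF s] slide[OF e x(1)]] by simp
    then show ?thesis using False by (simp add: edge_step_def x_def s_def)
  qed
qed

lemma state_path_run:
  "is_apath A u p v \<Longrightarrow> state_at u st \<Longrightarrow>
    path_cong A u0 v (path_mult A u (case_prod state_path st) p) (case_prod state_path (run st p))"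
proof -
  obtain b xs where p: "p = (b, xs)" by force
  assume "is_apath A u p v" "state_at u st"
  then show ?thesis unfolding p run_def fst_conv snd_conv
  proof (induction xs arbitrary: u b st)
    case Nil
    then have u: "u = v" "b \<in> vcarrier u" "word_end (fst st) = u" by (auto simp: is_apath_Nil state_at_def)
    have "path_mult A u (case_prod state_path st) (b, []) = state_path (fst st) (vmult u (snd st) b)"
      using state_path_mult[of u "fst st" "snd st" b] Nil(2) u(2) by (simp add: case_prod_beta)
    moreover have "is_apath A u0 (state_path (fst st) (vmult u (snd st) b)) u"
      using state_path_apath vmult_state[of u "fst st" "snd st" b] Nil(2) u(2) by simp
    ultimately show ?case using u by (simp add: path_cong.refl)
  next
    case (Cons x xs)
    obtain e d where x: "x = (e, d)" by force
    have e: "b \<in> vcarrier u" "e \<in> gedges A" "u = org A e" "is_apath A (trg A e) (d, xs) v"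
      using Cons.prems(1) by (auto simp: x is_apath_Cons)
    interpret G: group "vgroup A (org A e)" using e by (intro vgroup) auto
    interpret T: group "vgroup A (trg A e)" using e by (intro vgroup) auto
    have d: "d \<in> vcarrier (trg A e)" using e(4) by (simp add: is_apath_def)
    let ?st = "(fst st, vmult (org A e) (snd st) b)" and ?e = "(vone (org A e), [(e, vone (trg A e))])"
    have st: "state_at (org A e) ?st"
      using vmult_state[of u "fst st" "snd st" b] Cons.prems(2) e by simp
    have pe: "is_apath A (org A e) ?e (trg A e)" using e edge_apath by simp
    have pb: "is_apath A (org A e) (b, []) (org A e)" using e by (simp add: is_apath_Nil)
    have ps: "is_apath A u0 (case_prod state_path st) u"
      using state_path_apath Cons.prems(2) by (simp add: case_prod_beta)
    have "(b, x # xs) = path_mult A (org A e) (b, []) (path_mult A (trg A e) ?e (d, xs))"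
      using e(1,3) d by (simp add: x)
    then have "path_mult A u (case_prod state_path st) (b, x # xs) =
       path_mult A (trg A e) (path_mult A (org A e) (path_mult A u (case_prod state_path st) (b, [])) ?e) (d, xs)"
      using path_mult_assoc[OF ps _ is_apath_mult[OF pe e(4)]] pb pe e
        path_mult_assoc[OF is_apath_mult[OF ps] pe e(4)] by simp
    also have "path_mult A u (case_prod state_path st) (b, []) = case_prod state_path ?st"
      using state_path_mult[of u "fst st" "snd st" b] Cons.prems(2) e by (simp add: case_prod_beta)
    finally have eq: "path_mult A u (case_prod state_path st) (b, x # xs) =
       path_mult A (trg A e) (path_mult A (org A e) (case_prod state_path ?st) ?e) (d, xs)" .
    have "path_cong A u0 v \<dots> (path_mult A (trg A e) (case_prod state_path (edge_step e ?st)) (d, xs))"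
      using state_path_step[OF e(2) st] e(4) by (simp add: path_cong_trans_mult(1))
    moreover have "path_cong A u0 v (path_mult A (trg A e) (case_prod state_path (edge_step e ?st)) (d, xs))
       (case_prod state_path (run_list (edge_step e ?st) d xs))"
      using Cons.IH[OF e(4) edge_step_state[OF e(2) st]] .
    ultimately show ?case unfolding eq by (simp add: x) (rule path_cong.trans)
  qed
qed

definition nf :: "('e, 'a) apath \<Rightarrow> ('a \<times> 'e) list \<times> 'a" where
  "nf p = run root_state p"

lemma nf_state: "is_apath A u0 p u \<Longrightarrow> state_at u (nf p)"
  unfolding nf_def using root_state by (rule run_state[rotated])

lemma nf_cong: "is_apath A u0 p u \<Longrightarrow> path_cong A u0 u p (case_prod state_path (nf p))"
  using state_path_run[OF _ root_state, of p u] path_mult_one[of u0 p u] by (simp add: nf_def)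

text \<open>
  A path is congruent to the path of its normal form, and congruent paths act in the same way on
  states, in particular on the empty one.
\<close>

theorem path_cong_iff_nf:
  assumes "is_apath A u0 p u" "is_apath A u0 q u"
  shows "path_cong A u0 u p q \<longleftrightarrow> nf p = nf q"
proof
  assume "path_cong A u0 u p q"
  then show "nf p = nf q" unfolding nf_def using root_state by (rule run_cong)
next
  assume "nf p = nf q"
  then show "path_cong A u0 u p q"
    using nf_cong[OF assms(1)] path_cong.sym[OF nf_cong[OF assms(2)]] path_cong.trans by metis
qed

lemma nf_mult:
  "is_apath A u0 p u \<Longrightarrow> is_apath A u q v \<Longrightarrow> nf (path_mult A u p q) = run (nf p) q"
  unfolding nf_def using root_state by (intro run_mult)

end

section \<open>Trees of words\<close>

definition list_adj :: "'x list set \<Rightarrow> ('x list \<times> 'x list) set" where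
  "list_adj V = {(w, w'). w \<in> V \<and> w' \<in> V \<and> (\<exists>x. w' = x # w \<or> w = x # w')}"

text \<open>
  A word has only one shorter neighbour, its tail. So a reduced walk that has ascended never descends
  again.
\<close>

lemma ascending_walk:
  "walk (list_adj V) (a # b # ys) \<Longrightarrow> no_backtrack (a # b # ys) \<Longrightarrow> b = x # a \<Longrightarrow> \<exists>zs. last (b # ys) = zs @ b"
proof (induction ys arbitrary: a b x)
  case (Cons c ys)
  then have "c \<noteq> a" "(b, c) \<in> list_adj V" by auto
  then obtain y where c: "c = y # b" using Cons.prems(3) by (auto simp: list_adj_def)
  then obtain zs where "last (c # ys) = zs @ c" using Cons.IH[of b c y] Cons.prems by auto
  then show ?case using c by (intro exI[of _ "zs @ [y]"]) simp
qed simp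

text \<open>
  A reduced walk starting downwards either descends all the way, or turns to another branch, where
  the words at its two ends differ in the letter following the turning point.
\<close>

lemma descending_walk:
  "walk (list_adj V) (a # b # ys) \<Longrightarrow> no_backtrack (a # b # ys) \<Longrightarrow> a = x # b \<Longrightarrow>
    (\<exists>us. us \<noteq> [] \<and> a = us @ last (b # ys)) \<or>
    (\<exists>us y w z zs. y \<noteq> z \<and> a = us @ y # w \<and> last (b # ys) = zs @ z # w)"
proof (induction ys arbitrary: a b x)
  case Nil
  then show ?case by (intro disjI1 exI[of _ "[x]"]) simp
next
  case (Cons c ys)
  then have c: "c \<noteq> a" "(b, c) \<in> list_adj V" by auto
  show ?case
  proof (cases "\<exists>z. c = z # b")
    case True
    then obtain z where z: "c = z # b" by blast
    then obtain zs where "last (c # ys) = zs @ c" using ascending_walk[of V b c ys z] Cons.prems by auto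
    moreover have "x \<noteq> z" using c z Cons.prems(3) by auto
    ultimately show ?thesis using z Cons.prems(3)
      by (intro disjI2 exI[of _ "[]"] exI[of _ x] exI[of _ b] exI[of _ z] exI[of _ zs]) simp
  next
    case False
    then obtain y where "b = y # c" using c by (auto simp: list_adj_def)
    from Cons.IH[OF _ _ this] Cons.prems
    consider us where "us \<noteq> []" "b = us @ last (c # ys)"
      | us y w z zs where "y \<noteq> z" "b = us @ y # w" "last (c # ys) = zs @ z # w" by auto
    then show ?thesis
    proof cases
      case (1 us)
      then show ?thesis using Cons.prems(3) by (intro disjI1 exI[of _ "x # us"]) simp
    next
      case (2 us y w z zs)
      then show ?thesis using Cons.prems(3)
        by (intro disjI2 exI[of _ "x # us"] exI[of _ y] exI[of _ w] exI[of _ z] exI[of _ zs]) simp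
    qed
  qed
qed

lemma tree_list_adj:
  assumes nil: "[] \<in> V" and tl: "\<And>x w. x # w \<in> V \<Longrightarrow> w \<in> V"
  shows "tree V (list_adj V)"
proof
  show "list_adj V \<subseteq> V \<times> V" by (auto simp: list_adj_def)
  show sym: "sym (list_adj V)" by (auto simp: list_adj_def sym_def)
  have root: "(w, []) \<in> (list_adj V)\<^sup>*" if "w \<in> V" for w
    using that
  proof (induction w)
    case (Cons x w)
    then have "(x # w, w) \<in> list_adj V" using tl by (auto simp: list_adj_def)
    then show ?case using Cons tl by (meson converse_rtrancl_into_rtrancl)
  qed simp
  show "(x, y) \<in> (list_adj V)\<^sup>*" if "x \<in> V" "y \<in> V" for x y
    using root[OF that(1)] root[OF that(2)] sym_rtrancl[OF sym] by (meson rtrancl_trans symD)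
  fix xs assume xs: "walk (list_adj V) xs" "no_backtrack xs" "hd xs = last xs"
  show "length xs = 1"
  proof (rule ccontr)
    assume "length xs \<noteq> 1"
    then obtain a b ys where abys: "xs = a # b # ys" using xs(1) by (cases xs; cases "tl xs") auto
    have last: "last (b # ys) = a" using xs(3) abys by simp
    have "(a, b) \<in> list_adj V" using xs(1) abys by simp
    then consider x where "b = x # a" | x where "a = x # b" by (auto simp: list_adj_def)
    then show False
    proof cases
      case (1 x)
      then show False using ascending_walk[of V a b ys x] xs abys last by auto
    next
      case (2 x)
      from descending_walk[OF xs(1,2)[unfolded abys] 2] last
      consider us where "us \<noteq> []" "a = us @ a"
        | us y w z zs where "y \<noteq> z" "a = us @ y # w" "a = zs @ z # w" by auto
      then show False
      proof cases
        case (2 us y w z zs)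
        then have "(us @ [y]) @ w = (zs @ [z]) @ w" by simp
        with 2(1) show False by (simp only: append_same_eq) simp
      qed simp
    qed
  qed
qed

section \<open>The Bass-Serre tree\<close>

context based_graph_of_groups begin

abbreviation \<pi> where "\<pi> \<equiv> pi1 A u0"

definition edge_path :: "'e \<Rightarrow> ('e, 'a) apath" where
  "edge_path e = (vone (org A e), [(e, vone (trg A e))])"

definition append_edge :: "('e, 'a) apath \<Rightarrow> 'e \<Rightarrow> ('e, 'a) apath" where
  "append_edge p e = path_mult A (org A e) p (edge_path e)"

definition proj :: "('e, 'a) apath \<Rightarrow> ('a \<times> 'e) list" where
  "proj p = fst (nf p)"

definition tree_verts :: "('a \<times> 'e) list set" where
  "tree_verts = {w. normal_word w}"

text \<open>
  In this form invariance under left multiplication is clear; that adjacent words differ by one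
  letter is shown in \<open>tree_adj_eq\<close>.
\<close>

definition tree_adj :: "(('a \<times> 'e) list \<times> ('a \<times> 'e) list) set" where
  "tree_adj = {(proj p, proj (append_edge p e)) | p e. e \<in> gedges A \<and> is_apath A u0 p (org A e)}"

text \<open>
  Left multiplication of paths. The word is completed by the neutral element to a state and turned
  into a path; the result does not depend on the choice of \<open>q\<close>, see \<open>tree_act_class\<close>.
\<close>

definition tree_act :: "('e, 'a) apath set \<Rightarrow> ('a \<times> 'e) list \<Rightarrow> ('a \<times> 'e) list" where
  "tree_act g w = proj (path_mult A u0 (SOME q. q \<in> g) (state_path w (vone (word_end w))))"

lemma tree_adjI: "e \<in> gedges A \<Longrightarrow> is_apath A u0 p (org A e) \<Longrightarrow> (proj p, proj (append_edge p e)) \<in> tree_adj"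
  unfolding tree_adj_def by blast

lemma edge_path_apath: "e \<in> gedges A \<Longrightarrow> is_apath A (org A e) (edge_path e) (trg A e)"
  unfolding edge_path_def by (intro edge_apath) auto

lemma append_edge_apath: "e \<in> gedges A \<Longrightarrow> is_apath A u p (org A e) \<Longrightarrow> is_apath A u (append_edge p e) (trg A e)"
  unfolding append_edge_def by (rule is_apath_mult[OF _ edge_path_apath])

lemma vertex_apath: "u \<in> gverts A \<Longrightarrow> a \<in> vcarrier u \<Longrightarrow> is_apath A u (a, []) u"
  by (simp add: is_apath_Nil)

lemma run_vertex: "state_at u st \<Longrightarrow> run st (a, []) = (fst st, vmult u (snd st) a)"
  by (simp add: run_def state_at_def)

lemma nf_append_edge:
  assumes e: "e \<in> gedges A" and p: "is_apath A u0 p (org A e)"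
  shows "nf (append_edge p e) = edge_step e (nf p)"
proof -
  have st: "state_at (org A e) (nf p)" using p by (rule nf_state)
  interpret G: group "vgroup A (org A e)" using e by (intro vgroup) auto
  interpret T: group "vgroup A (trg A e)" using e by (intro vgroup) auto
  have st': "state_at (trg A e) (edge_step e (nf p))" using edge_step_state[OF e, of "fst (nf p)" "snd (nf p)"] st by simp
  have "run (nf p) (edge_path e) = edge_step e (nf p)"
    using st st' by (simp add: run_def edge_path_def state_at_def)
  then show ?thesis unfolding append_edge_def using nf_mult[OF p edge_path_apath[OF e]] by simp
qed

lemma proj_normal: "is_apath A u0 p u \<Longrightarrow> normal_word (proj p) \<and> word_end (proj p) = u"
  using nf_state[of p u] by (simp add: proj_def state_at_def)

lemma proj_in: "is_apath A u0 p u \<Longrightarrow> proj p \<in> tree_verts"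
  using proj_normal by (simp add: tree_verts_def)

lemma section_path:
  assumes "w \<in> tree_verts"
  shows "is_apath A u0 (state_path w (vone (word_end w))) (word_end w)"
    and "nf (state_path w (vone (word_end w))) = (w, vone (word_end w))"
    and "proj (state_path w (vone (word_end w))) = w"
proof -
  have w: "normal_word w" using assms by (simp add: tree_verts_def)
  have "state_at (word_end w) (w, vone (word_end w))" using w word_end_in[OF w] by (simp add: state_at_def)
  then show "is_apath A u0 (state_path w (vone (word_end w))) (word_end w)"
    "nf (state_path w (vone (word_end w))) = (w, vone (word_end w))"
    "proj (state_path w (vone (word_end w))) = w"
    using state_path_apath run_state_path by (auto simp: nf_def proj_def)
qed

lemma tree_verts_path:
  assumes "w \<in> tree_verts"
  obtains p u where "is_apath A u0 p u" "w = proj p"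
  using section_path[OF assms] by metis

lemma proj_cong: "path_cong A u0 u p q \<Longrightarrow> proj p = proj q"
  using path_cong_iff_nf path_cong_is_apath by (metis proj_def)

lemma proj_eq_iff:
  assumes p: "is_apath A u0 p u" and q: "is_apath A u0 q u'"
  shows "proj p = proj q \<longleftrightarrow> u = u' \<and> (\<exists>a\<in>vcarrier u. path_cong A u0 u q (path_mult A u p (a, [])))"
proof
  assume eq: "proj p = proj q"
  have st: "state_at u (nf p)" "state_at u' (nf q)" using p q by (auto intro: nf_state)
  have u: "u = u'" using eq st by (auto simp: proj_def state_at_def)
  interpret group "vgroup A u" using st(1) state_at_vert vgroup by blast
  define a where "a = vmult u (vinv u (snd (nf p))) (snd (nf q))"
  have a: "a \<in> vcarrier u" "vmult u (snd (nf p)) a = snd (nf q)"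
  proof -
    have "snd (nf p) \<in> vcarrier u" "snd (nf q) \<in> vcarrier u" using st u by (auto simp: state_at_def)
    then show "a \<in> vcarrier u" "vmult u (snd (nf p)) a = snd (nf q)" by (auto simp: a_def)
  qed
  have pa: "is_apath A u (a, []) u" using a(1) st(1) state_at_vert by (intro vertex_apath)
  have "nf (path_mult A u p (a, [])) = nf q"
    using nf_mult[OF p pa] run_vertex[OF st(1)] a(2) eq by (simp add: proj_def prod_eq_iff)
  then show "u = u' \<and> (\<exists>a\<in>vcarrier u. path_cong A u0 u q (path_mult A u p (a, [])))"
    using path_cong_iff_nf[OF q[folded u] is_apath_mult[OF p pa]] u a(1) by auto
next
  assume "u = u' \<and> (\<exists>a\<in>vcarrier u. path_cong A u0 u q (path_mult A u p (a, [])))"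
  then obtain a where a: "a \<in> vcarrier u" "path_cong A u0 u q (path_mult A u p (a, []))" by blast
  have st: "state_at u (nf p)" using p by (rule nf_state)
  then have "is_apath A u (a, []) u" using a(1) state_at_vert by (intro vertex_apath)
  then have "proj (path_mult A u p (a, [])) = proj p"
    using nf_mult[OF p] run_vertex[OF st] by (simp add: proj_def)
  then show "proj p = proj q" using proj_cong[OF a(2)] by simp
qed

text \<open>
  Both steps start from the same word. The edge can be recovered from the old and the new word, and
  then so can the coset of the group element.
\<close>

lemma edge_step_fst_eq_iff:
  assumes e: "e \<in> gedges A" "e' \<in> gedges A" and st: "state_at (org A e) (w, c)" "state_at (org A e') (w, c')"
  shows "fst (edge_step e (w, c)) = fst (edge_step e' (w, c')) \<longleftrightarrow>
    e = e' \<and> vmult (org A e) (vinv (org A e) c) c' \<in> edge_image A e"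
proof -
  have o: "org A e' = org A e" and c: "c \<in> vcarrier (org A e)" "c' \<in> vcarrier (org A e)"
    using st by (auto simp: state_at_def)
  interpret G: group "vgroup A (org A e)" using e by (intro vgroup) auto
  interpret E: subgroup "edge_image A e" "vgroup A (org A e)" using e(1) by (rule edge_image_subgroup)
  have mem: "c \<in> edge_image A e \<longleftrightarrow> c' \<in> edge_image A e"
    if d: "vmult (org A e) (vinv (org A e) c) c' \<in> edge_image A e" (is "?d \<in> _")
  proof -
    have "c' = vmult (org A e) c ?d" "c = vmult (org A e) c' (vinv (org A e) ?d)"
      using c by (auto simp: G.inv_mult_group G.m_assoc)
    then show ?thesis using d E.m_closed E.m_inv_closed by metis
  qed
  have len: "length (fst (edge_step f (w, d))) = (if pops f w d then length w - 1 else Suc (length w))" for f d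
    by (simp add: edge_step_def)
  have pne: "w \<noteq> []" if "pops f w d" for f d using that by (simp add: pops_def)
  show ?thesis
  proof (cases "pops e w c \<longleftrightarrow> pops e' w c'")
    case False
    have "length w - 1 \<noteq> Suc (length w)" by linarith
    then have "fst (edge_step e (w, c)) \<noteq> fst (edge_step e' (w, c'))"
      using False len[of e c] len[of e' c'] by (metis (full_types))
    moreover have "\<not> (e = e' \<and> vmult (org A e) (vinv (org A e) c) c' \<in> edge_image A e)"
      using False mem by (auto simp: pops_def)
    ultimately show ?thesis by blast
  next
    case same: True
    show ?thesis
    proof (cases "pops e w c")
      case True
      then have p: "pops e' w c'" using same by simp
      have "einv A e = einv A e'" using True p by (simp add: pops_def)
      then have "e = e'" by (metis arev_arev)
      moreover have "vmult (org A e) (vinv (org A e) c) c' \<in> edge_image A e"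
      proof -
        have "c \<in> edge_image A e" "c' \<in> edge_image A e" using True p \<open>e = e'\<close> by (auto simp: pops_def)
        then show ?thesis by simp
      qed
      ultimately show ?thesis using True p by (simp add: edge_step_def)
    next
      case False
      then have "fst (edge_step e (w, c)) = fst (edge_step e' (w, c')) \<longleftrightarrow> e = e' \<and> rep e c = rep e c'"
        using same by (auto simp: edge_step_def)
      then show ?thesis using rep_eq_iff[OF e(1) c] by simp
    qed
  qed
qed

lemma proj_append_edge_eq_iff:
  assumes e: "e \<in> gedges A" "e' \<in> gedges A" "org A e' = org A e"
    and p: "is_apath A u0 p (org A e)" and a: "a \<in> vcarrier (org A e)"
  shows "proj (append_edge (path_mult A (org A e) p (a, [])) e) = proj (append_edge p e') \<longleftrightarrow> e = e' \<and> a \<in> edge_image A e"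
proof -
  interpret G: group "vgroup A (org A e)" using e by (intro vgroup) auto
  interpret E: subgroup "edge_image A e" "vgroup A (org A e)" using e(1) by (rule edge_image_subgroup)
  obtain w c where wc: "nf p = (w, c)" by force
  have st: "state_at (org A e) (w, c)" using nf_state[OF p] wc by simp
  then have c: "c \<in> vcarrier (org A e)" by (simp add: state_at_def)
  have pa: "is_apath A (org A e) (a, []) (org A e)" using e a by (intro vertex_apath) auto
  have nfa: "nf (path_mult A (org A e) p (a, [])) = (w, vmult (org A e) c a)"
    using nf_mult[OF p pa] run_vertex[OF st] wc by simp
  have st2: "state_at (org A e) (w, vmult (org A e) c a)" using st a by (rule vmult_state)
  have "proj (append_edge (path_mult A (org A e) p (a, [])) e) = fst (edge_step e (w, vmult (org A e) c a))"
    using nf_append_edge[OF e(1) is_apath_mult[OF p pa]] nfa by (simp add: proj_def)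
  moreover have "proj (append_edge p e') = fst (edge_step e' (w, c))"
    using nf_append_edge[OF e(2)] p e(3) wc by (simp add: proj_def)
  moreover have "vmult (org A e) (vinv (org A e) (vmult (org A e) c a)) c = vinv (org A e) a"
    using a c by (simp add: G.inv_mult_group G.m_assoc)
  moreover have "vinv (org A e) a \<in> edge_image A e \<longleftrightarrow> a \<in> edge_image A e"
    using E.m_inv_closed[of a] E.m_inv_closed[of "vinv (org A e) a"] a by auto
  ultimately show ?thesis using edge_step_fst_eq_iff[OF e(1,2) st2, of c] st e(3) by simp
qed

lemma tree_adj_eq: "tree_adj = list_adj tree_verts"
proof (intro equalityI subrelI)
  fix x y assume "(x, y) \<in> tree_adj"
  then obtain p e where e: "e \<in> gedges A" "is_apath A u0 p (org A e)" "x = proj p" "y = proj (append_edge p e)"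
    by (auto simp: tree_adj_def)
  obtain w c where wc: "nf p = (w, c)" by force
  have "x = w" "y = fst (edge_step e (w, c))" using e wc nf_append_edge[OF e(1,2)] by (simp_all add: proj_def)
  moreover have "\<exists>z. fst (edge_step e (w, c)) = z # w \<or> w = z # fst (edge_step e (w, c))"
    by (cases w) (auto simp: edge_step_def pops_def)
  moreover have "x \<in> tree_verts" "y \<in> tree_verts" using proj_in[OF e(2)] proj_in[OF append_edge_apath[OF e(1,2)]] e(3,4) by simp_all
  ultimately show "(x, y) \<in> list_adj tree_verts" by (auto simp: list_adj_def)
next
  fix x y assume "(x, y) \<in> list_adj tree_verts"
  then have V: "x \<in> tree_verts" "y \<in> tree_verts" and "\<exists>z. y = z # x \<or> x = z # y" by (auto simp: list_adj_def)
  then obtain s e where "y = (s, e) # x \<or> x = (s, e) # y" by auto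
  then show "(x, y) \<in> tree_adj"
  proof
    assume y: "y = (s, e) # x"
    then have e: "e \<in> gedges A" "state_at (org A e) (x, s)" "rep e s = s" "x \<noteq> [] \<longrightarrow> snd (hd x) = einv A e \<longrightarrow> s \<noteq> vone (org A e)"
      using V by (auto simp: tree_verts_def state_at_def)
    have s: "s \<in> vcarrier (org A e)" using e by (simp add: state_at_def)
    let ?p = "state_path x s"
    have p: "is_apath A u0 ?p (org A e)" "nf ?p = (x, s)" using e state_path_apath run_state_path by (auto simp: nf_def)
    have "\<not> pops e x s" using e rep_eq_one_iff[OF e(1) s] by (auto simp: pops_def)
    then have "proj (append_edge ?p e) = y" using nf_append_edge[OF e(1) p(1)] p(2) e(3) y by (simp add: proj_def edge_step_def)
    moreover have "proj ?p = x" using p by (simp add: proj_def)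
    ultimately show ?thesis using tree_adjI[OF e(1) p(1)] by simp
  next
    assume x: "x = (s, e) # y"
    then have e: "e \<in> gedges A" "trg A e = word_end x" using V by (auto simp: tree_verts_def)
    let ?f = "einv A e" and ?p = "state_path x (vone (word_end x))"
    have f: "?f \<in> gedges A" "org A ?f = word_end x" using e by auto
    have p: "is_apath A u0 ?p (org A ?f)" "nf ?p = (x, vone (word_end x))" "proj ?p = x"
      using section_path[OF V(1)] f by auto
    interpret E: subgroup "edge_image A ?f" "vgroup A (org A ?f)" using f(1) by (rule edge_image_subgroup)
    have "pops ?f x (vone (word_end x))" using E.one_closed f by (simp add: pops_def x)
    then have "proj (append_edge ?p ?f) = y" using nf_append_edge[OF f(1) p(1)] p(2) by (simp add: proj_def edge_step_def x)
    then show ?thesis using tree_adjI[OF f(1) p(1)] p(3) by simp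
  qed
qed

subsection \<open>The action\<close>

lemma carrier_pi1: "g \<in> carrier \<pi> \<longleftrightarrow> (\<exists>q. is_apath A u0 q u0 \<and> g = path_class A u0 q)"
  by (auto simp: pi1_def)

lemma one_pi1: "\<one>\<^bsub>\<pi>\<^esub> = path_class A u0 (vone u0, [])"
  by (simp add: pi1_def)

lemma path_inv_cong_right:
  assumes p: "is_apath A u p v"
  shows "path_cong A u u (path_mult A v p (path_inv A u p)) (vone u, [])"
proof -
  let ?i = "path_inv A u p" let ?j = "path_inv A v ?i"
  have i: "is_apath A v ?i u" using p by (rule is_apath_inv)
  have j: "is_apath A u ?j v" using i by (rule is_apath_inv)
  have u: "u \<in> gverts A" "v \<in> gverts A" using is_apath_verts[OF p] by auto
  have ji: "path_cong A u u (path_mult A v ?j ?i) (vone u, [])" using i by (rule path_inv_cong)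
  have "path_cong A u v (path_mult A v ?j (path_mult A u ?i p)) (path_mult A v ?j (vone v, []))"
    using j path_inv_cong[OF p] by (rule path_cong_trans_mult)
  moreover have "path_cong A u v (path_mult A u (path_mult A v ?j ?i) p) (path_mult A u (vone u, []) p)"
    using ji p by (rule path_cong_trans_mult)
  moreover have "path_mult A v ?j (path_mult A u ?i p) = path_mult A u (path_mult A v ?j ?i) p"
    using path_mult_assoc[OF j i p] by simp
  moreover have "path_mult A u (vone u, []) p = p" using p by (rule path_mult_one)
  ultimately have jp: "path_cong A u v p (path_mult A v ?j (vone v, []))"
    using path_cong.sym path_cong.trans by metis
  have "path_cong A u u (path_mult A v p ?i) (path_mult A v (path_mult A v ?j (vone v, [])) ?i)"
    using jp i by (rule path_cong_trans_mult)
  also have "path_mult A v (path_mult A v ?j (vone v, [])) ?i = path_mult A v ?j ?i"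
    using path_mult_assoc[OF j is_apath_one[OF u(2)] i] path_mult_one[OF i] by simp
  finally show ?thesis using ji by (rule path_cong.trans)
qed

lemma cong_cancel_left:
  assumes p: "is_apath A u p v" and x: "is_apath A v x w" and y: "is_apath A v y w"
    and c: "path_cong A u w (path_mult A v p x) (path_mult A v p y)"
  shows "path_cong A v w x y"
proof -
  let ?i = "path_inv A u p"
  have i: "is_apath A v ?i u" using p by (rule is_apath_inv)
  have red: "path_cong A v w (path_mult A u ?i (path_mult A v p z)) z" if z: "is_apath A v z w" for z
    using path_cong_trans_mult(1)[OF path_inv_cong[OF p] z] path_mult_assoc[OF i p z] path_mult_one[OF z] by simp
  have "path_cong A v w (path_mult A u ?i (path_mult A v p x)) (path_mult A u ?i (path_mult A v p y))"
    using i c by (rule path_cong_trans_mult)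
  then show ?thesis using red[OF x] red[OF y] path_cong.sym path_cong.trans by metis
qed

lemma tree_act_class:
  assumes q: "is_apath A u0 q u0" and p: "is_apath A u0 p u"
  shows "tree_act (path_class A u0 q) (proj p) = proj (path_mult A u0 q p)"
proof -
  define q' where "q' = (SOME q'. q' \<in> path_class A u0 q)"
  have "q \<in> path_class A u0 q" using q by (simp add: path_class_def path_cong.refl)
  then have "q' \<in> path_class A u0 q" unfolding q'_def by (rule someI)
  then have qq': "path_cong A u0 u0 q q'" by (simp add: path_class_def)
  then have q': "is_apath A u0 q' u0" using path_cong_is_apath by blast
  define p' where "p' = state_path (proj p) (vone u)"
  have w: "proj p \<in> tree_verts" "word_end (proj p) = u" using p proj_in proj_normal by auto
  have p': "is_apath A u0 p' u" "proj p' = proj p" using section_path[OF w(1)] w(2) by (auto simp: p'_def)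
  obtain a where a: "a \<in> vcarrier u" "path_cong A u0 u p (path_mult A u p' (a, []))"
    using proj_eq_iff[OF p'(1) p] p'(2) by auto
  have pa: "is_apath A u (a, []) u" using a(1) is_apath_verts[OF p] by (intro vertex_apath) auto
  have "path_cong A u0 u (path_mult A u0 q p) (path_mult A u0 q' (path_mult A u p' (a, [])))"
    using qq' a(2) by (rule path_cong.mult)
  moreover have "path_mult A u0 q' (path_mult A u p' (a, [])) = path_mult A u (path_mult A u0 q' p') (a, [])"
    using path_mult_assoc[OF q' p'(1) pa] by simp
  ultimately have "proj (path_mult A u0 q' p') = proj (path_mult A u0 q p)"
    using proj_eq_iff[OF is_apath_mult[OF q' p'(1)] is_apath_mult[OF q p]] a(1) by auto
  then show ?thesis unfolding tree_act_def q'_def[symmetric] w(2) p'_def[symmetric] .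
qed

lemma class_mult: "is_apath A u0 p u0 \<Longrightarrow> is_apath A u0 q u0 \<Longrightarrow>
    path_class A u0 p \<otimes>\<^bsub>\<pi>\<^esub> path_class A u0 q = path_class A u0 (path_mult A u0 p q)"
  by (rule pi1_mult_class)

lemma tree_action_BS: "tree_action \<pi> tree_verts tree_adj tree_act"
proof -
  interpret \<pi>: group \<pi> using u0 by (rule group_pi1)
  interpret tree tree_verts tree_adj
    unfolding tree_adj_eq by (rule tree_list_adj) (auto simp: tree_verts_def)
  show ?thesis
  proof
    fix g x assume "g \<in> carrier \<pi>" "x \<in> tree_verts"
    then show "tree_act g x \<in> tree_verts"
      by (elim tree_verts_path) (auto simp: carrier_pi1 tree_act_class intro!: proj_in is_apath_mult)
  next
    fix x assume "x \<in> tree_verts"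
    then show "tree_act \<one>\<^bsub>\<pi>\<^esub> x = x"
      by (elim tree_verts_path) (simp add: one_pi1 tree_act_class is_apath_one u0 path_mult_one)
  next
    fix g h x assume "g \<in> carrier \<pi>" "h \<in> carrier \<pi>" "x \<in> tree_verts"
    then obtain p q r u where p: "is_apath A u0 p u0" "g = path_class A u0 p" and q: "is_apath A u0 q u0" "h = path_class A u0 q"
      and r: "is_apath A u0 r u" "x = proj r"
      by (elim tree_verts_path) (auto simp: carrier_pi1)
    show "tree_act (g \<otimes>\<^bsub>\<pi>\<^esub> h) x = tree_act g (tree_act h x)"
      using p q r path_mult_assoc[OF p(1) q(1) r(1)]
        tree_act_class[OF p(1) is_apath_mult[OF q(1) r(1)]] tree_act_class[OF is_apath_mult[OF p(1) q(1)] r(1)]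
      by (simp add: class_mult tree_act_class)
  next
    fix g x y assume "g \<in> carrier \<pi>" "(x, y) \<in> tree_adj"
    then obtain q p e where q: "is_apath A u0 q u0" "g = path_class A u0 q"
      and e: "e \<in> gedges A" "is_apath A u0 p (org A e)" "x = proj p" "y = proj (append_edge p e)"
      by (auto simp: carrier_pi1 tree_adj_def)
    have "tree_act g x = proj (path_mult A u0 q p)" using q e by (simp add: tree_act_class)
    moreover have "tree_act g y = proj (append_edge (path_mult A u0 q p) e)"
      using q e(4) tree_act_class[OF q(1) append_edge_apath[OF e(1,2)]]
        path_mult_assoc[OF q(1) e(2) edge_path_apath[OF e(1)]] by (simp add: append_edge_def)
    ultimately show "(tree_act g x, tree_act g y) \<in> tree_adj"
      using tree_adjI[OF e(1) is_apath_mult[OF q(1) e(2)]] by simp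
  qed
qed

definition conj_class :: "('e, 'a) apath \<Rightarrow> 'v \<Rightarrow> 'a \<Rightarrow> ('e, 'a) apath set" where
  "conj_class p u a = path_class A u0 (path_conj A u0 p u a)"

lemma path_conj_apath: "is_apath A u0 p u \<Longrightarrow> a \<in> vcarrier u \<Longrightarrow> is_apath A u0 (path_conj A u0 p u a) u0"
  unfolding path_conj_def using is_apath_verts by (intro is_apath_mult is_apath_inv vertex_apath) auto

lemma conj_class_closed: "is_apath A u0 p u \<Longrightarrow> a \<in> vcarrier u \<Longrightarrow> conj_class p u a \<in> carrier \<pi>"
  unfolding carrier_pi1 conj_class_def using path_conj_apath by blast

lemma path_mult_one_right:
  assumes "is_apath A u p v"
  shows "path_mult A v p (vone v, []) = p"
proof -
  have "path_mult A v (b, xs) (vone v, []) = (b, xs)" if "is_apath A u (b, xs) v" for u b xs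
    using that
  proof (induction xs arbitrary: u b)
    case Nil
    then show ?case using vgroup[of v] by (auto simp: is_apath_Nil group.is_monoid)
  next
    case (Cons x xs)
    then show ?case by (cases x) (auto simp: is_apath_Cons)
  qed
  then show ?thesis using assms by (cases p) auto
qed

lemma path_conj_mult:
  assumes p: "is_apath A w p u" and a: "a \<in> vcarrier u"
  shows "path_cong A w u (path_mult A w (path_conj A w p u a) p) (path_mult A u p (a, []))"
proof -
  have pa: "is_apath A u (a, []) u" using a is_apath_verts[OF p] by (intro vertex_apath) auto
  have x: "is_apath A w (path_mult A u p (a, [])) u" using p pa by (rule is_apath_mult)
  have i: "is_apath A u (path_inv A w p) w" using p by (rule is_apath_inv)
  have one: "path_mult A u (path_mult A u p (a, [])) (vone u, []) = path_mult A u p (a, [])"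
    using x by (rule path_mult_one_right)
  have "path_cong A w u (path_mult A u (path_mult A u p (a, [])) (path_mult A w (path_inv A w p) p))
      (path_mult A u (path_mult A u p (a, [])) (vone u, []))"
    using x path_inv_cong[OF p] by (rule path_cong_trans_mult)
  then show ?thesis unfolding path_conj_def one using path_mult_assoc[OF x i p] by simp
qed

lemma cong_conj_iff:
  assumes q: "is_apath A w q w" and p: "is_apath A w p u" and a: "a \<in> vcarrier u"
  shows "path_cong A w u (path_mult A w q p) (path_mult A u p (a, [])) \<longleftrightarrow> path_cong A w w q (path_conj A w p u a)"
proof
  assume "path_cong A w w q (path_conj A w p u a)"
  from path_cong_trans_mult(1)[OF this p] path_conj_mult[OF p a]
  show "path_cong A w u (path_mult A w q p) (path_mult A u p (a, []))" by (rule path_cong.trans)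
next
  assume c: "path_cong A w u (path_mult A w q p) (path_mult A u p (a, []))"
  have i: "is_apath A u (path_inv A w p) w" using p by (rule is_apath_inv)
  have w: "w \<in> gverts A" using is_apath_verts[OF p] by simp
  have "path_cong A w w (path_mult A u (path_mult A w q p) (path_inv A w p)) (path_conj A w p u a)"
    unfolding path_conj_def using c i by (rule path_cong_trans_mult)
  moreover have "path_cong A w w (path_mult A w q (path_mult A u p (path_inv A w p))) (path_mult A w q (vone w, []))"
    using q path_inv_cong_right[OF p] by (rule path_cong_trans_mult)
  moreover have "path_mult A w q (vone w, []) = q" using q by (rule path_mult_one_right)
  ultimately show "path_cong A w w q (path_conj A w p u a)"
    using path_mult_assoc[OF q p i] path_cong.sym path_cong.trans by metis
qed

lemma act_conj_class:
  assumes p: "is_apath A u0 p u" and a: "a \<in> vcarrier u" and r: "is_apath A u r v"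
  shows "tree_act (conj_class p u a) (proj (path_mult A u p r)) = proj (path_mult A u (path_mult A u p (a, [])) r)"
proof -
  let ?c = "path_conj A u0 p u a"
  have c: "is_apath A u0 ?c u0" using p a by (rule path_conj_apath)
  have "tree_act (conj_class p u a) (proj (path_mult A u p r)) = proj (path_mult A u0 ?c (path_mult A u p r))"
    unfolding conj_class_def using c is_apath_mult[OF p r] by (rule tree_act_class)
  also have "path_mult A u0 ?c (path_mult A u p r) = path_mult A u (path_mult A u0 ?c p) r"
    using path_mult_assoc[OF c p r] by simp
  also have "proj \<dots> = proj (path_mult A u (path_mult A u p (a, [])) r)"
    using path_cong_trans_mult(1)[OF path_conj_mult[OF p a] r] by (rule proj_cong)
  finally show ?thesis .
qed

lemma act_conj_class_edge:
  assumes "e \<in> gedges A" "is_apath A u0 p (org A e)" "a \<in> vcarrier (org A e)"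
  shows "tree_act (conj_class p (org A e) a) (proj (append_edge p e)) =
    proj (append_edge (path_mult A (org A e) p (a, [])) e)"
  unfolding append_edge_def using act_conj_class[OF assms(2,3) edge_path_apath[OF assms(1)]] .

lemma conj_class_fixes:
  assumes p: "is_apath A u0 p u" and a: "a \<in> vcarrier u"
  shows "tree_act (conj_class p u a) (proj p) = proj p"
proof -
  have c: "is_apath A u0 (path_conj A u0 p u a) u0" using p a by (rule path_conj_apath)
  have "tree_act (conj_class p u a) (proj p) = proj (path_mult A u0 (path_conj A u0 p u a) p)"
    unfolding conj_class_def using c p by (rule tree_act_class)
  also have "\<dots> = proj p"
    using proj_eq_iff[OF p is_apath_mult[OF c p]] path_conj_mult[OF p a] a by auto
  finally show ?thesis .
qed

lemma stab_path_cong: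
  assumes q: "is_apath A u0 q u0" and p: "is_apath A u0 p u"
    and fix_p: "tree_act (path_class A u0 q) (proj p) = proj p"
  obtains a where "a \<in> vcarrier u" "path_cong A u0 u (path_mult A u0 q p) (path_mult A u p (a, []))"
  using fix_p tree_act_class[OF q p] proj_eq_iff[OF p is_apath_mult[OF q p]] that by auto

lemma stab_conj_class:
  assumes g: "g \<in> carrier \<pi>" and p: "is_apath A u0 p u" and fix_p: "tree_act g (proj p) = proj p"
  obtains a where "a \<in> vcarrier u" "g = conj_class p u a"
proof -
  obtain q where q: "is_apath A u0 q u0" "g = path_class A u0 q" using g carrier_pi1 by auto
  obtain a where a: "a \<in> vcarrier u" "path_cong A u0 u (path_mult A u0 q p) (path_mult A u p (a, []))"
    using stab_path_cong[OF q(1) p] fix_p q(2) by blast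
  then have "path_cong A u0 u0 q (path_conj A u0 p u a)" using cong_conj_iff[OF q(1) p a(1)] by simp
  then have "g = conj_class p u a" unfolding q(2) conj_class_def using path_class_eq_iff[OF q(1)] by simp
  with a(1) that show ?thesis by blast
qed

lemma conj_class_inj:
  assumes p: "is_apath A u0 p u" and a: "a \<in> vcarrier u" "b \<in> vcarrier u" and eq: "conj_class p u a = conj_class p u b"
  shows "a = b"
proof -
  let ?c = "path_conj A u0 p u"
  have u: "u \<in> gverts A" using is_apath_verts[OF p] by simp
  have "path_cong A u0 u0 (?c a) (?c b)"
    using eq path_class_eq_iff[OF path_conj_apath[OF p a(1)]] by (simp add: conj_class_def)
  then have "path_cong A u0 u (path_mult A u0 (?c a) p) (path_mult A u p (b, []))"
    using cong_conj_iff[OF path_conj_apath[OF p a(1)] p a(2)] by simp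
  then have "path_cong A u0 u (path_mult A u p (a, [])) (path_mult A u p (b, []))"
    using path_conj_mult[OF p a(1)] path_cong.sym path_cong.trans by metis
  then have "nf (path_mult A u p (a, [])) = nf (path_mult A u p (b, []))"
    using path_cong_iff_nf path_cong_is_apath by metis
  then have "vmult u (snd (nf p)) a = vmult u (snd (nf p)) b"
    using nf_mult[OF p vertex_apath[OF u]] run_vertex[OF nf_state[OF p]] a by simp
  moreover interpret group "vgroup A u" using u by (rule vgroup)
  have "snd (nf p) \<in> vcarrier u" using nf_state[OF p] by (simp add: state_at_def)
  ultimately show ?thesis using a by simp
qed

lemma conj_class_mult:
  assumes p: "is_apath A u0 p u" and a: "a \<in> vcarrier u" "b \<in> vcarrier u"
  shows "conj_class p u (vmult u a b) = conj_class p u a \<otimes>\<^bsub>\<pi>\<^esub> conj_class p u b"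
proof -
  let ?c = "path_conj A u0 p u"
  have u: "u \<in> gverts A" using is_apath_verts[OF p] by simp
  have ab: "vmult u a b \<in> vcarrier u" using a u by simp
  have ca: "is_apath A u0 (?c a) u0" and cb: "is_apath A u0 (?c b) u0" using p a by (auto intro: path_conj_apath)
  have va: "is_apath A u (a, []) u" and vb: "is_apath A u (b, []) u" using u a by (auto intro: vertex_apath)
  have "path_cong A u0 u (path_mult A u0 (?c a) (path_mult A u0 (?c b) p)) (path_mult A u0 (?c a) (path_mult A u p (b, [])))"
    using ca path_conj_mult[OF p a(2)] by (rule path_cong_trans_mult)
  also have "path_mult A u0 (?c a) (path_mult A u p (b, [])) = path_mult A u (path_mult A u0 (?c a) p) (b, [])"
    using path_mult_assoc[OF ca p vb] by simp
  finally have 1: "path_cong A u0 u (path_mult A u0 (?c a) (path_mult A u0 (?c b) p)) (path_mult A u (path_mult A u0 (?c a) p) (b, []))" .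
  have "path_cong A u0 u (path_mult A u (path_mult A u0 (?c a) p) (b, [])) (path_mult A u (path_mult A u p (a, [])) (b, []))"
    using path_conj_mult[OF p a(1)] vb by (rule path_cong_trans_mult)
  moreover have "path_mult A u (path_mult A u p (a, [])) (b, []) = path_mult A u p (vmult u a b, [])"
    using path_mult_assoc[OF p va vb] by simp
  ultimately have "path_cong A u0 u (path_mult A u0 (path_mult A u0 (?c a) (?c b)) p) (path_mult A u p (vmult u a b, []))"
    using 1 path_mult_assoc[OF ca cb p] path_cong.trans by metis
  then have "path_cong A u0 u0 (path_mult A u0 (?c a) (?c b)) (?c (vmult u a b))"
    using cong_conj_iff[OF is_apath_mult[OF ca cb] p ab] by simp
  then have "path_class A u0 (path_mult A u0 (?c a) (?c b)) = path_class A u0 (?c (vmult u a b))"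
    using path_class_eq_iff[OF is_apath_mult[OF ca cb]] by simp
  then show ?thesis using class_mult[OF ca cb] by (simp add: conj_class_def)
qed

lemma edge_stab:
  assumes e: "e \<in> gedges A" and p: "is_apath A u0 p (org A e)"
  shows "{g \<in> carrier \<pi>. tree_act g (proj p) = proj p \<and> tree_act g (proj (append_edge p e)) = proj (append_edge p e)} =
    conj_class p (org A e) ` edge_image A e"
proof (intro equalityI subsetI)
  fix g assume "g \<in> {g \<in> carrier \<pi>. tree_act g (proj p) = proj p \<and> tree_act g (proj (append_edge p e)) = proj (append_edge p e)}"
  then have g: "g \<in> carrier \<pi>" "tree_act g (proj p) = proj p" "tree_act g (proj (append_edge p e)) = proj (append_edge p e)" by auto
  obtain a where a: "a \<in> vcarrier (org A e)" "g = conj_class p (org A e) a" using stab_conj_class[OF g(1) p g(2)] by blast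
  have "a \<in> edge_image A e"
    using g(3) act_conj_class_edge[OF e p a(1)] proj_append_edge_eq_iff[OF e e HOL.refl p a(1)] a(2) by simp
  with a(2) show "g \<in> conj_class p (org A e) ` edge_image A e" by blast
next
  fix g assume "g \<in> conj_class p (org A e) ` edge_image A e"
  then obtain a where a: "a \<in> edge_image A e" "g = conj_class p (org A e) a" by blast
  have ac: "a \<in> vcarrier (org A e)" using a(1) edge_image_subgroup[OF e] subgroup.subset by blast
  show "g \<in> {g \<in> carrier \<pi>. tree_act g (proj p) = proj p \<and> tree_act g (proj (append_edge p e)) = proj (append_edge p e)}"
    using conj_class_closed[OF p ac] conj_class_fixes[OF p ac] act_conj_class_edge[OF e p ac]
      proj_append_edge_eq_iff[OF e e HOL.refl p ac] a by simp
qed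

subsection \<open>Inversions and acylindricity\<close>

lemma append_edge_back:
  assumes e: "e \<in> gedges A" and p: "is_apath A u p (org A e)" and x: "x \<in> ecarrier e"
  shows "path_cong A u (org A e)
    (append_edge (path_mult A (trg A e) (append_edge p e) (omega A e x, [])) (einv A e))
    (path_mult A (org A e) p (alpha A e x, []))"
proof -
  let ?f = "einv A e"
  have f: "?f \<in> gedges A" "org A ?f = trg A e" "trg A ?f = org A e" using e by auto
  interpret G: group "vgroup A (org A e)" using e by (intro vgroup) auto
  interpret T: group "vgroup A (trg A e)" using e by (intro vgroup) auto
  have c: "omega A e x \<in> vcarrier (trg A e)" using e x by (rule omega_closed)
  have E: "is_apath A (org A e) (edge_path e) (trg A e)" using e by (rule edge_path_apath)
  have F: "is_apath A (trg A e) (edge_path ?f) (org A e)" using edge_path_apath[OF f(1)] f by simp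
  have w: "is_apath A (trg A e) (omega A e x, []) (trg A e)" using e c by (intro vertex_apath) auto
  have "append_edge (path_mult A (trg A e) (append_edge p e) (omega A e x, [])) ?f =
     path_mult A (org A e) p (path_mult A (trg A e) (path_mult A (trg A e) (edge_path e) (omega A e x, [])) (edge_path ?f))"
    using path_mult_assoc[OF p E w] path_mult_assoc[OF p is_apath_mult[OF E w] F] f
    by (simp add: append_edge_def)
  also have "path_mult A (trg A e) (path_mult A (trg A e) (edge_path e) (omega A e x, [])) (edge_path ?f) =
     (vone (org A e), [(e, omega A e x), (?f, vone (org A e))])"
    using c f by (simp add: edge_path_def)
  finally show ?thesis using path_cong_trans_mult(2)[OF p path_cong.base[OF e x]] by simp
qed

lemma append_edge_back_one:
  assumes e: "e \<in> gedges A" and p: "is_apath A u0 p (org A e)"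
  shows "proj (append_edge (append_edge p e) (einv A e)) = proj p"
proof -
  interpret E: group "egroup A e" using e by (rule egroup)
  have "omega A e \<one>\<^bsub>egroup A e\<^esub> = vone (trg A e)"
    using alpha_one[of "einv A e"] e by (simp add: omega_def egroup_inv)
  then show ?thesis
    using proj_cong[OF append_edge_back[OF e p E.one_closed]] alpha_one[OF e]
      path_mult_one_right[OF p] path_mult_one_right[OF append_edge_apath[OF e p]] by simp
qed

text \<open>
  The type of an oriented edge is invariant, and the two orientations have the types \<open>e\<close> and \<open>e\<^sup>-\<^sup>1\<close>.
\<close>

lemma tree_act_no_inversion:
  assumes g: "g \<in> carrier \<pi>" and xy: "(x, y) \<in> tree_adj" and gx: "tree_act g x = y"
  shows "tree_act g y \<noteq> x"
proof
  assume gy: "tree_act g y = x"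
  obtain q where q: "is_apath A u0 q u0" "g = path_class A u0 q" using g carrier_pi1 by auto
  obtain p e where e: "e \<in> gedges A" "is_apath A u0 p (org A e)" "x = proj p" "y = proj (append_edge p e)"
    using xy by (auto simp: tree_adj_def)
  let ?f = "einv A e"
  have f: "?f \<in> gedges A" "org A ?f = trg A e" using e by auto
  define p1 where "p1 = path_mult A u0 q p"
  have p1: "is_apath A u0 p1 (org A e)" unfolding p1_def using q(1) e(2) by (rule is_apath_mult)
  have y1: "proj p1 = y" using gx tree_act_class[OF q(1) e(2)] q(2) e(3) by (simp add: p1_def)
  have x1: "proj (append_edge p1 e) = x"
    using gy tree_act_class[OF q(1) append_edge_apath[OF e(1,2)]] q(2) e(4)
      path_mult_assoc[OF q(1) e(2) edge_path_apath[OF e(1)]] by (simp add: p1_def append_edge_def)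
  define p2 where "p2 = append_edge p e"
  have p2: "is_apath A u0 p2 (trg A e)" unfolding p2_def using e(1,2) by (rule append_edge_apath)
  obtain a where a: "org A e = trg A e" "a \<in> vcarrier (org A e)"
    "path_cong A u0 (trg A e) p2 (path_mult A (org A e) p1 (a, []))"
    using proj_eq_iff[OF p1 p2] y1 e(4) by (auto simp: p2_def)
  have "path_cong A u0 (trg A ?f) (append_edge p2 ?f) (append_edge (path_mult A (org A e) p1 (a, [])) ?f)"
    unfolding append_edge_def f(2) using a(3) edge_path_apath[OF f(1)] f(2) by (simp add: path_cong_trans_mult(1))
  from proj_cong[OF this] have "proj (append_edge (path_mult A (org A ?f) p1 (a, [])) ?f) = proj (append_edge p1 e)"
    using append_edge_back_one[OF e(1,2)] e(3) x1 f(2) a(1) by (simp add: p2_def)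
  then have "?f = e"
    using proj_append_edge_eq_iff[OF f(1) e(1) _, of p1 a] f(2) a(1,2) p1 by simp
  then show False using arev_neq[OF e(1)] by simp
qed

lemma reduced_Cons:
  "reduced A (a, (e, b) # xs) \<longleftrightarrow> reduced A (b, xs) \<and>
    (xs \<noteq> [] \<longrightarrow> fst (hd xs) \<noteq> einv A e \<or> b \<notin> omega A e ` ecarrier e)"
  by (cases xs) (auto simp: reduced_def All_less_Suc2)

text \<open>
  A path that is not reduced at some place gives a walk that backtracks there. The last conjunct
  describes the first step of the walk, which the induction needs to see a backtracking.
\<close>

lemma reduced_walk_lift:
  assumes "walk tree_adj xs" "no_backtrack xs" "is_apath A u0 p u" "hd xs = proj p"
  shows "\<exists>r v. is_apath A u r v \<and> reduced A r \<and> length (snd r) = length xs - 1 \<and>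
    last xs = proj (path_mult A u p r) \<and>
    (snd r \<noteq> [] \<longrightarrow> xs ! 1 = proj (append_edge (path_mult A u p (fst r, [])) (fst (hd (snd r)))))"
  using assms
proof (induction xs arbitrary: p u)
  case (Cons x xs)
  show ?case
  proof (cases xs)
    case Nil
    have "is_apath A u (vone u, []) u" using is_apath_verts[OF Cons.prems(3)] by (intro is_apath_one) simp
    then show ?thesis using Cons.prems Nil path_mult_one_right[OF Cons.prems(3)]
      by (intro exI[of _ "(vone u, [])"] exI[of _ u]) (simp add: reduced_def)
  next
    case (Cons y ys)
    have x: "x = proj p" using Cons.prems(4) by simp
    have "(x, y) \<in> tree_adj" using Cons.prems(1) Cons by simp
    then obtain q e where e: "e \<in> gedges A" "is_apath A u0 q (org A e)" "x = proj q" "y = proj (append_edge q e)"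
      by (auto simp: tree_adj_def)
    obtain a where a: "u = org A e" "a \<in> vcarrier u" "path_cong A u0 u q (path_mult A u p (a, []))"
      using proj_eq_iff[OF Cons.prems(3) e(2)] x e(3) by auto
    interpret G: group "vgroup A (org A e)" using e by (intro vgroup) auto
    interpret T: group "vgroup A (trg A e)" using e by (intro vgroup) auto
    have p: "is_apath A u0 p (org A e)" using Cons.prems(3) a(1) by simp
    have pa: "is_apath A (org A e) (a, []) (org A e)" using a e by (intro vertex_apath) auto
    have ppa: "is_apath A u0 (path_mult A (org A e) p (a, [])) (org A e)" using p pa by (rule is_apath_mult)
    define p1 where "p1 = append_edge (path_mult A (org A e) p (a, [])) e"
    have p1: "is_apath A u0 p1 (trg A e)" unfolding p1_def using e(1) ppa by (rule append_edge_apath)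
    have "path_cong A u0 (trg A e) (append_edge q e) p1"
      unfolding p1_def append_edge_def using a(1,3) edge_path_apath[OF e(1)] by (intro path_cong_trans_mult(1)) simp_all
    from proj_cong[OF this] have y: "y = proj p1" using e(4) by simp
    have "\<exists>r v. is_apath A (trg A e) r v \<and> reduced A r \<and> length (snd r) = length xs - 1 \<and>
      last xs = proj (path_mult A (trg A e) p1 r) \<and>
      (snd r \<noteq> [] \<longrightarrow> xs ! 1 = proj (append_edge (path_mult A (trg A e) p1 (fst r, [])) (fst (hd (snd r)))))"
      using Cons.prems(1,2) Cons y by (intro Cons.IH[OF _ _ p1]) (auto simp: no_backtrack_Cons)
    then obtain r v where r: "is_apath A (trg A e) r v" "reduced A r" "length (snd r) = length xs - 1"
      "last xs = proj (path_mult A (trg A e) p1 r)"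
      "snd r \<noteq> [] \<longrightarrow> xs ! 1 = proj (append_edge (path_mult A (trg A e) p1 (fst r, [])) (fst (hd (snd r))))"
      by (elim exE conjE) (rule that)
    obtain c zs where cz: "r = (c, zs)" by force
    let ?r = "(a, (e, c) # zs)"
    have c: "c \<in> vcarrier (trg A e)" using r(1) cz by (simp add: is_apath_def)
    have r': "is_apath A u ?r v" using r(1) a e(1) cz by (simp add: is_apath_Cons)
    have ae: "is_apath A (org A e) (a, [(e, vone (trg A e))]) (trg A e)" using e a by (intro edge_apath) auto
    have p1_eq: "p1 = path_mult A (org A e) p (a, [(e, vone (trg A e))])"
      unfolding p1_def append_edge_def
      using path_mult_assoc[OF p pa edge_path_apath[OF e(1)]] a by (simp add: edge_path_def)
    have "path_mult A u p ?r = path_mult A (trg A e) p1 r"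
      unfolding p1_eq using path_mult_assoc[OF p ae r(1)] a c by (simp add: cz)
    then have last: "last (x # xs) = proj (path_mult A u p ?r)" using r(4) Cons by simp
    have "reduced A ?r"
      unfolding reduced_Cons
    proof (intro conjI impI)
      show "reduced A (c, zs)" using r(2) cz by simp
      assume zs: "zs \<noteq> []"
      show "fst (hd zs) \<noteq> einv A e \<or> c \<notin> omega A e ` ecarrier e"
      proof (rule ccontr)
        assume "\<not> (fst (hd zs) \<noteq> einv A e \<or> c \<notin> omega A e ` ecarrier e)"
        then obtain z where z: "fst (hd zs) = einv A e" "z \<in> ecarrier e" "c = omega A e z" by auto
        have al: "alpha A e z \<in> vcarrier (org A e)" using e(1) z(2) by (rule alpha_closed)
        have "xs ! 1 = proj (append_edge (path_mult A (trg A e) p1 (omega A e z, [])) (einv A e))"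
          using r(5) zs z cz by simp
        also have "\<dots> = proj (path_mult A (org A e) (path_mult A (org A e) p (a, [])) (alpha A e z, []))"
          unfolding p1_def using append_edge_back[OF e(1) ppa z(2)] by (rule proj_cong)
        also have "path_mult A (org A e) (path_mult A (org A e) p (a, [])) (alpha A e z, []) =
            path_mult A (org A e) p (vmult (org A e) a (alpha A e z), [])"
          using path_mult_assoc[OF p pa, of "(alpha A e z, [])" "org A e"] al e(1) by (simp add: vertex_apath)
        also have "proj \<dots> = proj p"
        proof -
          let ?d = "vmult (org A e) a (alpha A e z)"
          have d: "?d \<in> vcarrier (org A e)" using a al by simp
          have pd: "is_apath A u0 (path_mult A (org A e) p (?d, [])) (org A e)"
            using p e d by (intro is_apath_mult vertex_apath) auto
          show ?thesis using proj_eq_iff[OF p pd] d path_cong.refl[OF pd] by auto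
        qed
        finally have "xs ! 1 = x" using x by simp
        moreover have "length zs = length xs - 1" using r(3) cz by simp
        then have "length xs \<ge> 2" using zs by (cases zs) auto
        ultimately show False using Cons.prems(2) by (auto simp: no_backtrack_Cons)
      qed
    qed
    moreover have "length (snd ?r) = length (x # xs) - 1" using r(3) Cons cz by simp
    moreover have "(x # xs) ! 1 = proj (append_edge (path_mult A u p (fst ?r, [])) (fst (hd (snd ?r))))"
      using y Cons a(1) by (simp add: p1_def)
    ultimately show ?thesis using r' last by blast
  qed
qed simp

text \<open>
  If \<open>g\<close> fixes the vertices of \<open>p\<close> and \<open>p r\<close>, then \<open>g p = p b\<close> and \<open>g p r = p r a\<close> with \<open>a\<close> and \<open>b\<close> in vertex
  groups, so \<open>r a r\<^sup>-\<^sup>1 = b\<close>.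
\<close>

lemma acylindrical_tree_action:
  assumes acyl: "k_acylindrical k A" and k: "k \<ge> 1" and xs: "walk tree_adj xs" "no_backtrack xs" "length xs = Suc k"
    and g: "g \<in> carrier \<pi>" "tree_act g (hd xs) = hd xs" "tree_act g (last xs) = last xs"
  shows "g = \<one>\<^bsub>\<pi>\<^esub>"
proof -
  obtain x y zs where xy: "xs = x # y # zs" using xs(3) k by (cases xs; cases "tl xs") auto
  then have "hd xs \<in> tree_verts" using xs(1) by (auto simp: tree_adj_eq list_adj_def)
  then obtain p u where p: "is_apath A u0 p u" "hd xs = proj p" by (rule tree_verts_path)
  obtain r v where r: "is_apath A u r v" "reduced A r" "length (snd r) = k" "last xs = proj (path_mult A u p r)"
    using reduced_walk_lift[OF xs(1,2) p] unfolding xs(3) diff_Suc_1 by blast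
  obtain q where q: "is_apath A u0 q u0" "g = path_class A u0 q" using g(1) carrier_pi1 by auto
  have pr: "is_apath A u0 (path_mult A u p r) v" using p(1) r(1) by (rule is_apath_mult)
  have uv: "u \<in> gverts A" "v \<in> gverts A" using is_apath_verts[OF r(1)] by auto
  obtain b where b: "b \<in> vcarrier u" "path_cong A u0 u (path_mult A u0 q p) (path_mult A u p (b, []))"
    using stab_path_cong[OF q(1) p(1)] g(2) q(2) p(2) by auto
  obtain a where a: "a \<in> vcarrier v"
    "path_cong A u0 v (path_mult A u0 q (path_mult A u p r)) (path_mult A v (path_mult A u p r) (a, []))"
    using stab_path_cong[OF q(1) pr] g(3) q(2) r(4) by auto
  have va: "is_apath A v (a, []) v" and vb: "is_apath A u (b, []) u" using a b uv by (auto intro: vertex_apath)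
  have br: "is_apath A u (path_mult A u (b, []) r) v" and ra: "is_apath A u (path_mult A v r (a, [])) v"
    using va vb r(1) by (auto intro: is_apath_mult)
  have "path_cong A u0 v (path_mult A u (path_mult A u0 q p) r) (path_mult A u (path_mult A u p (b, [])) r)"
    using b(2) r(1) by (rule path_cong_trans_mult)
  then have "path_cong A u0 v (path_mult A u p (path_mult A u (b, []) r)) (path_mult A u p (path_mult A v r (a, [])))"
    using a(2) path_mult_assoc[OF q(1) p(1) r(1)] path_mult_assoc[OF p(1) vb r(1)] path_mult_assoc[OF p(1) r(1) va]
      path_cong.sym path_cong.trans by metis
  from cong_cancel_left[OF p(1) br ra this]
  have "path_cong A u u (b, []) (path_conj A u r v a)"
    using cong_conj_iff[OF vb r(1) a(1)] by simp
  then have "path_cong A u u (path_conj A u r v a) (b, [])" by (rule path_cong.sym)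
  then have a1: "a = vone v"
    using acyl r(1-3) a(1) b(1) unfolding k_acylindrical_def path_edges_def by (metis length_map)
  have "path_cong A u0 u0 q (path_conj A u0 (path_mult A u p r) v a)"
    using cong_conj_iff[OF q(1) pr a(1)] a(2) by simp
  moreover have "path_cong A u0 u0 (path_conj A u0 (path_mult A u p r) v a) (vone u0, [])"
    unfolding path_conj_def a1 path_mult_one_right[OF pr] using pr by (rule path_inv_cong_right)
  ultimately have "path_cong A u0 u0 q (vone u0, [])" by (rule path_cong.trans)
  then show ?thesis unfolding q(2) one_pi1 using path_class_eq_iff[OF q(1)] by simp
qed

section \<open>The fundamental group\<close>

definition base :: "'v \<Rightarrow> ('e, 'a) apath" where
  "base u = (SOME p. is_apath A u0 p u)"

lemma base_apath: "u \<in> gverts A \<Longrightarrow> is_apath A u0 (base u) u"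
  unfolding base_def using paths_exist by (rule someI_ex)

lemma charted_BS:
  assumes fin: "finite (gedges A)"
    and fg_edges: "\<And>e. e \<in> gedges A \<Longrightarrow> fg_group (egroup A e)"
    and fcip: "\<And>u. u \<in> gverts A \<Longrightarrow> fcip_rel (vgroup A u) (star A u) (edge_image A)"
    and edge_fgip: "\<And>E. E \<in> edge_subgroups A u0 \<Longrightarrow> fgip_rel \<pi> E"
  shows "charted_tree_action \<pi> tree_verts tree_adj tree_act (gverts A) (\<lambda>u. proj (base u)) (vgroup A)
    (\<lambda>u. conj_class (base u) u) (star A) (edge_image A) (\<lambda>e. proj (append_edge (base (org A e)) e))"
proof -
  interpret T: tree_action \<pi> tree_verts tree_adj tree_act by (rule tree_action_BS)
  show ?thesis
  proof (intro charted_tree_action.intro tree_action_BS charted_tree_action_axioms.intro)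
    show "tree_verts \<noteq> {}" by (auto simp: tree_verts_def intro: exI[of _ "[]"])
    fix u assume u: "u \<in> gverts A"
    note p = base_apath[OF u]
    show hom: "group_hom (vgroup A u) \<pi> (conj_class (base u) u)"
      unfolding group_hom_def group_hom_axioms_def
      using vgroup[OF u] T.is_group conj_class_closed[OF p] conj_class_mult[OF p] by (auto intro!: homI)
    show "inj_on (conj_class (base u) u) (vcarrier u)"
      using conj_class_inj[OF p] by (auto intro: inj_onI)
    show "proj (base u) \<in> tree_verts" using p by (rule proj_in)
    show "conj_class (base u) u ` vcarrier u = T.stab (carrier \<pi>) (proj (base u))"
      using conj_class_closed[OF p] conj_class_fixes[OF p] stab_conj_class[OF _ p]
      by (auto simp: T.stab_def) (metis image_eqI)
    show "finite (star A u)" using fin by (simp add: star_def)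
    show "fcip_rel (vgroup A u) (star A u) (edge_image A)" using u by (rule fcip)
    show "\<exists>i\<in>star A u. \<exists>a\<in>vcarrier u. y = tree_act (conj_class (base u) u a) (proj (append_edge (base (org A i)) i))"
      if uy: "(proj (base u), y) \<in> tree_adj" for y
    proof -
      obtain q e where e: "e \<in> gedges A" "is_apath A u0 q (org A e)" "proj (base u) = proj q" "y = proj (append_edge q e)"
        using uy by (auto simp: tree_adj_def)
      obtain a where a: "u = org A e" "a \<in> vcarrier u" "path_cong A u0 u q (path_mult A u (base u) (a, []))"
        using proj_eq_iff[OF p e(2)] e(3) by auto
      have "path_cong A u0 (trg A e) (append_edge q e) (append_edge (path_mult A u (base u) (a, [])) e)"
        unfolding append_edge_def using a(1,3) edge_path_apath[OF e(1)] by (simp add: path_cong_trans_mult(1))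
      from proj_cong[OF this] have "y = tree_act (conj_class (base u) u a) (proj (append_edge (base (org A e)) e))"
        using act_conj_class_edge[OF e(1), of "base u" a] p a e(4) by simp
      then show ?thesis using a e(1) by (auto simp: star_def)
    qed
    fix e assume eu: "e \<in> star A u"
    then have e: "e \<in> gedges A" "org A e = u" by (auto simp: star_def)
    show "(proj (base u), proj (append_edge (base (org A e)) e)) \<in> tree_adj"
      using tree_adjI[OF e(1), of "base u"] p e(2) by simp
    have nadj: "tree_act (conj_class (base u) u a) (proj (append_edge (base (org A e)) e)) = proj (append_edge (base (org A f)) f)
        \<longleftrightarrow> e = f \<and> a \<in> edge_image A e" if "a \<in> vcarrier u" "f \<in> star A u" for a f
      using act_conj_class_edge[OF e(1), of "base u" a] proj_append_edge_eq_iff[OF e(1), of f "base u" a] p e(2) that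
      by (simp add: star_def)
    have "edge_image A e \<subseteq> vcarrier u" using edge_image_subgroup[OF e(1)] e(2) subgroup.subset by blast
    then show "edge_image A e = {a \<in> vcarrier u. tree_act (conj_class (base u) u a) (proj (append_edge (base (org A e)) e)) =
        proj (append_edge (base (org A e)) e)}"
      using nadj[OF _ eu] by auto
    show "e = f" if "f \<in> star A u" "a \<in> vcarrier u"
      "tree_act (conj_class (base u) u a) (proj (append_edge (base (org A e)) e)) = proj (append_edge (base (org A f)) f)" for f a
      using nadj[OF that(2,1)] that(3) by simp
    have "fg_subgroup (egroup A e) (ecarrier e)" using fg_edges[OF e(1)] by (simp add: fg_group_def)
    from group_hom.fg_subgroup_image[OF alpha_hom[OF e(1)] this]
    show "fg_subgroup (vgroup A u) (edge_image A e)" using e(2) by (simp add: edge_image_def)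
  next
    fix x assume "x \<in> tree_verts"
    then obtain p u where p: "is_apath A u0 p u" "x = proj p" by (rule tree_verts_path)
    have u: "u \<in> gverts A" using is_apath_verts[OF p(1)] by simp
    note b = base_apath[OF u]
    have i: "is_apath A u (path_inv A u0 (base u)) u0" using b by (rule is_apath_inv)
    let ?q = "path_mult A u p (path_inv A u0 (base u))"
    have q: "is_apath A u0 ?q u0" using p(1) i by (rule is_apath_mult)
    have "path_cong A u0 u (path_mult A u p (path_mult A u0 (path_inv A u0 (base u)) (base u))) (path_mult A u p (vone u, []))"
      using p(1) path_inv_cong[OF b] by (rule path_cong_trans_mult)
    then have "path_cong A u0 u (path_mult A u0 ?q (base u)) p"
      using path_mult_assoc[OF p(1) i b] path_mult_one_right[OF p(1)] by simp
    from proj_cong[OF this] have "x = tree_act (path_class A u0 ?q) (proj (base u))"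
      using tree_act_class[OF q b] p(2) by simp
    moreover have "path_class A u0 ?q \<in> carrier \<pi>" unfolding carrier_pi1 using q by blast
    ultimately show "\<exists>u\<in>gverts A. \<exists>g\<in>carrier \<pi>. x = tree_act g (proj (base u))" using u by blast
  next
    show "g \<in> carrier \<pi> \<Longrightarrow> (x, y) \<in> tree_adj \<Longrightarrow> tree_act g x = y \<Longrightarrow> tree_act g y \<noteq> x" for g x y
      by (rule tree_act_no_inversion)
  next
    fix x y assume "(x, y) \<in> tree_adj"
    then obtain p e where e: "e \<in> gedges A" "is_apath A u0 p (org A e)" "x = proj p" "y = proj (append_edge p e)"
      by (auto simp: tree_adj_def)
    have "T.stab (carrier \<pi>) x \<inter> T.stab (carrier \<pi>) y = conj_class p (org A e) ` edge_image A e"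
      using edge_stab[OF e(1,2)] e(3,4) by (auto simp: T.stab_def)
    moreover have "conj_class p (org A e) ` edge_image A e \<in> edge_subgroups A u0"
      unfolding edge_subgroups_def conj_class_def using e(1,2) by blast
    ultimately show "fgip_rel \<pi> (T.stab (carrier \<pi>) x \<inter> T.stab (carrier \<pi>) y)" using edge_fgip by simp
  qed
qed

end

theorem theoremF:
  fixes A :: "('v, 'e, 'a, 'b) graph_of_groups" and u0 :: 'v
  assumes "graph_of_groups A"
    and "u0 \<in> gverts A"
    and "core A u0"
    and "finite (gverts A)" and "finite (gedges A)"
    and "\<forall>u\<in>gverts A. fg_group (vgroup A u)"
    and "\<forall>e\<in>gedges A. fg_group (egroup A e)"
    and "\<forall>u\<in>gverts A. fcip_rel (vgroup A u) (star A u) (edge_image A)"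
    and "\<forall>E\<in>edge_subgroups A u0. fgip_rel (pi1 A u0) E"
  shows "((\<forall>u\<in>gverts A. fgip (vgroup A u)) \<longrightarrow> fgip (pi1 A u0)) \<and>
    ((\<forall>u\<in>gverts A. sfgip (vgroup A u)) \<and> acylindrical A \<longrightarrow> sfgip (pi1 A u0))"
proof -
  interpret graph_of_groups A by fact
  have paths: "\<exists>p. is_apath A u0 p v" if v: "v \<in> gverts A" for v
  proof -
    obtain p where p: "is_apath A u0 p u0" "v \<in> set (awalk_verts u0 (path_edges p))"
      using \<open>core A u0\<close> v unfolding core_def by blast
    \<comment> \<open>Being core makes the graph connected; any path in it carries an \<open>\<A>\<close>-path with trivial letters.\<close>
    have "awalk u0 (path_edges p) u0" using p(1) by (simp add: is_apath_def)
    then obtain es where es: "awalk u0 es v" using p(2) awalk_decomp by blast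
    define q where "q = (\<one>\<^bsub>vgroup A u0\<^esub>, map (\<lambda>e. (e, \<one>\<^bsub>vgroup A (trg A e)\<^esub>)) es)"
    have "path_edges q = es" by (simp add: q_def path_edges_def comp_def)
    moreover have "set es \<subseteq> gedges A" using es by (auto simp: awalk_def)
    ultimately have "is_apath A u0 q v" using es \<open>u0 \<in> gverts A\<close> by (auto simp: is_apath_def q_def)
    then show ?thesis by blast
  qed
  interpret based_graph_of_groups A u0
    using \<open>u0 \<in> gverts A\<close> paths by unfold_locales
  interpret charted_tree_action "pi1 A u0" tree_verts tree_adj tree_act "gverts A" "\<lambda>u. proj (base u)" "vgroup A"
    "\<lambda>u. conj_class (base u) u" "star A" "edge_image A" "\<lambda>e. proj (append_edge (base (org A e)) e)"
    using assms(5,7,8,9) by (intro charted_BS) auto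
  show ?thesis
  proof (intro conjI impI)
    assume "\<forall>u\<in>gverts A. fgip (vgroup A u)"
    then show "fgip (pi1 A u0)" by (intro fgip_if_vertex_groups_fgip) auto
  next
    assume s: "(\<forall>u\<in>gverts A. sfgip (vgroup A u)) \<and> acylindrical A"
    then obtain k where "k_acylindrical k A" "k \<ge> 1" by (auto simp: acylindrical_def)
    then show "sfgip (pi1 A u0)"
      using s by (intro sfgip_if_vertex_groups_sfgip[of k] acylindrical_tree_action) auto
  qed
qed

end
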